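(* Let $\mathfrak s$ be a completely solvable Lie algebra with an inner product. Then any modification of $\mathfrak s$ (in its isometry algebra) is a normal modification.
   Context: Lie algebras are real and finite-dimensional. A solvable Lie algebra $\mathfrak g$ is completely solvable if $\mathrm{ad}_X:\mathfrak g\to\mathfrak g$ has only real eigenvalues for every $X\in\mathfrak g$. Let $S$ be the simply-connected Lie group with Lie algebra $\mathfrak s$, equipped with the left-invariant metric $g$ determined by the inner product on $\mathfrak s$. Identify $S$ with the group of left translations in $\mathrm{Isom}(S,g)$; thus $\mathfrak s$ is a subalgebra of the isometry algebra $\mathrm{Lie}\,\mathrm{Isom}(S,g)$. Let $\mathfrak l$ be the isotropy (stabilizer) subalgebra at the identity $e\in S$, and $N_{\mathfrak l}(\mathfrak s)=\{Z\in\mathfrak l : [Z,\mathfrak s]\subset\mathfrak s\}$. A modification of $\mathfrak s$ is a Lie subalgebra $\mathfrak r$ of the isometry algebra of the form $\mathfrak r=(\mathrm{id}+\varphi)(\mathfrak s)=\{X+\varphi(X): X\in\mathfrak s\}$, where $\varphi:\mathfrak s\to N_{\mathfrak l}(\mathfrak s)$ is a linear map. The modification $\mathfrak r$ is called normal if $\mathfrak s$ normalizes $\mathfrak r$, i.e. $[\mathfrak s,\mathfrak r]\subset \mathfrak r$. *)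

theory Defs
  imports "HOL-Analysis.Analysis"
begin

section \<open>Abstract Lie algebras\<close>

definition lie_algebra :: "('s::real_vector \<Rightarrow> 's \<Rightarrow> 's) \<Rightarrow> bool" where
  "lie_algebra br \<longleftrightarrow>
     (\<forall>x. linear (br x)) \<and> (\<forall>y. linear (\<lambda>x. br x y)) \<and>
     (\<forall>x. br x x = 0) \<and>
     (\<forall>x y z. br x (br y z) + br y (br z x) + br z (br x y) = 0)"

primrec derived_series :: "('s::real_vector \<Rightarrow> 's \<Rightarrow> 's) \<Rightarrow> nat \<Rightarrow> 's set" where
  "derived_series br 0 = UNIV"
| "derived_series br (Suc k) =
     span {br x y |x y. x \<in> derived_series br k \<and> y \<in> derived_series br k}"

definition solvable :: "('s::real_vector \<Rightarrow> 's \<Rightarrow> 's) \<Rightarrow> bool" where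
  "solvable br \<longleftrightarrow> (\<exists>k. derived_series br k = {0})"

text \<open>
  An eigenvalue of the complexification of a real operator \<open>T\<close>: the condition is
  \<open>T (x + i y) = \<mu> (x + i y)\<close> with \<open>x + i y \<noteq> 0\<close>, split into real and imaginary parts.
\<close>
definition complex_eigenvalue :: "('s::real_vector \<Rightarrow> 's) \<Rightarrow> complex \<Rightarrow> bool" where
  "complex_eigenvalue T \<mu> \<longleftrightarrow>
     (\<exists>x y. (x \<noteq> 0 \<or> y \<noteq> 0) \<and>
            T x = Re \<mu> *\<^sub>R x - Im \<mu> *\<^sub>R y \<and>
            T y = Im \<mu> *\<^sub>R x + Re \<mu> *\<^sub>R y)"

definition completely_solvable :: "('s::real_vector \<Rightarrow> 's \<Rightarrow> 's) \<Rightarrow> bool" where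
  "completely_solvable br \<longleftrightarrow>
     solvable br \<and> (\<forall>x \<mu>. complex_eigenvalue (br x) \<mu> \<longrightarrow> \<mu> \<in> \<real>)"


section \<open>Smooth manifolds\<close>

text \<open>
  \<open>Ck_on k f U\<close> and \<open>smooth_on f U\<close> are only used for open \<open>U\<close>.
\<close>
primrec Ck_on ::
  "nat \<Rightarrow> ('a::euclidean_space \<Rightarrow> 'b::real_normed_vector) \<Rightarrow> 'a set \<Rightarrow> bool" where
  "Ck_on 0 f U \<longleftrightarrow> continuous_on U f"
| "Ck_on (Suc k) f U \<longleftrightarrow>
     (\<forall>x\<in>U. f differentiable (at x)) \<and>
     (\<forall>v. Ck_on k (\<lambda>x. frechet_derivative f (at x) v) U)"

definition smooth_on ::
  "('a::euclidean_space \<Rightarrow> 'b::real_normed_vector) \<Rightarrow> 'a set \<Rightarrow> bool" where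
  "smooth_on f U \<longleftrightarrow> (\<forall>k. Ck_on k f U)"

type_synonym ('m, 'e) atlas = "('m set \<times> ('m \<Rightarrow> 'e)) set"

definition smooth_atlas :: "('m::topological_space, 'e::euclidean_space) atlas \<Rightarrow> bool" where
  "smooth_atlas A \<longleftrightarrow>
     (\<Union>(U, \<kappa>)\<in>A. U) = UNIV \<and>
     (\<forall>(U, \<kappa>)\<in>A. open U \<and> open (\<kappa> ` U) \<and> homeomorphism U (\<kappa> ` U) \<kappa> (inv_into U \<kappa>)) \<and>
     (\<forall>(U, \<kappa>)\<in>A. \<forall>(V, \<eta>)\<in>A. smooth_on (\<eta> \<circ> inv_into U \<kappa>) (\<kappa> ` (U \<inter> V)))"

definition real_atlas :: "(real, real) atlas" where
  "real_atlas = {(UNIV, id)}"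

definition prod_atlas :: "('m, 'e) atlas \<Rightarrow> ('n, 'f) atlas \<Rightarrow> ('m \<times> 'n, 'e \<times> 'f) atlas" where
  "prod_atlas A B = {(U \<times> V, map_prod \<kappa> \<eta>) |U \<kappa> V \<eta>. (U, \<kappa>) \<in> A \<and> (V, \<eta>) \<in> B}"

definition smooth_map ::
  "('m::topological_space, 'e::euclidean_space) atlas \<Rightarrow>
   ('n::topological_space, 'f::euclidean_space) atlas \<Rightarrow> ('m \<Rightarrow> 'n) \<Rightarrow> bool" where
  "smooth_map A B F \<longleftrightarrow>
     continuous_on UNIV F \<and>
     (\<forall>(U, \<kappa>)\<in>A. \<forall>(V, \<eta>)\<in>B. smooth_on (\<eta> \<circ> F \<circ> inv_into U \<kappa>) (\<kappa> ` (U \<inter> F -` V)))"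

definition smooth_near ::
  "('m::topological_space, 'e::euclidean_space) atlas \<Rightarrow> 'm \<Rightarrow> ('m \<Rightarrow> real) \<Rightarrow> bool" where
  "smooth_near A p f \<longleftrightarrow>
     (\<exists>W. open W \<and> p \<in> W \<and> (\<forall>(U, \<kappa>)\<in>A. smooth_on (f \<circ> inv_into U \<kappa>) (\<kappa> ` (U \<inter> W))))"


section \<open>Tangent vectors and vector fields\<close>

text \<open>
  A tangent vector at \<open>p\<close> is a directional derivative at \<open>p\<close>, acting on the functions that are
  smooth near \<open>p\<close>. Tangent vectors are made extensional by the value \<open>0\<close> on all
  other functions, so that equality of functionals is equality of tangent vectors; the
  guards \<open>if smooth_near \<dots> else 0\<close> below serve the same purpose.
\<close>
type_synonym 'm tvec = "('m \<Rightarrow> real) \<Rightarrow> real"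

type_synonym 'm vfield = "'m \<Rightarrow> 'm tvec"

definition tangent_space ::
  "('m::topological_space, 'e::euclidean_space) atlas \<Rightarrow> 'm \<Rightarrow> 'm tvec set" where
  "tangent_space A p =
     {(\<lambda>f. if smooth_near A p f then frechet_derivative (f \<circ> inv_into U \<kappa>) (at (\<kappa> p)) w else 0)
        |U \<kappa> w. (U, \<kappa>) \<in> A \<and> p \<in> U}"

text \<open>The differential \<open>dF\<^sub>p\<close> applied to the tangent vector \<open>v\<close> at \<open>p\<close>.\<close>
definition push ::
  "('m::topological_space, 'e::euclidean_space) atlas \<Rightarrow> ('m \<Rightarrow> 'm) \<Rightarrow> 'm \<Rightarrow> 'm tvec \<Rightarrow> 'm tvec"
  where
  "push A F p v = (\<lambda>f. if smooth_near A (F p) f then v (f \<circ> F) else 0)"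

definition vf_zero :: "'m vfield" where
  "vf_zero = (\<lambda>p f. 0)"

definition vf_add :: "'m vfield \<Rightarrow> 'm vfield \<Rightarrow> 'm vfield" where
  "vf_add X Y = (\<lambda>p f. X p f + Y p f)"

definition vf_scale :: "real \<Rightarrow> 'm vfield \<Rightarrow> 'm vfield" where
  "vf_scale c X = (\<lambda>p f. c * X p f)"

definition vf_bracket ::
  "('m::topological_space, 'e::euclidean_space) atlas \<Rightarrow> 'm vfield \<Rightarrow> 'm vfield \<Rightarrow> 'm vfield" where
  "vf_bracket A X Y =
     (\<lambda>p f. if smooth_near A p f then X p (\<lambda>q. Y q f) - Y p (\<lambda>q. X q f) else 0)"


section \<open>Lie algebras of transformation groups\<close>

definition one_parameter_group ::
  "('m::topological_space, 'e::euclidean_space) atlas \<Rightarrow> ('m \<Rightarrow> 'm) set \<Rightarrow>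
   (real \<Rightarrow> 'm \<Rightarrow> 'm) \<Rightarrow> bool" where
  "one_parameter_group A H \<theta> \<longleftrightarrow>
     smooth_map (prod_atlas real_atlas A) A (\<lambda>(t, p). \<theta> t p) \<and>
     \<theta> 0 = id \<and> (\<forall>s t. \<theta> (s + t) = \<theta> s \<circ> \<theta> t) \<and> (\<forall>t. \<theta> t \<in> H)"

definition generator ::
  "('m::topological_space, 'e::euclidean_space) atlas \<Rightarrow> (real \<Rightarrow> 'm \<Rightarrow> 'm) \<Rightarrow> 'm vfield" where
  "generator A \<theta> = (\<lambda>p f. if smooth_near A p f then deriv (\<lambda>t. f (\<theta> t p)) 0 else 0)"

text \<open>
  The Lie algebra of a Lie group \<open>H\<close> of diffeomorphisms: an element of the Lie algebra is
  a one-parameter subgroup of \<open>H\<close>, represented by its infinitesimal generator.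
  For a left action \<open>Z \<mapsto> generator (\<lambda>t. exp (t Z))\<close> is an anti-homomorphism from the Lie
  algebra of \<open>H\<close> to the vector fields, so the Lie bracket of \<open>H\<close> is minus the
  bracket of vector fields.
\<close>
definition lie_of ::
  "('m::topological_space, 'e::euclidean_space) atlas \<Rightarrow> ('m \<Rightarrow> 'm) set \<Rightarrow> 'm vfield set" where
  "lie_of A H = {generator A \<theta> |\<theta>. one_parameter_group A H \<theta>}"

definition transf_bracket ::
  "('m::topological_space, 'e::euclidean_space) atlas \<Rightarrow> 'm vfield \<Rightarrow> 'm vfield \<Rightarrow> 'm vfield" where
  "transf_bracket A X Y = vf_scale (- 1) (vf_bracket A X Y)"


section \<open>Lie groups\<close>

record ('g, 's) lie_group_data =
  charts :: "('g, 's) atlas"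
  gmul :: "'g \<Rightarrow> 'g \<Rightarrow> 'g"
  gone :: 'g
  ginv :: "'g \<Rightarrow> 'g"

definition lie_group ::
  "('g::{t2_space, second_countable_topology}, 's::euclidean_space) lie_group_data \<Rightarrow> bool" where
  "lie_group G \<longleftrightarrow>
     smooth_atlas (charts G) \<and>
     Groups.group (gmul G) (gone G) (ginv G) \<and>
     smooth_map (prod_atlas (charts G) (charts G)) (charts G) (\<lambda>(x, y). gmul G x y) \<and>
     smooth_map (charts G) (charts G) (ginv G)"

definition left_invariant_field ::
  "('g::topological_space, 's::euclidean_space) lie_group_data \<Rightarrow> 'g tvec \<Rightarrow> 'g vfield" where
  "left_invariant_field G v = (\<lambda>p. push (charts G) (\<lambda>x. gmul G p x) (gone G) v)"

text \<open>
  \<open>\<iota>\<close> identifies the Lie algebra \<open>('s, br)\<close> with the Lie algebra of \<open>G\<close>, that is, with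
  the tangent space at the identity under the bracket of left-invariant vector fields.
\<close>
definition has_lie_algebra ::
  "('g::topological_space, 's::euclidean_space) lie_group_data \<Rightarrow> ('s \<Rightarrow> 's \<Rightarrow> 's) \<Rightarrow>
   ('s \<Rightarrow> 'g tvec) \<Rightarrow> bool" where
  "has_lie_algebra G br \<iota> \<longleftrightarrow>
     bij_betw \<iota> UNIV (tangent_space (charts G) (gone G)) \<and>
     (\<forall>u v f. \<iota> (u + v) f = \<iota> u f + \<iota> v f) \<and>
     (\<forall>c u f. \<iota> (c *\<^sub>R u) f = c * \<iota> u f) \<and>
     (\<forall>u v. vf_bracket (charts G) (left_invariant_field G (\<iota> u)) (left_invariant_field G (\<iota> v)) =
            left_invariant_field G (\<iota> (br u v)))"


section \<open>The left-invariant metric and its isometry algebra\<close>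

text \<open>
  The inner product on the Lie algebra is that of the type \<open>'s\<close>; every finite-dimensional
  inner product space of positive dimension is isometric to such a type. The metric at
  \<open>p\<close> is obtained by moving tangent vectors to the identity with the left translation by the
  inverse of \<open>p\<close>.
\<close>
definition left_metric ::
  "('g::topological_space, 's::euclidean_space) lie_group_data \<Rightarrow> ('s \<Rightarrow> 'g tvec) \<Rightarrow>
   'g \<Rightarrow> 'g tvec \<Rightarrow> 'g tvec \<Rightarrow> real" where
  "left_metric G \<iota> p v w =
     (let to_e = (\<lambda>z. inv \<iota> (push (charts G) (\<lambda>x. gmul G (ginv G p) x) p z))
      in to_e v \<bullet> to_e w)"

definition isometries ::
  "('g::topological_space, 's::euclidean_space) lie_group_data \<Rightarrow> ('s \<Rightarrow> 'g tvec) \<Rightarrow>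
   ('g \<Rightarrow> 'g) set" where
  "isometries G \<iota> =
     {F. bij F \<and> smooth_map (charts G) (charts G) F \<and> smooth_map (charts G) (charts G) (inv F) \<and>
         (\<forall>p. \<forall>v\<in>tangent_space (charts G) p. \<forall>w\<in>tangent_space (charts G) p.
            left_metric G \<iota> (F p) (push (charts G) F p v) (push (charts G) F p w) =
            left_metric G \<iota> p v w)}"

definition isometry_algebra ::
  "('g::topological_space, 's::euclidean_space) lie_group_data \<Rightarrow> ('s \<Rightarrow> 'g tvec) \<Rightarrow>
   'g vfield set" where
  "isometry_algebra G \<iota> = lie_of (charts G) (isometries G \<iota>)"

definition isotropy_algebra ::
  "('g::topological_space, 's::euclidean_space) lie_group_data \<Rightarrow> ('s \<Rightarrow> 'g tvec) \<Rightarrow>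
   'g vfield set" where
  "isotropy_algebra G \<iota> = lie_of (charts G) {F \<in> isometries G \<iota>. F (gone G) = gone G}"

text \<open>
  The embedding of the Lie algebra of \<open>G\<close> into the isometry algebra induced by
  letting \<open>G\<close> act on itself by left translations: its value at \<open>p\<close> is the differential of
  the orbit map \<open>x \<mapsto> x p\<close> at the identity (so it is a right-invariant vector field).
\<close>
definition translation_field ::
  "('g::topological_space, 's::euclidean_space) lie_group_data \<Rightarrow> ('s \<Rightarrow> 'g tvec) \<Rightarrow>
   's \<Rightarrow> 'g vfield" where
  "translation_field G \<iota> u = (\<lambda>p. push (charts G) (\<lambda>x. gmul G x p) (gone G) (\<iota> u))"

definition normalizer_in_isotropy ::
  "('g::topological_space, 's::euclidean_space) lie_group_data \<Rightarrow> ('s \<Rightarrow> 'g tvec) \<Rightarrow>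
   'g vfield set" where
  "normalizer_in_isotropy G \<iota> =
     {Z \<in> isotropy_algebra G \<iota>. \<forall>X\<in>range (translation_field G \<iota>).
        transf_bracket (charts G) Z X \<in> range (translation_field G \<iota>)}"


section \<open>Modifications\<close>

definition lie_subalgebra_of_isometries ::
  "('g::topological_space, 's::euclidean_space) lie_group_data \<Rightarrow> ('s \<Rightarrow> 'g tvec) \<Rightarrow>
   'g vfield set \<Rightarrow> bool" where
  "lie_subalgebra_of_isometries G \<iota> R \<longleftrightarrow>
     R \<subseteq> isometry_algebra G \<iota> \<and>
     vf_zero \<in> R \<and>
     (\<forall>X\<in>R. \<forall>Y\<in>R. vf_add X Y \<in> R) \<and>
     (\<forall>c. \<forall>X\<in>R. vf_scale c X \<in> R) \<and>
     (\<forall>X\<in>R. \<forall>Y\<in>R. transf_bracket (charts G) X Y \<in> R)"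

definition modification ::
  "('g::topological_space, 's::euclidean_space) lie_group_data \<Rightarrow> ('s \<Rightarrow> 'g tvec) \<Rightarrow>
   'g vfield set \<Rightarrow> bool" where
  "modification G \<iota> R \<longleftrightarrow>
     lie_subalgebra_of_isometries G \<iota> R \<and>
     (\<exists>\<phi>. (\<forall>u. \<phi> u \<in> normalizer_in_isotropy G \<iota>) \<and>
          (\<forall>u v. \<phi> (u + v) = vf_add (\<phi> u) (\<phi> v)) \<and>
          (\<forall>c u. \<phi> (c *\<^sub>R u) = vf_scale c (\<phi> u)) \<and>
          R = {vf_add (translation_field G \<iota> u) (\<phi> u) |u. True})"

definition normal_modification ::
  "('g::topological_space, 's::euclidean_space) lie_group_data \<Rightarrow> ('s \<Rightarrow> 'g tvec) \<Rightarrow>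
   'g vfield set \<Rightarrow> bool" where
  "normal_modification G \<iota> R \<longleftrightarrow>
     modification G \<iota> R \<and>
     (\<forall>X\<in>range (translation_field G \<iota>). \<forall>Y\<in>R. transf_bracket (charts G) X Y \<in> R)"

end

theory Submission
  imports Defs "HOL-Computational_Algebra.Fundamental_Theorem_Algebra"
begin

text \<open>
  Write \<open>D\<^sub>X\<close> for the bracket with \<open>\<phi> X\<close>. Each \<open>D\<^sub>X\<close> is a skew derivation of the Lie algebra, and
  closure of the modification under brackets says
  \<open>D\<^sub>Z = [D\<^sub>X, D\<^sub>Y]\<close> for \<open>Z = [X, Y] + D\<^sub>X Y - D\<^sub>Y X\<close>. Normality means \<open>\<phi> W = 0\<close> for all
  \<open>W = [X, Y] - D\<^sub>Y X\<close>.

  If \<open>D\<^sub>X X = 0\<close>, then \<open>ad X\<close> and \<open>D\<^sub>X\<close> commute; one has real and the other imaginary eigenvalues,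
  so that they can be separated inside \<open>ad X + D\<^sub>X\<close>, and \<open>D\<^sub>W = 0\<close> follows for this \<open>X\<close>. An
  induction up the derived series \<open>S\<^sub>j\<close> shows that such \<open>X\<close>, together with the kernel of \<open>D\<close>,
  span everything: modulo \<open>S\<^sub>j\<^sub>+\<^sub>1\<close>, the space \<open>S\<^sub>j\<close> is spanned by eigenvectors of the invariant form
  \<open>- tr (D\<^sub>X D\<^sub>Y)\<close>, which can be corrected within \<open>S\<^sub>j\<^sub>+\<^sub>1\<close> to satisfy \<open>D\<^sub>X X = 0\<close>.

  Finally \<open>D\<^sub>W = 0\<close> implies \<open>\<phi> W = 0\<close>: a vector field that vanishes at the identity and commutes with
  all translation fields satisfies a homogeneous linear first order system, hence is zero.
\<close>

section \<open>Quadratic forms and operators with real or imaginary spectrum\<close>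

text \<open>Separation rests on this: if \<open>K\<close> is skew and commutes with \<open>N\<close>
  of real spectrum, a complex eigenvector of \<open>N + K\<close> for \<open>a + i b\<close> is an
  eigenvector of \<open>K\<close> for \<open>i b\<close>. The obstacle is that \<open>br X\<close>
  and \<open>D X\<close> do not commute in general; their commutator is \<open>- br (D X X)\<close>.
  Hence the spectral lemmas are stated modulo invariant subspaces, and the induction carries a
  second inclusion, of \<open>S (Suc j)\<close> in \<open>ker\<close>. Once \<open>D X X\<close>
  lies in \<open>S (Suc j)\<close>, bracketing with it takes \<open>S (Suc j)\<close> into
  \<open>S (Suc (Suc j))\<close>, already inside \<open>ker\<close>, so the commutator does no harm
  there. That \<open>D X X\<close> lies in \<open>S (Suc j)\<close> comes from invariance:
  \<open>form X\<close> vanishes on \<open>br X Y + D X Y - D Y X\<close>. For an eigenvector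
  \<open>X\<close> outside \<open>ker\<close> and \<open>S (Suc j)\<close> the inner product of the
  quotient vanishes there too; skewness disposes of \<open>D Y X\<close>, and \<open>D X X\<close>
  is congruent to 0. Neither complexifications nor quotient spaces are formed: complex vectors are
  pairs, congruences are memberships in a subspace, and quotients are represented by orthogonal
  complements.\<close>

lemma semidefinite_form_null_vector:
  fixes g :: "'a::real_vector \<Rightarrow> 'a \<Rightarrow> real"
  assumes g: "bilinear g" and sym: "\<And>x y. g x y = g y x"
    and S: "subspace S" and psd: "\<And>x. x \<in> S \<Longrightarrow> 0 \<le> g x x"
    and x: "x \<in> S" "g x x = 0" and y: "y \<in> S"
  shows "g x y = 0"
proof (rule ccontr)
  assume ne: "g x y \<noteq> 0"
  define t where "t = - (g y y + 1) / (2 * g x y)"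
  have "0 \<le> g (t *\<^sub>R x + y) (t *\<^sub>R x + y)"
    using psd S x y by (simp add: subspace_add subspace_scale)
  also have "\<dots> = 2 * t * g x y + g y y"
    using x(2) sym[of y x]
    by (simp add: bilinear_ladd[OF g] bilinear_radd[OF g] bilinear_lmul[OF g] bilinear_rmul[OF g])
  also have "\<dots> = - 1"
    using ne by (simp add: t_def field_simps)
  finally show False by simp
qed

lemma continuous_on_quadratic_form:
  fixes h :: "'a::euclidean_space \<Rightarrow> 'a \<Rightarrow> real"
  assumes "bilinear h"
  shows "continuous_on A (\<lambda>x. h x x)"
proof -
  interpret bounded_bilinear h
    using assms bilinear_conv_bounded_bilinear by blast
  show ?thesis by (intro continuous_on continuous_on_id)
qed

text \<open>The null vectors of \<open>g\<close> in \<open>S\<close> count as eigenvectors as well.\<close>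
lemma pencil_spectral:
  fixes g h :: "'a::euclidean_space \<Rightarrow> 'a \<Rightarrow> real"
  assumes g: "bilinear g" and gsym: "\<And>x y. g x y = g y x"
    and h: "bilinear h" and hsym: "\<And>x y. h x y = h y x"
    and S: "subspace S" and psd: "\<And>x. x \<in> S \<Longrightarrow> 0 \<le> g x x"
    and ker: "\<And>x y. x \<in> S \<Longrightarrow> y \<in> S \<Longrightarrow> g x x = 0 \<Longrightarrow> h x y = 0"
  shows "S \<subseteq> span {x \<in> S. \<exists>l. \<forall>y\<in>S. h x y = l * g x y}"
  using S psd ker
proof (induction "dim S" arbitrary: S rule: less_induct)
  case less
  note S = less.prems(1) and psd = less.prems(2) and ker = less.prems(3)
  show ?case
  proof (cases "S \<subseteq> {0}")
    case True
    then show ?thesis using span_0 by auto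
  next
    case False
    \<comment> \<open>The functional \<open>c\<close> splits off \<open>x0\<close>: its kernel in
      \<open>S\<close> is a complement of \<open>x0\<close> on which \<open>g x0\<close> vanishes. A
      null vector has \<open>g x0\<close> zero on \<open>S\<close>, so there \<open>c\<close> is the
      inner product with \<open>x0\<close>; otherwise \<open>c\<close> is \<open>g x0\<close>
      itself.\<close>
    have "\<exists>x0\<in>S. \<exists>l. \<exists>c. linear c \<and> c x0 \<noteq> (0::real) \<and> (\<forall>y\<in>S. h x0 y = l * g x0 y) \<and>
            (\<forall>y\<in>S. c y = 0 \<longrightarrow> g x0 y = 0)"
    proof (cases "\<exists>x\<in>S. x \<noteq> 0 \<and> g x x = 0")
      case True
      then obtain x0 where x0: "x0 \<in> S" "x0 \<noteq> 0" "g x0 x0 = 0" by blast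
      have "g x0 y = 0" if "y \<in> S" for y
        using semidefinite_form_null_vector[OF g gsym S psd x0(1) x0(3) that] .
      then have "linear ((\<bullet>) x0) \<and> x0 \<bullet> x0 \<noteq> 0 \<and> (\<forall>y\<in>S. h x0 y = 0 * g x0 y) \<and>
            (\<forall>y\<in>S. x0 \<bullet> y = 0 \<longrightarrow> g x0 y = 0)"
        using x0 ker by (auto simp: linear_iff inner_right_distrib)
      then show ?thesis using x0 by blast
    next
      case False
      have pos: "0 < g x x" if "x \<in> S" "x \<noteq> 0" for x
        using psd[OF that(1)] False that by force
      define U where "U = S \<inter> sphere 0 1"
      have "compact U"
        unfolding U_def using closed_subspace[OF S] by (metis closed_Int_compact compact_sphere)
      moreover have "U \<noteq> {}"
      proof -
        obtain x where "x \<in> S" "x \<noteq> 0" using \<open>\<not> S \<subseteq> {0}\<close> by auto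
        then have "(1 / norm x) *\<^sub>R x \<in> U" unfolding U_def using S by (auto intro: subspace_scale)
        then show ?thesis by blast
      qed
      moreover have "continuous_on U (\<lambda>x. h x x / g x x)"
        using pos by (intro continuous_on_divide continuous_on_quadratic_form g h)
           (force simp: U_def)
      ultimately obtain x0 where x0: "x0 \<in> U" "\<And>x. x \<in> U \<Longrightarrow> h x x / g x x \<le> h x0 x0 / g x0 x0"
        using continuous_attains_sup[of U "\<lambda>x. h x x / g x x"] by blast
      define l where "l = h x0 x0 / g x0 x0"
      have x0S: "x0 \<in> S" "x0 \<noteq> 0" using x0 by (auto simp: U_def)
      \<comment> \<open>\<open>l\<close> is the maximum of the Rayleigh quotient, so
        \<open>q\<close> is semidefinite on \<open>S\<close> with null vector \<open>x0\<close>;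
        that \<open>q x0\<close> vanishes on \<open>S\<close> is the eigenvalue equation.\<close>
      define q where "q = (\<lambda>x y. l * g x y - h x y)"
      have q: "bilinear q"
        unfolding q_def bilinear_def
        by (auto intro!: linearI simp: bilinear_ladd[OF g] bilinear_radd[OF g] bilinear_lmul[OF g]
            bilinear_rmul[OF g] bilinear_ladd[OF h] bilinear_radd[OF h] bilinear_lmul[OF h]
            bilinear_rmul[OF h] algebra_simps)
      have "0 \<le> q x x" if "x \<in> S" for x
      proof (cases "x = 0")
        case True
        then show ?thesis by (simp add: bilinear_lzero[OF q])
      next
        case False
        define e where "e = (1 / norm x) *\<^sub>R x"
        have "e \<in> U" unfolding U_def e_def using S that False by (auto intro: subspace_scale)
        then have "h e e / g e e \<le> l" using x0(2) by (simp add: l_def)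
        moreover have "g e e > 0" using pos[of e] \<open>e \<in> U\<close> by (force simp: U_def)
        ultimately have "0 \<le> q e e" by (simp add: q_def divide_simps)
        moreover have "x = norm x *\<^sub>R e" using False by (simp add: e_def)
        then have "q x x = norm x * (norm x * q e e)"
          by (metis bilinear_lmul[OF q] bilinear_rmul[OF q] real_scaleR_def)
        ultimately show ?thesis by simp
      qed
      moreover have "q x0 x0 = 0" using pos[OF x0S] by (simp add: q_def l_def)
      moreover have "q x y = q y x" for x y by (simp add: q_def gsym[of x y] hsym[of x y])
      ultimately have "q x0 y = 0" if "y \<in> S" for y
        using semidefinite_form_null_vector[OF q _ S _ x0S(1) _ that] by blast
      then have "\<forall>y\<in>S. h x0 y = l * g x0 y" by (simp add: q_def)
      moreover have "linear (g x0)" using g by (simp add: bilinear_def)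
      ultimately show ?thesis using x0S pos[OF x0S] by force
    qed
    then obtain x0 l c where x0: "x0 \<in> S" and c: "linear c" "c x0 \<noteq> (0::real)"
      and eig: "\<And>y. y \<in> S \<Longrightarrow> h x0 y = l * g x0 y"
      and cg: "\<And>y. y \<in> S \<Longrightarrow> c y = 0 \<Longrightarrow> g x0 y = 0"
      by blast
    define S' where "S' = {y \<in> S. c y = 0}"
    have S': "subspace S'"
      using S c(1) unfolding S'_def subspace_def by (auto simp: linear_add linear_cmul linear_0)
    have S'S: "S' \<subseteq> S" by (auto simp: S'_def)
    have "x0 \<notin> S'" using c by (simp add: S'_def)
    then have "S' \<subset> S" using S'S x0 by blast
    then have "dim S' < dim S"
      using S S' by (metis dim_psubset span_eq_iff)
    then have IH: "S' \<subseteq> span {x \<in> S'. \<exists>l. \<forall>y\<in>S'. h x y = l * g x y}"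
      using less.hyps[of S'] S' psd ker S'S by (meson subsetD)
    have dec: "y - (c y / c x0) *\<^sub>R x0 \<in> S'" if "y \<in> S" for y
      using that x0 S c by (auto simp: S'_def linear_diff linear_cmul subspace_diff subspace_scale)
    \<comment> \<open>Both \<open>g x0\<close> and \<open>h x0\<close> vanish on \<open>S'\<close>,
      so an eigenvector relative to \<open>S'\<close> remains one when tested against
      \<open>x0\<close>.\<close>
    have ext: "\<forall>y\<in>S. h x y = k * g x y" if "x \<in> S'" "\<forall>y\<in>S'. h x y = k * g x y" for x k
    proof
      fix y assume y: "y \<in> S"
      define t where "t = c y / c x0"
      define y' where "y' = y - t *\<^sub>R x0"
      have y': "y' \<in> S'" "y = y' + t *\<^sub>R x0" using dec[OF y] by (auto simp: y'_def t_def)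
      have "g x x0 = 0" using cg[of x] that(1) gsym[of x x0] by (auto simp: S'_def)
      moreover have "h x x0 = 0" using eig[of x] cg[of x] that(1) hsym[of x x0] by (auto simp: S'_def)
      ultimately show "h x y = k * g x y"
        using that(2) y' by (simp add: bilinear_radd[OF g] bilinear_rmul[OF g]
            bilinear_radd[OF h] bilinear_rmul[OF h])
    qed
    let ?E = "{x \<in> S. \<exists>l. \<forall>y\<in>S. h x y = l * g x y}"
    have "{x \<in> S'. \<exists>l. \<forall>y\<in>S'. h x y = l * g x y} \<subseteq> ?E"
      using ext S'S by blast
    then have sub: "S' \<subseteq> span ?E" using IH span_mono by blast
    have "x0 \<in> span ?E" using x0 eig by (intro span_base) auto
    show ?thesis
    proof
      fix y assume "y \<in> S"
      then have "(y - (c y / c x0) *\<^sub>R x0) + (c y / c x0) *\<^sub>R x0 \<in> span ?E"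
        using dec sub \<open>x0 \<in> span ?E\<close> by (intro span_add span_scale) auto
      then show "y \<in> span ?E" by simp
    qed
  qed
qed

text \<open>\<open>poly_re T x p + i poly_im T x p\<close> is the polynomial \<open>p\<close> in \<open>T\<close> applied to \<open>x\<close> in the
  complexification.\<close>
definition poly_re :: "('a::real_vector \<Rightarrow> 'a) \<Rightarrow> 'a \<Rightarrow> complex poly \<Rightarrow> 'a" where
  "poly_re T x p = (\<Sum>i\<le>degree p. Re (coeff p i) *\<^sub>R (T ^^ i) x)"

definition poly_im :: "('a::real_vector \<Rightarrow> 'a) \<Rightarrow> 'a \<Rightarrow> complex poly \<Rightarrow> 'a" where
  "poly_im T x p = (\<Sum>i\<le>degree p. Im (coeff p i) *\<^sub>R (T ^^ i) x)"

section \<open>Complex polynomials in a real operator\<close>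

lemma poly_re_bound: "degree p \<le> n \<Longrightarrow> poly_re T x p = (\<Sum>i\<le>n. Re (coeff p i) *\<^sub>R (T ^^ i) x)"
  unfolding poly_re_def by (rule sum.mono_neutral_left) (auto simp: coeff_eq_0)

lemma poly_im_bound: "degree p \<le> n \<Longrightarrow> poly_im T x p = (\<Sum>i\<le>n. Im (coeff p i) *\<^sub>R (T ^^ i) x)"
  unfolding poly_im_def by (rule sum.mono_neutral_left) (auto simp: coeff_eq_0)

lemma poly_re_linear_factor:
  assumes "linear T"
  shows "poly_re T x ([:- \<mu>, 1:] * r) =
    T (poly_re T x r) - Re \<mu> *\<^sub>R poly_re T x r + Im \<mu> *\<^sub>R poly_im T x r"
proof -
  interpret linear T by fact
  define n where "n = degree r"
  have "degree ([:- \<mu>, 1:] * r) \<le> Suc n"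
    using degree_mult_le[of "[:- \<mu>, 1:]" r] by (simp add: n_def)
  then have "poly_re T x ([:- \<mu>, 1:] * r) = (\<Sum>i\<le>Suc n. Re (coeff ([:- \<mu>, 1:] * r) i) *\<^sub>R (T ^^ i) x)"
    by (rule poly_re_bound)
  also have "\<dots> = (\<Sum>i\<le>Suc n. Re (coeff (pCons 0 r) i) *\<^sub>R (T ^^ i) x)
      - (\<Sum>i\<le>Suc n. Re (\<mu> * coeff r i) *\<^sub>R (T ^^ i) x)"
    unfolding sum_subtractf[symmetric] by (rule sum.cong) (simp_all add: scaleR_diff_left)
  also have "(\<Sum>i\<le>Suc n. Re (coeff (pCons 0 r) i) *\<^sub>R (T ^^ i) x) =
      (\<Sum>i\<le>n. Re (coeff r i) *\<^sub>R T ((T ^^ i) x))"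
    by (subst sum.atMost_Suc_shift) simp
  also have "\<dots> = T (poly_re T x r)"
    by (simp add: poly_re_def n_def sum scale)
  also have "(\<Sum>i\<le>Suc n. Re (\<mu> * coeff r i) *\<^sub>R (T ^^ i) x) =
      Re \<mu> *\<^sub>R (\<Sum>i\<le>Suc n. Re (coeff r i) *\<^sub>R (T ^^ i) x) -
      Im \<mu> *\<^sub>R (\<Sum>i\<le>Suc n. Im (coeff r i) *\<^sub>R (T ^^ i) x)"
    unfolding scaleR_sum_right sum_subtractf[symmetric]
    by (rule sum.cong) (simp_all add: scaleR_diff_left)
  also have "\<dots> = Re \<mu> *\<^sub>R poly_re T x r - Im \<mu> *\<^sub>R poly_im T x r"
    by (simp add: poly_re_bound[of r "Suc n"] poly_im_bound[of r "Suc n"] n_def)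
  finally show ?thesis by simp
qed

text \<open>Multiplication by \<open>- \<i>\<close> moves the imaginary part into the real one, so
  the linear factor formula for \<open>poly_im\<close> follows from that for
  \<open>poly_re\<close>.\<close>

lemma poly_re_smult_i:
  "poly_re T x (smult (- \<i>) p) = poly_im T x p" "poly_im T x (smult (- \<i>) p) = - poly_re T x p"
  by (simp_all add: poly_re_def poly_im_def sum_negf)

lemma poly_im_linear_factor:
  assumes "linear T"
  shows "poly_im T x ([:- \<mu>, 1:] * r) =
    T (poly_im T x r) - Im \<mu> *\<^sub>R poly_re T x r - Re \<mu> *\<^sub>R poly_im T x r"
  using poly_re_linear_factor[OF assms, of x \<mu> "smult (- \<i>) r"]
  by (simp only: mult_smult_right poly_re_smult_i) simp

lemma annihilating_poly_exists:
  fixes T :: "'a::euclidean_space \<Rightarrow> 'a"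
  obtains p :: "complex poly" where "p \<noteq> 0" "poly_re T x p = 0" "poly_im T x p = 0"
proof -
  let ?n = "DIM('a)"
  have "\<exists>c::nat \<Rightarrow> real. (\<exists>i\<le>?n. c i \<noteq> 0) \<and> (\<Sum>i\<le>?n. c i *\<^sub>R (T ^^ i) x) = 0"
  \<comment> \<open>\<open>dependent\<close> concerns sets of vectors, not families. If two powers
    of \<open>T\<close> agree on \<open>x\<close>, the counting argument breaks down, and the
    difference of these powers is the relation.\<close>
  proof (cases "inj_on (\<lambda>i. (T ^^ i) x) {..?n}")
    case True
    let ?S = "(\<lambda>i. (T ^^ i) x) ` {..?n}"
    have "card ?S = Suc ?n" using True by (simp add: card_image)
    then have "dependent ?S" by (intro dependent_biggerset) simp_all
    then obtain u where u: "\<exists>v\<in>?S. u v \<noteq> 0" "(\<Sum>v\<in>?S. u v *\<^sub>R v) = 0"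
      using dependent_finite[of ?S] by auto
    have "(\<Sum>i\<le>?n. u ((T ^^ i) x) *\<^sub>R (T ^^ i) x) = 0"
      using u(2) by (simp add: sum.reindex[OF True])
    then show ?thesis using u(1) by (intro exI[of _ "\<lambda>i. u ((T ^^ i) x)"]) auto
  next
    case False
    then obtain i j where ij: "i \<le> ?n" "j \<le> ?n" "i \<noteq> j" "(T ^^ i) x = (T ^^ j) x"
      by (auto simp: inj_on_def)
    have "(\<Sum>k\<le>?n. ((if k = i then 1 else 0) - (if k = j then 1 else 0)) *\<^sub>R (T ^^ k) x) =
       (\<Sum>k\<le>?n. if k = i then (T ^^ k) x else 0) - (\<Sum>k\<le>?n. if k = j then (T ^^ k) x else 0)"
      unfolding sum_subtractf[symmetric] by (rule sum.cong) auto
    also have "\<dots> = 0" using ij by simp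
    finally show ?thesis using ij
      by (intro exI[of _ "\<lambda>k. (if k = i then 1 else 0) - (if k = j then 1 else 0)"]) auto
  qed
  then obtain c :: "nat \<Rightarrow> real" where c: "\<exists>i\<le>?n. c i \<noteq> 0" "(\<Sum>i\<le>?n. c i *\<^sub>R (T ^^ i) x) = 0"
    by blast
  define p where "p = (\<Sum>i\<le>?n. monom (complex_of_real (c i)) i)"
  have co: "coeff p i = (if i \<le> ?n then complex_of_real (c i) else 0)" for i
    by (simp add: p_def coeff_sum)
  then have "p \<noteq> 0" using c(1) by (metis coeff_0 of_real_eq_0_iff)
  have "degree p \<le> ?n" by (rule degree_le) (simp add: co)
  then have "poly_re T x p = 0" "poly_im T x p = 0"
    using c(2) by (simp_all add: poly_re_bound poly_im_bound co)
  with \<open>p \<noteq> 0\<close> that show thesis by blast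
qed

text \<open>An eigenvector of the complexification of the operator induced by \<open>T\<close> on \<open>Z / Z0\<close>.\<close>
lemma quotient_eigenpair_exists:
  fixes T :: "'a::euclidean_space \<Rightarrow> 'a"
  assumes T: "linear T" and Z: "subspace Z" "subspace Z0" "Z0 \<subseteq> Z"
    and inv: "\<And>z. z \<in> Z \<Longrightarrow> T z \<in> Z"
    and x: "x \<in> Z" "x \<notin> Z0"
  obtains a b u v where "u \<in> Z" "v \<in> Z" "u \<notin> Z0 \<or> v \<notin> Z0"
    "T u - a *\<^sub>R u + b *\<^sub>R v \<in> Z0" "T v - b *\<^sub>R u - a *\<^sub>R v \<in> Z0"
proof -
  \<comment> \<open>The least \<open>n\<close> with \<open>P n\<close> is the degree of the minimal
    polynomial of \<open>x\<close> modulo \<open>Z0\<close>. Splitting off a root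
    \<open>\<mu>\<close> leaves a cofactor of smaller degree, whose value at \<open>x\<close> is
    outside \<open>Z0\<close> but is taken into \<open>Z0\<close> by
    \<open>T - \<mu>\<close>.\<close>
  define P where "P = (\<lambda>n. \<exists>p. p \<noteq> 0 \<and> degree p = n \<and> poly_re T x p \<in> Z0 \<and> poly_im T x p \<in> Z0)"
  have "\<exists>n. P n"
    using annihilating_poly_exists[of T x] Z(2) subspace_0 unfolding P_def by metis
  define n where "n = (LEAST n. P n)"
  have "P n" unfolding n_def using \<open>\<exists>n. P n\<close> by (rule LeastI_ex)
  then obtain p where p: "p \<noteq> 0" "degree p = n" "poly_re T x p \<in> Z0" "poly_im T x p \<in> Z0"
    unfolding P_def by blast
  have "degree p \<noteq> 0"
  proof
    assume "degree p = 0"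
    then have "Re (coeff p 0) *\<^sub>R x \<in> Z0" "Im (coeff p 0) *\<^sub>R x \<in> Z0"
      using p(3,4) by (simp_all add: poly_re_def poly_im_def)
    moreover have "coeff p 0 \<noteq> 0" using p(1) \<open>degree p = 0\<close> by (metis leading_coeff_0_iff)
    ultimately have "x \<in> Z0"
      using Z(2) by (metis complex_eq_iff subspace_scale scaleR_scaleR left_inverse scaleR_one
          zero_complex.sel)
    then show False using x by blast
  qed
  then obtain \<mu> where "poly p \<mu> = 0"
    using fundamental_theorem_of_algebra[of p] by (auto simp: constant_degree)
  then obtain r where r: "p = [:- \<mu>, 1:] * r" by (metis dvdE poly_eq_0_iff_dvd)
  have "r \<noteq> 0" using r p by auto
  then have "degree p = Suc (degree r)"
    unfolding r by (subst degree_mult_eq) auto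
  then have "\<not> P (degree r)" using p(2) not_less_Least[of "degree r" P] n_def by auto
  then have ne: "poly_re T x r \<notin> Z0 \<or> poly_im T x r \<notin> Z0" unfolding P_def using \<open>r \<noteq> 0\<close> by blast
  have "(T ^^ i) x \<in> Z" for i by (induction i) (auto intro: inv x)
  then have mem: "poly_re T x r \<in> Z" "poly_im T x r \<in> Z"
    unfolding poly_re_def poly_im_def using Z(1) by (auto intro!: subspace_sum subspace_scale)
  have "T (poly_re T x r) - Re \<mu> *\<^sub>R poly_re T x r + Im \<mu> *\<^sub>R poly_im T x r \<in> Z0"
    using p(3) unfolding r poly_re_linear_factor[OF T] .
  moreover have "T (poly_im T x r) - Im \<mu> *\<^sub>R poly_re T x r - Re \<mu> *\<^sub>R poly_im T x r \<in> Z0"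
    using p(4) unfolding r poly_im_linear_factor[OF T] .
  ultimately show thesis using that mem ne by blast
qed

text \<open>That is, the complexification of \<open>N\<close> has no eigenvalue \<open>a + i b\<close> off the real line.\<close>
definition real_spectrum :: "('a::real_vector \<Rightarrow> 'a) \<Rightarrow> bool" where
  "real_spectrum N \<longleftrightarrow>
     (\<forall>a b x. b \<noteq> 0 \<and> N (N x) - (2 * a) *\<^sub>R N x + (a\<^sup>2 + b\<^sup>2) *\<^sub>R x = 0 \<longrightarrow> x = 0)"

definition skew_map :: "('a::real_inner \<Rightarrow> 'a) \<Rightarrow> bool" where
  "skew_map K \<longleftrightarrow> linear K \<and> (\<forall>x y. K x \<bullet> y = - (x \<bullet> K y))"

lemma skew_map_linear: "skew_map K \<Longrightarrow> linear K"
  by (simp add: skew_map_def)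

lemma skew_map_swap: "skew_map K \<Longrightarrow> K x \<bullet> y = - (x \<bullet> K y)"
  by (simp add: skew_map_def)

text \<open>An eigenvalue of the operator induced by \<open>N + K\<close> on \<open>V / Z\<close> is the sum of a real
  eigenvalue of \<open>N\<close> and an imaginary one of \<open>K\<close>; if it is \<open>0\<close>, both vanish.\<close>
lemma kernel_real_plus_skew:
  fixes N K :: "'a::euclidean_space \<Rightarrow> 'a"
  assumes N: "linear N" "real_spectrum N" and K: "skew_map K"
    and V: "subspace V" "\<And>x. x \<in> V \<Longrightarrow> N x \<in> V" "\<And>x. x \<in> V \<Longrightarrow> K x \<in> V"
    and Z: "subspace Z" "Z \<subseteq> V" "\<And>x. x \<in> Z \<Longrightarrow> N x \<in> Z" "\<And>x. x \<in> Z \<Longrightarrow> K x \<in> Z"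
    and comm: "\<And>x. x \<in> V \<Longrightarrow> N (K x) - K (N x) \<in> Z"
    and m: "m \<in> V" "N m + K m \<in> Z"
  shows "K m \<in> Z"
proof (rule ccontr)
  assume Km: "K m \<notin> Z"
  interpret N: linear N by fact
  interpret K: linear K using K by (rule skew_map_linear)
  \<comment> \<open>\<open>V1\<close> represents the kernel of \<open>N + K\<close> on
    \<open>V / Z\<close> by vectors orthogonal to \<open>Z\<close>. Skewness makes it invariant
    under \<open>K\<close>, so that \<open>\<lambda>x. K (K x)\<close> can be diagonalised on
    it.\<close>
  define V1 where "V1 = {v \<in> V. N v + K v \<in> Z \<and> (\<forall>z\<in>Z. v \<bullet> z = 0)}"
  have V1: "subspace V1"
    unfolding V1_def subspace_def
  proof (intro conjI ballI allI)
    fix x y assume xy: "x \<in> {v \<in> V. N v + K v \<in> Z \<and> (\<forall>z\<in>Z. v \<bullet> z = 0)}"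
      "y \<in> {v \<in> V. N v + K v \<in> Z \<and> (\<forall>z\<in>Z. v \<bullet> z = 0)}"
    have "N (x + y) + K (x + y) = (N x + K x) + (N y + K y)" by (simp add: N.add K.add)
    then show "x + y \<in> {v \<in> V. N v + K v \<in> Z \<and> (\<forall>z\<in>Z. v \<bullet> z = 0)}"
      using xy V(1) Z(1) by (simp add: subspace_add inner_add_left)
  next
    fix c x assume x: "x \<in> {v \<in> V. N v + K v \<in> Z \<and> (\<forall>z\<in>Z. v \<bullet> z = 0)}"
    have "N (c *\<^sub>R x) + K (c *\<^sub>R x) = c *\<^sub>R (N x + K x)" by (simp add: N.scale K.scale scaleR_add_right)
    then show "c *\<^sub>R x \<in> {v \<in> V. N v + K v \<in> Z \<and> (\<forall>z\<in>Z. v \<bullet> z = 0)}"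
      using x V(1) Z(1) by (simp add: subspace_scale)
  qed (use V(1) Z(1) in \<open>simp add: subspace_0\<close>)
  have KV1: "K v \<in> V1" if v: "v \<in> V1" for v
  proof -
    have vV: "v \<in> V" "N v + K v \<in> Z" and vZ: "\<And>z. z \<in> Z \<Longrightarrow> v \<bullet> z = 0"
      using v by (auto simp: V1_def)
    have "(N (K v) - K (N v)) + K (N v + K v) \<in> Z"
      using comm[OF vV(1)] Z(4)[OF vV(2)] by (rule subspace_add[OF Z(1)])
    then have "N (K v) + K (K v) \<in> Z" by (simp add: K.add)
    moreover have "K v \<bullet> z = 0" if "z \<in> Z" for z
      unfolding skew_map_swap[OF K, of v z] using vZ[OF Z(4)[OF that]] by simp
    ultimately show ?thesis using V(3)[OF vV(1)] unfolding V1_def by blast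
  qed
  obtain z v where zv: "z \<in> span Z" "\<And>w. w \<in> span Z \<Longrightarrow> orthogonal v w" "m = z + v"
    using orthogonal_subspace_decomp_exists[of Z m] by metis
  have spZ: "span Z = Z" using Z(1) by (simp add: span_eq_iff)
  have z: "z \<in> Z" using zv spZ by simp
  have "N v + K v = (N m + K m) - (N z + K z)" using zv by (simp add: N.add K.add)
  then have "N v + K v \<in> Z" using m z Z(1,3,4) by (simp add: subspace_diff subspace_add)
  moreover have "v = m - z" using zv by simp
  ultimately have v: "v \<in> V1"
    unfolding V1_def using zv(2) spZ subspace_diff[OF V(1) m(1), of z] z Z(2) by (auto simp: orthogonal_def)
  have "K m = K z + K v" using zv by (simp add: K.add)
  then have "K v \<notin> Z" using Km z Z(1,4) subspace_add by metis
  then have Kv0: "K v \<noteq> 0" using subspace_0[OF Z(1)] by auto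
  define h where "h = (\<lambda>x y. K x \<bullet> K y)"
  have hb: "bilinear h" unfolding h_def bilinear_def
    by (auto intro!: linearI simp: K.add K.scale inner_add_left inner_add_right)
  have ib: "bilinear ((\<bullet>) :: 'a \<Rightarrow> 'a \<Rightarrow> real)" unfolding bilinear_def
    by (auto intro!: linearI simp: inner_add_left inner_add_right)
  have sp: "V1 \<subseteq> span {x \<in> V1. \<exists>l. \<forall>y\<in>V1. h x y = l * (x \<bullet> y)}"
  proof (rule pencil_spectral[OF ib inner_commute hb _ V1])
    show "h x y = h y x" for x y unfolding h_def by (rule inner_commute)
    show "h x y = 0" if "x \<bullet> x = 0" for x y using that by (simp add: h_def K.zero)
  qed simp
  define E where "E = {x \<in> V1. \<exists>l. \<forall>y\<in>V1. h x y = l * (x \<bullet> y)}"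
  have "\<exists>x\<in>E. K x \<noteq> 0"
  proof (rule ccontr)
    assume "\<not> ?thesis"
    then have "\<And>x. x \<in> E \<Longrightarrow> K x = 0" by blast
    moreover have "v \<in> span E" using sp v unfolding E_def by blast
    ultimately have "K v = 0" by (rule linear_eq_0_on_span[OF K.linear_axioms])
    then show False using Kv0 by simp
  qed
  then obtain x l where x: "x \<in> V1" "K x \<noteq> 0" and l: "\<And>y. y \<in> V1 \<Longrightarrow> h x y = l * (x \<bullet> y)"
    unfolding E_def by blast
  have x0: "x \<noteq> 0" using x K.zero by auto
  have "K x \<bullet> K x = l * (x \<bullet> x)" using l[OF x(1)] by (simp add: h_def)
  then have "0 < l * (x \<bullet> x)" using x(2) by (metis inner_gt_zero_iff)
  then have lpos: "l > 0" using inner_ge_zero[of x] by (auto simp: zero_less_mult_iff)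
  have KK: "K (K x) = - l *\<^sub>R x"
  proof -
    have mem: "K (K x) + l *\<^sub>R x \<in> V1" using KV1 x V1 by (simp add: subspace_add subspace_scale)
    have "(K (K x) + l *\<^sub>R x) \<bullet> y = 0" if "y \<in> V1" for y
      using l[OF that] by (simp add: inner_add_left skew_map_swap[OF K, of "K x"] h_def)
    from this[OF mem] show ?thesis by (simp add: add_eq_0_iff)
  qed
  define \<mu> where "\<mu> = sqrt l"
  \<comment> \<open>On \<open>V1\<close> the map \<open>N\<close> is \<open>- K\<close> modulo
    \<open>Z\<close>, so \<open>N (N x)\<close> is \<open>K (K x)\<close>, that is
    \<open>- l\<close> times \<open>x\<close>, and \<open>Q x\<close> falls into \<open>Z\<close>.
    Real spectrum, with \<open>a = 0\<close> and \<open>b = sqrt l\<close>, makes \<open>Q\<close>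
    injective, hence a bijection of \<open>Z\<close>. Thus \<open>x\<close> itself is in
    \<open>Z\<close>, although it is non-zero and orthogonal to \<open>Z\<close>.\<close>
  define Q where "Q = (\<lambda>w. N (N w) + l *\<^sub>R w)"
  have Q: "linear Q" unfolding Q_def
    by (auto intro!: linearI simp: N.add N.scale algebra_simps)
  have inj0: "w = 0" if "Q w = 0" for w
    using N(2)[unfolded real_spectrum_def, rule_format, of \<mu> w 0] that lpos by (auto simp: Q_def \<mu>_def)
  then have "inj Q" using linear_injective_0[OF Q] by blast
  have QZ: "Q ` Z \<subseteq> Z" using Z(1,3) by (auto simp: Q_def subspace_add subspace_scale)
  have "Q ` Z = Z"
  proof (rule subspace_dim_equal)
    show "subspace (Q ` Z)" using Q Z(1) by (rule linear_subspace_image)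
    show "dim Z \<le> dim (Q ` Z)"
      using dim_image_eq[OF Q, of Z] \<open>inj Q\<close> by (simp add: inj_on_def)
  qed (use Z QZ in auto)
  have "Q x \<in> Z"
  proof -
    have "Q x = N (N x + K x) - (N (K x) - K (N x)) - K (N x + K x)"
      using KK by (simp add: Q_def N.add K.add)
    moreover have "N (N x + K x) \<in> Z" "N (K x) - K (N x) \<in> Z" "K (N x + K x) \<in> Z"
      using x(1) comm[of x] Z(3,4) by (simp_all add: V1_def)
    ultimately show ?thesis using Z(1) by (simp add: subspace_diff)
  qed
  then obtain z' where "z' \<in> Z" "Q z' = Q x" using \<open>Q ` Z = Z\<close> by (metis imageE)
  then have "x \<in> Z" using \<open>inj Q\<close> by (metis injD)
  then show False using x x0 by (auto simp: V1_def)
qed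

text \<open>Pairs \<open>(u, v)\<close> stand for \<open>u + i v\<close>. An eigenvalue
  \<open>a + i b\<close> of \<open>N + K\<close> is reduced to 0 by subtracting \<open>a\<close>
  from \<open>N\<close> and \<open>i b\<close> from \<open>K\<close>. The first shift keeps the
  spectrum real: the quadratic with parameters \<open>c\<close>, \<open>e\<close> for
  \<open>N - a\<close> is the one with \<open>a + c\<close>, \<open>e\<close> for
  \<open>N\<close>.\<close>

lemma real_spectrum_pair_shift:
  assumes N: "linear N" "real_spectrum N"
  shows "real_spectrum (\<lambda>(u, v). (N u - a *\<^sub>R u, N v - a *\<^sub>R v))"
proof -
  interpret N: linear N by fact
  have dbl: "(t * 2) *\<^sub>R y = t *\<^sub>R y + t *\<^sub>R y" for t and y :: 'a
    by (simp only: mult_2_right scaleR_add_left)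
  have *: "x = 0" if "e \<noteq> 0" and eq: "N (N x - a *\<^sub>R x) - a *\<^sub>R (N x - a *\<^sub>R x)
      - (2 * c) *\<^sub>R (N x - a *\<^sub>R x) + (c\<^sup>2 + e\<^sup>2) *\<^sub>R x = 0" for c e x
  proof -
    have "N (N x) - (2 * (a + c)) *\<^sub>R N x + ((a + c)\<^sup>2 + e\<^sup>2) *\<^sub>R x = 0"
      using eq by (simp add: N.diff N.scale algebra_simps power2_eq_square dbl)
    then show ?thesis using N(2) \<open>e \<noteq> 0\<close> unfolding real_spectrum_def by blast
  qed
  show ?thesis
    unfolding real_spectrum_def by (auto simp: zero_prod_def intro: *)
qed

text \<open>Where \<open>N\<close> and \<open>K\<close> commute, \<open>K\<close> is the imaginary part of \<open>N + K\<close>, hence a polynomial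
  in it.\<close>
lemma invariant_real_plus_skew:
  fixes N K :: "'a::euclidean_space \<Rightarrow> 'a"
  assumes N: "linear N" "real_spectrum N" and K: "skew_map K"
    and V: "subspace V" "\<And>x. x \<in> V \<Longrightarrow> N x \<in> V" "\<And>x. x \<in> V \<Longrightarrow> K x \<in> V"
    and Q: "subspace Q" "\<And>x. x \<in> Q \<Longrightarrow> N x \<in> Q" "\<And>x. x \<in> Q \<Longrightarrow> K x \<in> Q"
    and Z: "subspace Z" "Q \<subseteq> Z" "Z \<subseteq> V" "\<And>x. x \<in> Z \<Longrightarrow> N x + K x \<in> Z"
    and comm: "\<And>x. x \<in> V \<Longrightarrow> N (K x) - K (N x) \<in> Q"
    and z: "z \<in> Z"
  shows "K z \<in> Z"
proof -
  interpret N: linear N by fact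
  interpret K: linear K using K by (rule skew_map_linear)
  \<comment> \<open>A \<open>good\<close> subspace of largest dimension is compared with
    \<open>Z\<close>: if it were smaller, a complex eigenvector of \<open>N + K\<close> on the
    quotient would enlarge it.\<close>
  define good where "good = (\<lambda>W. subspace W \<and> Q \<subseteq> W \<and> W \<subseteq> Z \<and> (\<forall>x\<in>W. N x \<in> W) \<and> (\<forall>x\<in>W. K x \<in> W))"
  have "good Q" using Q Z by (simp add: good_def)
  moreover have "\<forall>W. good W \<longrightarrow> dim W < Suc (DIM('a))" by (simp add: dim_subset_UNIV le_imp_less_Suc)
  ultimately have "\<exists>W. good W \<and> (\<forall>W'. good W' \<longrightarrow> dim W' \<le> dim W)"
    by (rule Lattices_Big.ex_has_greatest_nat)
  then obtain Z0 where Z0: "good Z0" and max: "\<And>W. good W \<Longrightarrow> dim W \<le> dim Z0"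
    by metis
  have Z0s: "subspace Z0" "Q \<subseteq> Z0" "Z0 \<subseteq> Z"
    using Z0 unfolding good_def by simp_all
  have NZ0: "N x \<in> Z0" and KZ0: "K x \<in> Z0" if "x \<in> Z0" for x
    using Z0 that unfolding good_def by simp_all
  have "Z \<subseteq> Z0"
  proof (rule ccontr)
    assume "\<not> Z \<subseteq> Z0"
    then obtain x where x: "x \<in> Z" "x \<notin> Z0" by blast
    have T: "linear (\<lambda>x. N x + K x)"
      by (auto intro!: linearI simp: N.add K.add N.scale K.scale algebra_simps)
    obtain a b u v where uv: "u \<in> Z" "v \<in> Z" "u \<notin> Z0 \<or> v \<notin> Z0"
      "N u + K u - a *\<^sub>R u + b *\<^sub>R v \<in> Z0" "N v + K v - b *\<^sub>R u - a *\<^sub>R v \<in> Z0"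
      using quotient_eigenpair_exists[OF T Z(1) Z0s(1,3) Z(4) x] by metis
    define N' where "N' = (\<lambda>(u, v). (N u - a *\<^sub>R u, N v - a *\<^sub>R v))"
    define K' where "K' = (\<lambda>(u, v). (K u + b *\<^sub>R v, K v - b *\<^sub>R u))"
    have N': "linear N'" unfolding N'_def
      by (auto intro!: linearI simp: N.add N.scale algebra_simps)
    have RN': "real_spectrum N'" unfolding N'_def using N by (rule real_spectrum_pair_shift)
    have "skew_map K'" unfolding K'_def skew_map_def
      by (auto intro!: linearI simp: K.add K.scale algebra_simps inner_add_left inner_add_right
          inner_diff_left inner_diff_right skew_map_swap[OF K])
    \<comment> \<open>\<open>N'\<close> and \<open>K'\<close> are \<open>N - a\<close> and
      \<open>K - i b\<close> on pairs, and their sum kills \<open>u + i v\<close> modulo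
      \<open>Z0\<close>. Hence \<open>K\<close> acts on it as \<open>i b\<close> and
      \<open>N\<close> as \<open>a\<close>, so adjoining \<open>u\<close> and \<open>v\<close> to
      \<open>Z0\<close> gives an invariant subspace again.\<close>
    have "K' (u, v) \<in> Z0 \<times> Z0"
    proof (rule kernel_real_plus_skew[OF N' RN' \<open>skew_map K'\<close>, where V = "V \<times> V"])
      show "N' x \<in> V \<times> V" "K' x \<in> V \<times> V" if "x \<in> V \<times> V" for x
        using that V by (auto simp: N'_def K'_def subspace_add subspace_diff subspace_scale)
      show "N' x \<in> Z0 \<times> Z0" "K' x \<in> Z0 \<times> Z0" if "x \<in> Z0 \<times> Z0" for x
        using that Z0s NZ0 KZ0
        by (auto simp: N'_def K'_def subspace_add subspace_diff subspace_scale)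
      show "N' (K' x) - K' (N' x) \<in> Z0 \<times> Z0" if x: "x \<in> V \<times> V" for x
      proof -
        obtain p q where [simp]: "x = (p, q)" by force
        have "N' (K' x) - K' (N' x) = (N (K p) - K (N p), N (K q) - K (N q))"
          by (simp add: N'_def K'_def N.add N.scale K.add K.scale N.diff K.diff algebra_simps)
        then show ?thesis using comm[of p] comm[of q] x Z0s by auto
      qed
      show "N' (u, v) + K' (u, v) \<in> Z0 \<times> Z0"
        using uv by (simp add: N'_def K'_def algebra_simps)
    qed (use V Z Z0s uv in \<open>auto simp: subspace_Times\<close>)
    then have Kuv: "K u + b *\<^sub>R v \<in> Z0" "K v - b *\<^sub>R u \<in> Z0" by (auto simp: K'_def)
    define W where "W = {w + s *\<^sub>R u + t *\<^sub>R v | w s t. w \<in> Z0}"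
    have WI: "w + s *\<^sub>R u + t *\<^sub>R v \<in> W" if "w \<in> Z0" for w s t
      using that by (auto simp: W_def)
    have Wsub: "subspace W"
      unfolding subspace_def
    proof (intro conjI ballI allI)
      show "0 \<in> W" using WI[of 0 0 0] Z0s by (simp add: subspace_0)
      fix x y assume "x \<in> W" "y \<in> W"
      then obtain w s t w' s' t' where "w \<in> Z0" "w' \<in> Z0"
        "x = w + s *\<^sub>R u + t *\<^sub>R v" "y = w' + s' *\<^sub>R u + t' *\<^sub>R v" by (auto simp: W_def)
      then show "x + y \<in> W"
        using WI[of "w + w'" "s + s'" "t + t'"] Z0s by (simp add: subspace_add algebra_simps)
    next
      fix c x assume "x \<in> W"
      then obtain w s t where "w \<in> Z0" "x = w + s *\<^sub>R u + t *\<^sub>R v" by (auto simp: W_def)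
      then show "c *\<^sub>R x \<in> W"
        using WI[of "c *\<^sub>R w" "c * s" "c * t"] Z0s by (simp add: subspace_scale algebra_simps)
    qed
    have Z0W: "Z0 \<subseteq> W" using WI[of _ 0 0] by auto
    have uvW: "u \<in> W" "v \<in> W" using WI[of 0 1 0] WI[of 0 0 1] Z0s by (auto simp: subspace_0)
    have KuW: "K u \<in> W" using WI[OF Kuv(1), of 0 "- b"] by simp
    have KvW: "K v \<in> W" using WI[OF Kuv(2), of b 0] by simp
    have NuW: "N u \<in> W"
    proof -
      define e where "e = N u + K u - a *\<^sub>R u + b *\<^sub>R v"
      have "e \<in> W" using uv(4) Z0W by (auto simp: e_def)
      then have "e + a *\<^sub>R u - b *\<^sub>R v - K u \<in> W"
        using uvW KuW Wsub by (simp add: subspace_diff subspace_add subspace_scale)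
      then show ?thesis by (simp add: e_def)
    qed
    have NvW: "N v \<in> W"
    proof -
      define e where "e = N v + K v - b *\<^sub>R u - a *\<^sub>R v"
      have "e \<in> W" using uv(5) Z0W by (auto simp: e_def)
      then have "e + b *\<^sub>R u + a *\<^sub>R v - K v \<in> W"
        using uvW KvW Wsub by (simp add: subspace_diff subspace_add subspace_scale)
      then show ?thesis by (simp add: e_def)
    qed
    have "good W"
      unfolding good_def
    proof (intro conjI ballI)
      show "W \<subseteq> Z" using uv Z0s Z by (auto simp: W_def subset_iff subspace_add subspace_scale)
      fix x assume "x \<in> W"
      then obtain w s t where w: "w \<in> Z0" "x = w + s *\<^sub>R u + t *\<^sub>R v" by (auto simp: W_def)
      have "N w \<in> W" "K w \<in> W" using w(1) NZ0 KZ0 Z0W by blast+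
      then show "N x \<in> W" "K x \<in> W" using w(2) NuW NvW KuW KvW Wsub
        by (simp_all add: N.add N.scale K.add K.scale subspace_add subspace_scale)
    qed (use Wsub Z0W Z0s in auto)
    then have "dim W \<le> dim Z0" by (rule max)
    moreover have "Z0 \<subset> W" using Z0W uvW uv by blast
    then have "dim Z0 < dim W"
      using dim_psubset[of Z0 W] Wsub Z0s by (simp add: span_eq_iff[THEN iffD2])
    ultimately show False by simp
  qed
  then show ?thesis using KZ0 z Z0s by blast
qed

text \<open>The Hilbert-Schmidt product, that is, the trace of the transpose of \<open>f\<close>
  times \<open>g\<close>. For skew \<open>f\<close> it is \<open>- tr (f g)\<close>, with positivity
  evident.\<close>

definition hs :: "('a::euclidean_space \<Rightarrow> 'a) \<Rightarrow> ('a \<Rightarrow> 'a) \<Rightarrow> real" where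
  "hs f g = (\<Sum>b\<in>Basis. f b \<bullet> g b)"

definition comm :: "('a::real_vector \<Rightarrow> 'a) \<Rightarrow> ('a \<Rightarrow> 'a) \<Rightarrow> 'a \<Rightarrow> 'a" where
  "comm f g = (\<lambda>x. f (g x) - g (f x))"

lemma hs_commute: "hs f g = hs g f"
  by (simp add: hs_def inner_commute)

lemma hs_diff_left: "hs (\<lambda>x. f x - f' x) g = hs f g - hs f' g"
  by (simp add: hs_def inner_diff_left sum_subtractf)

lemma hs_diff_right: "hs f (\<lambda>x. g x - g' x) = hs f g - hs f g'"
  by (simp add: hs_def inner_diff_right sum_subtractf)

lemma hs_nonneg: "0 \<le> hs f f"
  by (simp add: hs_def sum_nonneg)

lemma hs_eq_0:
  assumes "linear f" "hs f f = 0"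
  shows "f x = 0"
proof -
  have "\<forall>b\<in>Basis. f b \<bullet> f b = 0"
    using assms(2) unfolding hs_def by (subst (asm) sum_nonneg_eq_0_iff) auto
  then have "\<And>b. b \<in> Basis \<Longrightarrow> f b = 0" by simp
  then show ?thesis using linear_eq_0_on_span[OF assms(1), of Basis x] by simp
qed

lemma hs_skew_left: "skew_map k \<Longrightarrow> hs (\<lambda>x. k (f x)) g = - hs f (\<lambda>x. k (g x))"
  by (simp add: hs_def skew_map_swap sum_negf)

text \<open>Expanding \<open>k b\<close> in the basis produces the matrix of \<open>k\<close>; its
  antisymmetry, after exchanging the two sums, gives the sign.\<close>

lemma hs_skew_right:
  assumes k: "skew_map k" and f: "linear f" and g: "linear g"
  shows "hs (\<lambda>x. f (k x)) g = - hs f (\<lambda>x. g (k x))"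
proof -
  have exp: "h (k b) = (\<Sum>c\<in>Basis. (k b \<bullet> c) *\<^sub>R h c)" if "linear h" for h :: "'a \<Rightarrow> 'a" and b
    by (subst euclidean_representation[symmetric, of "k b"])
      (simp add: linear_sum[OF that] linear_cmul[OF that])
  have sw: "k b \<bullet> c = - (k c \<bullet> b)" for b c
    using skew_map_swap[OF k, of b c] by (simp add: inner_commute)
  have "hs (\<lambda>x. f (k x)) g = (\<Sum>b\<in>Basis. \<Sum>c\<in>Basis. (k b \<bullet> c) * (f c \<bullet> g b))"
    by (simp add: hs_def exp[OF f] inner_sum_left)
  also have "\<dots> = (\<Sum>c\<in>Basis. \<Sum>b\<in>Basis. (k b \<bullet> c) * (f c \<bullet> g b))"
    by (rule sum.swap)
  also have "\<dots> = - (\<Sum>c\<in>Basis. \<Sum>b\<in>Basis. (k c \<bullet> b) * (f c \<bullet> g b))"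
    by (subst sw) (simp add: sum_negf)
  also have "\<dots> = - hs f (\<lambda>x. g (k x))"
    by (simp add: hs_def exp[OF g] inner_sum_right)
  finally show ?thesis .
qed

lemma hs_comm:
  assumes "skew_map k" "linear f" "linear g"
  shows "hs (comm k f) g = - hs f (comm k g)"
  unfolding comm_def hs_diff_left hs_diff_right
  using hs_skew_left[OF assms(1), of f g] hs_skew_right[OF assms] by simp

text \<open>For the part \<open>v\<close> of \<open>w\<close> orthogonal to \<open>Z\<close>, the
  vector \<open>K v\<close> lies in \<open>Z\<close> and, by skewness, is orthogonal to it, hence
  vanishes. The lemma serves to replace a vector by one in \<open>Z\<close> with the same
  image.\<close>

lemma skew_orthogonal_part:
  fixes K :: "'a::euclidean_space \<Rightarrow> 'a"
  assumes K: "skew_map K" and Z: "subspace Z" "\<And>x. x \<in> Z \<Longrightarrow> K x \<in> Z" and w: "K w \<in> Z"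
  obtains w1 where "w1 \<in> Z" "K w1 = K w"
proof -
  obtain z v where zv: "z \<in> span Z" "\<And>w. w \<in> span Z \<Longrightarrow> orthogonal v w" "w = z + v"
    using orthogonal_subspace_decomp_exists[of Z w] by metis
  have spZ: "span Z = Z" using Z(1) by (simp add: span_eq_iff)
  have z: "z \<in> Z" using zv spZ by simp
  have Kw: "K w = K z + K v" using zv(3) skew_map_linear[OF K] by (simp add: linear_add)
  then have "K v = K w - K z" by simp
  then have "K v \<in> Z" using w Z(2)[OF z] Z(1) by (simp add: subspace_diff)
  then have "K v \<bullet> K v = 0"
    using skew_map_swap[OF K, of v "K v"] zv(2)[of "K (K v)"] Z(2) spZ by (simp add: orthogonal_def)
  then show thesis using that[OF z] Kw by simp
qed

text \<open>Skew maps have no nilpotent part, even on quotients: if \<open>v\<close> is the part of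
  \<open>w\<close> orthogonal to \<open>Z\<close>, then
  \<open>K v \<bullet> K v = - (v \<bullet> K (K v))\<close>, which is 0 because
  \<open>K (K v)\<close> is in \<open>Z\<close>.\<close>

lemma skew_square_invariant:
  fixes K :: "'a::euclidean_space \<Rightarrow> 'a"
  assumes K: "skew_map K" and Z: "subspace Z" "\<And>x. x \<in> Z \<Longrightarrow> K x \<in> Z" and w: "K (K w) \<in> Z"
  shows "K w \<in> Z"
proof -
  obtain z v where zv: "z \<in> span Z" "\<And>w. w \<in> span Z \<Longrightarrow> orthogonal v w" "w = z + v"
    using orthogonal_subspace_decomp_exists[of Z w] by metis
  have spZ: "span Z = Z" using Z(1) by (simp add: span_eq_iff)
  have z: "z \<in> Z" using zv spZ by simp
  note lin = skew_map_linear[OF K]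
  have Kw: "K w = K z + K v" using zv(3) lin by (simp add: linear_add)
  then have "K (K v) = K (K w) - K (K z)" using lin by (simp add: linear_add)
  then have "K (K v) \<in> Z" using w Z(2) z Z(1) by (simp add: subspace_diff)
  then have "K v \<bullet> K v = 0"
    using skew_map_swap[OF K, of v "K v"] zv(2)[of "K (K v)"] spZ by (simp add: orthogonal_def)
  then show ?thesis using Kw Z(2)[OF z] by simp
qed

lemma real_spectrum_if_real_eigenvalues:
  assumes N: "linear N" and ev: "\<And>\<mu>. complex_eigenvalue N \<mu> \<Longrightarrow> \<mu> \<in> \<real>"
  shows "real_spectrum N"
  unfolding real_spectrum_def
proof (intro allI impI, elim conjE)
  fix a b :: real and x
  assume b: "b \<noteq> 0" and eq: "N (N x) - (2 * a) *\<^sub>R N x + (a\<^sup>2 + b\<^sup>2) *\<^sub>R x = 0"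
  show "x = 0"
  proof (rule ccontr)
    assume "x \<noteq> 0"
    \<comment> \<open>Solves the real part of \<open>N (x + i y) = (a + i b) (x + i y)\<close>; the
      quadratic relation then yields the imaginary part.\<close>
    define y where "y = (1 / b) *\<^sub>R (a *\<^sub>R x - N x)"
    have hy: "b *\<^sub>R y = a *\<^sub>R x - N x" using b by (simp add: y_def)
    have "b *\<^sub>R N y = a *\<^sub>R N x - N (N x)"
      using arg_cong[OF hy, of N] N by (simp add: linear_cmul linear_diff)
    also have "\<dots> = a *\<^sub>R N x - (2 * a) *\<^sub>R N x + (a\<^sup>2 + b\<^sup>2) *\<^sub>R x"
    proof -
      have "N (N x) = (2 * a) *\<^sub>R N x - (a\<^sup>2 + b\<^sup>2) *\<^sub>R x"
        using eq by (simp add: add_eq_0_iff diff_add_eq algebra_simps)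
      then show ?thesis by simp
    qed
    also have "\<dots> = a *\<^sub>R (a *\<^sub>R x - N x) + (b * b) *\<^sub>R x"
    proof -
      have "a *\<^sub>R N x - (2 * a) *\<^sub>R N x = - a *\<^sub>R N x"
        by (simp only: scaleR_diff_left[symmetric]) simp
      then show ?thesis by (simp add: power2_eq_square algebra_simps)
    qed
    also have "\<dots> = b *\<^sub>R (b *\<^sub>R x + a *\<^sub>R y)"
      using hy by (simp add: scaleR_add_right) (simp flip: hy add: mult.commute)
    finally have "N y = b *\<^sub>R x + a *\<^sub>R y" using b by simp
    moreover have "N x = a *\<^sub>R x - b *\<^sub>R y" using hy by simp
    ultimately have "complex_eigenvalue N (Complex a b)"
      unfolding complex_eigenvalue_def using \<open>x \<noteq> 0\<close> by (intro exI[of _ x] exI[of _ y]) simp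
    then have "Complex a b \<in> \<real>" by (rule ev)
    then show False using b by (simp add: complex_is_Real_iff)
  qed
qed

section \<open>Modifications of completely solvable Lie algebras\<close>

text \<open>An abstract modification: \<open>D x\<close> stands for the bracket with \<open>\<phi> x\<close>, and \<open>closed\<close> says
  that the elements \<open>x + \<phi> x\<close> form a subalgebra.\<close>
locale skew_modification =
  fixes br D :: "'s::euclidean_space \<Rightarrow> 's \<Rightarrow> 's"
  assumes lie: "lie_algebra br"
    and ad_real: "\<And>x. real_spectrum (br x)"
    and D_linear: "\<And>v. linear (\<lambda>x. D x v)"
    and D_skew: "\<And>x. skew_map (D x)"
    and D_derivation: "\<And>x y z. D x (br y z) = br (D x y) z + br y (D x z)"
    and closed: "\<And>x y v. D (br x y + D x y - D y x) v = D x (D y v) - D y (D x v)"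
begin

lemma br_linear: "linear (br x)" "linear (\<lambda>x. br x y)"
  using lie by (auto simp: lie_algebra_def)

lemma br_self: "br x x = 0"
  using lie by (auto simp: lie_algebra_def)

lemma br_swap: "br x y = - br y x"
proof -
  have "br (x + y) (x + y) = 0" by (rule br_self)
  then have "br x x + br y x + (br x y + br y y) = 0"
    by (simp only: linear_add[OF br_linear(1)] linear_add[OF br_linear(2)])
  then have "br x y + br y x = 0" by (simp add: br_self add.commute)
  then show ?thesis by (simp add: eq_neg_iff_add_eq_0)
qed

lemma br_derivation: "br x (br y z) = br (br x y) z + br y (br x z)"
proof -
  have "br x (br y z) + br y (br z x) + br z (br x y) = 0"
    using lie by (auto simp: lie_algebra_def)
  moreover have "br y (br z x) = - br y (br x z)"
    using br_swap[of z x] by (simp add: linear_neg[OF br_linear(1)])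
  moreover have "br z (br x y) = - br (br x y) z" by (rule br_swap)
  ultimately show ?thesis by (simp add: add_eq_0_iff algebra_simps)
qed

lemma D_lin: "linear (D x)"
  using D_skew by (rule skew_map_linear)

lemmas br_simps = linear_add[OF br_linear(1)] linear_add[OF br_linear(2)]
  linear_diff[OF br_linear(1)] linear_diff[OF br_linear(2)]
  linear_cmul[OF br_linear(1)] linear_cmul[OF br_linear(2)]
  linear_0[OF br_linear(1)] linear_0[OF br_linear(2)]
  linear_neg[OF br_linear(1)] linear_neg[OF br_linear(2)]

lemmas D_simps = linear_add[OF D_lin] linear_add[OF D_linear]
  linear_diff[OF D_lin] linear_diff[OF D_linear]
  linear_cmul[OF D_lin] linear_cmul[OF D_linear]
  linear_0[OF D_lin] linear_0[OF D_linear]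
  linear_neg[OF D_lin] linear_neg[OF D_linear]

section \<open>The kernel of \<open>D\<close> and the invariant form\<close>

definition ker :: "'s set" where
  "ker = {x. \<forall>v. D x v = 0}"

text \<open>Normality for one fixed first argument, seen through \<open>D\<close>. The aim is that
  every vector belongs; as the set is a subspace, a spanning set suffices.\<close>

definition normal_part :: "'s set" where
  "normal_part = {x. \<forall>y. br x y - D y x \<in> ker}"

lemma ker_subspace: "subspace ker"
  by (auto simp: ker_def subspace_def D_simps)

lemma normal_part_subspace: "subspace normal_part"
  unfolding subspace_def normal_part_def mem_Collect_eq
proof (intro conjI ballI allI impI)
  show "br 0 y - D y 0 \<in> ker" for y
    using subspace_0[OF ker_subspace] by (simp add: br_simps D_simps)
next
  fix x x' y
  assume *: "x \<in> {x. \<forall>y. br x y - D y x \<in> ker}" "x' \<in> {x. \<forall>y. br x y - D y x \<in> ker}"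
  then have "(br x y - D y x) + (br x' y - D y x') \<in> ker"
    by (intro subspace_add ker_subspace) auto
  then show "br (x + x') y - D y (x + x') \<in> ker" by (simp add: br_simps D_simps algebra_simps)
next
  fix c x y
  assume *: "x \<in> {x. \<forall>y. br x y - D y x \<in> ker}"
  then have "c *\<^sub>R (br x y - D y x) \<in> ker"
    by (intro subspace_scale ker_subspace) auto
  then show "br (c *\<^sub>R x) y - D y (c *\<^sub>R x) \<in> ker" by (simp add: br_simps D_simps algebra_simps)
qed

definition form :: "'s \<Rightarrow> 's \<Rightarrow> real" where
  "form x y = hs (D x) (D y)"

lemma form_bilinear: "bilinear form"
  unfolding bilinear_def form_def hs_def
  by (auto intro!: linearI simp: D_simps inner_add_left inner_add_right sum.distrib sum_distrib_left)

lemma form_commute: "form x y = form y x"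
  by (simp add: form_def hs_commute)

lemma form_nonneg: "0 \<le> form x x"
  by (simp add: form_def hs_nonneg)

lemma form_eq_0: "form x x = 0 \<Longrightarrow> x \<in> ker"
  using hs_eq_0[OF D_lin] by (auto simp: form_def ker_def)

lemma form_ker: "x \<in> ker \<Longrightarrow> form x y = 0"
  by (simp add: form_def ker_def hs_def)

lemma D_closed_comm: "D (br x y + D x y - D y x) = comm (D x) (D y)"
  using closed by (auto simp: comm_def)

text \<open>\<open>D\<close> turns the operator \<open>\<lambda>z. br x z + D x z - D z x\<close>
  into the commutator with the skew map \<open>D x\<close>, which is skew for \<open>hs\<close>.
  That operator is the adjoint action of \<open>x + \<phi> x\<close> on the modification, with the
  latter identified with the Lie algebra.\<close>

lemma form_invariant: "form (br x y + D x y - D y x) z = - form y (br x z + D x z - D z x)"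
  unfolding form_def D_closed_comm by (intro hs_comm D_skew D_lin)

lemma form_self_bracket: "form x (br x y + D x y - D y x) = 0"
  using form_invariant[of x x y] by (simp add: br_self linear_0[OF form_bilinear[unfolded bilinear_def, THEN conjunct2, rule_format]]
    bilinear_lzero[OF form_bilinear])

lemma normal_part_bracket:
  assumes "x \<in> normal_part"
  shows "D (br x y) v = D (D y x) v" "D (D x y) v = D x (D y v) - D y (D x v)"
proof -
  show "D (br x y) v = D (D y x) v"
    using assms by (simp add: normal_part_def ker_def D_simps)
  then show "D (D x y) v = D x (D y v) - D y (D x v)"
    using closed[of x y v] by (simp add: D_simps)
qed

text \<open>Modulo \<open>ker\<close> the operator \<open>A\<close> is skew for \<open>form\<close>, so its eigenvalues are imaginary,
  and \<open>M A = (N + K) M\<close>. Since the eigenvalues of \<open>N\<close> are real, \<open>M\<close> maps the eigenspaces of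
  \<open>A\<close> into those of \<open>K\<close>. As \<open>M = A - K\<close>, this forces \<open>M = 0\<close> modulo \<open>ker\<close>.\<close>
lemma normal_part_if_fixed:
  assumes fixed: "D X X = 0"
  shows "X \<in> normal_part"
proof -
  define N where "N = br X"
  define K where "K = D X"
  define q where "q = (\<lambda>y. D y X)"
  define A where "A = (\<lambda>y. N y + K y - q y)"
  define M where "M = (\<lambda>y. N y - q y)"
  have linN: "linear N" unfolding N_def by (rule br_linear)
  have linK: "linear K" unfolding K_def by (rule D_lin)
  have linq: "linear q" unfolding q_def by (rule D_linear)
  have linA: "linear A" unfolding A_def by (intro linear_compose_sub linear_compose_add linN linK linq)
  have linM: "linear M" unfolding M_def by (intro linear_compose_sub linN linq)
  have K: "skew_map K" unfolding K_def by (rule D_skew)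
  have RN: "real_spectrum N" unfolding N_def by (rule ad_real)
  note lin = linear_add[OF linN] linear_add[OF linK] linear_add[OF linq] linear_diff[OF linN]
    linear_diff[OF linK] linear_diff[OF linq]
  \<comment> \<open>The commutator of \<open>br X\<close> and \<open>D X\<close> is
    \<open>- br (D X X)\<close>, which \<open>fixed\<close> makes zero.\<close>
  have NK: "N (K y) = K (N y)" for y
    using D_derivation[of X X y] fixed by (simp add: N_def K_def br_simps)
  have DA: "D (A y) v = K (D y v) - D y (K v)" for y v
    unfolding A_def N_def K_def q_def by (rule closed)
  have qA: "q (A y) = K (q y)" for y
    using DA[of y X] fixed by (simp add: q_def K_def D_simps)
  have MA: "M (A y) = N (M y) + K (M y)" for y
  proof -
    have "M (A y) = N (N y) + N (K y) - N (q y) - K (q y)" using qA[of y]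
      by (simp add: M_def) (simp add: A_def lin)
    then show ?thesis by (simp add: M_def lin NK)
  qed
  have qker: "q x = 0" if "x \<in> ker" for x using that by (simp add: q_def ker_def)
  have Aker: "A x \<in> ker" if "x \<in> ker" for x
    using that by (simp add: ker_def DA linear_0[OF linK])
  have NKker: "N x + K x \<in> ker" if "x \<in> ker" for x
    using Aker[OF that] qker[OF that] by (simp add: A_def)
  \<comment> \<open>On \<open>ker\<close> the operator \<open>A\<close> is \<open>N + K\<close>,
    since \<open>q\<close> vanishes there. That the summand \<open>K\<close> preserves
    \<open>ker\<close> by itself uses the separation of the spectra.\<close>
  have Kker: "K x \<in> ker" if "x \<in> ker" for x
  proof (rule invariant_real_plus_skew[OF linN RN K, where V = UNIV and Q = "{0}"])
    show "ker \<subseteq> UNIV" "subspace ker" "{0} \<subseteq> ker" using ker_subspace subspace_0 by auto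
  qed (use that NKker NK in \<open>auto simp: linear_0[OF linN] linear_0[OF linK]\<close>)
  have Nker: "N x \<in> ker" if "x \<in> ker" for x
    using subspace_diff[OF ker_subspace NKker[OF that] Kker[OF that]] by simp
  have Mker: "M x \<in> ker" if "x \<in> ker" for x
    using Nker[OF that] qker[OF that] by (simp add: M_def)
  have formA: "form (A x) y = - form x (A y)" for x y
    using form_invariant[of X x y] by (simp add: A_def N_def K_def q_def)
  define h where "h = (\<lambda>x y. form (A x) (A y))"
  have hb: "bilinear h"
    unfolding bilinear_def h_def
    by (auto intro!: linearI simp: linear_add[OF linA] linear_cmul[OF linA]
        bilinear_ladd[OF form_bilinear] bilinear_radd[OF form_bilinear]
        bilinear_lmul[OF form_bilinear] bilinear_rmul[OF form_bilinear])
  \<comment> \<open>As \<open>A\<close> is skew for \<open>form\<close>, this pencil diagonalises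
    \<open>\<lambda>x. - A (A x)\<close> modulo \<open>ker\<close>, and \<open>M\<close> has to be
    examined on the eigenvectors only.\<close>
  have eig: "UNIV \<subseteq> span {x \<in> UNIV. \<exists>l. \<forall>y\<in>UNIV. h x y = l * form x y}"
  proof (rule pencil_spectral[OF form_bilinear form_commute hb _ subspace_UNIV form_nonneg])
    show "h x y = h y x" for x y unfolding h_def by (rule form_commute)
    show "h x y = 0" if "form x x = 0" for x y
      using form_ker[OF Aker[OF form_eq_0[OF that]]] by (simp add: h_def)
  qed
  have Meig: "M x \<in> ker" if l: "\<And>y. form (A x) (A y) = l * form x y" for x l
  proof (cases "form x x = 0")
    case True
    then show ?thesis using form_eq_0 Mker by blast
  next
    case False
    then have pos: "0 < form x x" using form_nonneg[of x] by simp
    have "0 \<le> l * form x x" using l[of x] form_nonneg[of "A x"] by simp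
    then have l0: "0 \<le> l" using pos by (simp add: zero_le_mult_iff)
    have "form (A (A x) + l *\<^sub>R x) y = 0" for y
      using l[of y] formA[of "A x" y]
      by (simp add: bilinear_ladd[OF form_bilinear] bilinear_lmul[OF form_bilinear])
    then have AA: "A (A x) + l *\<^sub>R x \<in> ker" by (intro form_eq_0)
    \<comment> \<open>Modulo \<open>ker\<close> this reads
      \<open>A (x + i y) = - i \<theta> (x + i y)\<close>. For \<open>l > 0\<close> the partner of
      \<open>x\<close> is \<open>A x\<close> divided by \<open>\<theta> = sqrt l\<close>; for
      \<open>l = 0\<close> both witnesses are 0.\<close>
    have "\<exists>\<theta> y. A x - \<theta> *\<^sub>R y \<in> ker \<and> A y + \<theta> *\<^sub>R x \<in> ker"
    proof (cases "l = 0")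
      case True
      then have "A x \<in> ker" using l[of x] by (intro form_eq_0) simp
      then show ?thesis using subspace_0[OF ker_subspace]
        by (intro exI[of _ 0]) (auto simp: linear_0[OF linA] intro!: exI[of _ 0])
    next
      case False
      define \<theta> where "\<theta> = sqrt l"
      have th: "\<theta> \<noteq> 0" "\<theta> * \<theta> = l" using False l0 by (auto simp: \<theta>_def)
      define y where "y = (1 / \<theta>) *\<^sub>R A x"
      have "A x - \<theta> *\<^sub>R y = 0" using th by (simp add: y_def)
      moreover have "A y + \<theta> *\<^sub>R x = (1 / \<theta>) *\<^sub>R (A (A x) + l *\<^sub>R x)"
        using th by (simp add: y_def linear_cmul[OF linA] scaleR_add_right flip: th(2))
      ultimately have "A x - \<theta> *\<^sub>R y \<in> ker" "A y + \<theta> *\<^sub>R x \<in> ker"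
        using AA ker_subspace subspace_0 subspace_scale by metis+
      then show ?thesis by blast
    qed
    then obtain \<theta> y where xy: "A x - \<theta> *\<^sub>R y \<in> ker" "A y + \<theta> *\<^sub>R x \<in> ker" by blast
    define N' where "N' = (\<lambda>(u, v). (N u, N v))"
    define K' where "K' = (\<lambda>(u, v). (K u - \<theta> *\<^sub>R v, K v + \<theta> *\<^sub>R u))"
    have N': "linear N'" unfolding N'_def
      by (auto intro!: linearI simp: lin linear_cmul[OF linN])
    have RN': "real_spectrum N'" unfolding N'_def
      using real_spectrum_pair_shift[OF linN RN, of 0] by simp
    have K': "skew_map K'" unfolding K'_def skew_map_def
      by (auto intro!: linearI simp: lin linear_cmul[OF linK] algebra_simps inner_add_left
          inner_add_right inner_diff_left inner_diff_right skew_map_swap[OF K])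
    have kk: "subspace (ker \<times> ker)" by (intro subspace_Times ker_subspace)
    have N'ker: "N' z \<in> ker \<times> ker" and K'ker: "K' z \<in> ker \<times> ker" if "z \<in> ker \<times> ker" for z
      using that Nker Kker ker_subspace
      by (auto simp: N'_def K'_def subspace_add subspace_diff subspace_scale)
    \<comment> \<open>\<open>K'\<close> is \<open>K + i \<theta>\<close> on pairs. By
      \<open>MA\<close>, the map \<open>N' + K'\<close> takes \<open>M x + i M y\<close> to
      \<open>M\<close> of \<open>(A + i \<theta>) (x + i y)\<close>, an element of
      \<open>ker\<close>.\<close>
    have "K' (M x, M y) \<in> ker \<times> ker"
    proof (rule kernel_real_plus_skew[OF N' RN' K' subspace_UNIV UNIV_I UNIV_I kk _ N'ker K'ker])
      show "N' (K' z) - K' (N' z) \<in> ker \<times> ker" for z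
      proof -
        have "N' (K' z) - K' (N' z) = 0"
          by (cases z) (simp add: N'_def K'_def lin linear_cmul[OF linN] NK zero_prod_def)
        then show ?thesis using subspace_0[OF kk] by simp
      qed
      have "N' (M x, M y) + K' (M x, M y) = (M (A x - \<theta> *\<^sub>R y), M (A y + \<theta> *\<^sub>R x))"
        by (simp add: N'_def K'_def MA linear_add[OF linM] linear_diff[OF linM]
            linear_cmul[OF linM])
      then show "N' (M x, M y) + K' (M x, M y) \<in> ker \<times> ker" using Mker xy by simp
    qed auto
    \<comment> \<open>Because \<open>M = A - K\<close>, the pair \<open>(M x, M y)\<close> is
      \<open>- K' (x, y)\<close> modulo \<open>ker\<close>. So applying \<open>K'\<close> twice
      takes \<open>(x, y)\<close> into \<open>ker\<close>; by skewness one application does so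
      already, and \<open>M x\<close> is in \<open>ker\<close>.\<close>
    moreover have Mxy: "(M x, M y) = (A x - \<theta> *\<^sub>R y, A y + \<theta> *\<^sub>R x) - K' (x, y)"
      by (simp add: K'_def A_def M_def)
    ultimately have "K' (A x - \<theta> *\<^sub>R y, A y + \<theta> *\<^sub>R x) - K' (K' (x, y)) \<in> ker \<times> ker"
      using linear_diff[OF skew_map_linear[OF K']] by metis
    then have kd: "K' (A x - \<theta> *\<^sub>R y, A y + \<theta> *\<^sub>R x) - K' (K' (x, y)) \<in> ker \<times> ker" .
    have w: "(A x - \<theta> *\<^sub>R y, A y + \<theta> *\<^sub>R x) \<in> ker \<times> ker" using xy by simp
    have KK: "K' (K' (x, y)) \<in> ker \<times> ker"
      using subspace_diff[OF kk K'ker[OF w] kd] by (simp only: diff_diff_eq2 add_diff_cancel_left')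
    have "K' (x, y) \<in> ker \<times> ker"
    proof (rule skew_square_invariant[OF K' kk _ KK])
      show "K' z \<in> ker \<times> ker" if "z \<in> ker \<times> ker" for z using that by (rule K'ker)
    qed
    then have "(M x, M y) \<in> ker \<times> ker" unfolding Mxy by (rule subspace_diff[OF kk w])
    then show ?thesis by simp
  qed
  have "M y \<in> ker" for y
  proof -
    have "{x \<in> UNIV. \<exists>l. \<forall>y\<in>UNIV. h x y = l * form x y} \<subseteq> {x. M x \<in> ker}"
      using Meig by (auto simp: h_def)
    moreover have "subspace {x. M x \<in> ker}"
      using linear_subspace_vimage[OF linM ker_subspace] by (simp add: vimage_def)
    ultimately have "span {x \<in> UNIV. \<exists>l. \<forall>y\<in>UNIV. h x y = l * form x y} \<subseteq> {x. M x \<in> ker}"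
      by (rule span_minimal)
    then show ?thesis using eig by blast
  qed
  then show ?thesis by (simp add: normal_part_def M_def N_def q_def)
qed

lemma ker_normal_part: "x \<in> ker \<Longrightarrow> x \<in> normal_part"
  by (rule normal_part_if_fixed) (simp add: ker_def)

section \<open>The derived series and the induction along it\<close>

abbreviation S :: "nat \<Rightarrow> 's set" where
  "S \<equiv> derived_series br"

lemma S_subspace: "subspace (S j)"
  by (cases j) simp_all

lemma S_bracket: "x \<in> S j \<Longrightarrow> y \<in> S j \<Longrightarrow> br x y \<in> S (Suc j)"
  by (auto intro!: span_base)

lemma S_derivation:
  assumes d: "linear d" "\<And>x y. d (br x y) = br (d x) y + br x (d y)"
  shows "x \<in> S j \<Longrightarrow> d x \<in> S j"
proof (induction j arbitrary: x)
  case (Suc j)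
  have "subspace {x. d x \<in> S (Suc j)}"
    using linear_subspace_vimage[OF d(1) S_subspace[of "Suc j"]]
    by (simp add: vimage_def del: derived_series.simps)
  moreover have "{br x y |x y. x \<in> S j \<and> y \<in> S j} \<subseteq> {x. d x \<in> S (Suc j)}"
    using Suc.IH S_bracket S_subspace[of "Suc j"] by (auto simp: d(2) simp del: derived_series.simps intro!: subspace_add)
  ultimately have "S (Suc j) \<subseteq> {x. d x \<in> S (Suc j)}"
    unfolding derived_series.simps by (rule span_minimal[rotated])
  then show ?case using Suc.prems by blast
qed simp

lemma S_ideal: "x \<in> S j \<Longrightarrow> br y x \<in> S j"
  using S_derivation[OF br_linear(1) br_derivation] .

lemma S_invariant: "x \<in> S j \<Longrightarrow> D y x \<in> S j"
  using S_derivation[OF D_lin D_derivation] .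

lemma S_Suc_subset: "S (Suc j) \<subseteq> S j"
proof -
  have "{br x y |x y. x \<in> S j \<and> y \<in> S j} \<subseteq> S j" using S_ideal by auto
  then show ?thesis using span_minimal[OF _ S_subspace] by simp
qed

text \<open>Eigenvectors \<open>x\<close> of \<open>form\<close> relative to the inner product on the quotient of \<open>S j\<close> by
  \<open>E = S (Suc j)\<close> satisfy \<open>D x x \<in> E\<close>. Since \<open>D x\<close> maps \<open>E\<close> into \<open>ker\<close>, subtracting an element of
  \<open>E \<inter> ker\<close> from \<open>x\<close> leaves \<open>D x\<close> unchanged and achieves \<open>D x x = 0\<close>.\<close>
lemma normal_part_step:
  assumes good: "S (Suc j) \<subseteq> normal_part" and ker2: "S (Suc (Suc j)) \<subseteq> ker"
  shows "S j \<subseteq> normal_part"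
proof -
  define E where "E = S (Suc j)"
  have E: "subspace E" unfolding E_def by (rule S_subspace)
  have ES: "E \<subseteq> S j" unfolding E_def by (rule S_Suc_subset)
  have DE: "D y x \<in> E" if "x \<in> E" for x y using that unfolding E_def by (rule S_invariant)
  have "\<exists>w. w \<in> E \<and> (\<forall>e\<in>E. (x - w) \<bullet> e = 0)" for x
  proof -
    obtain y z where yz: "y \<in> span E" "\<And>w. w \<in> span E \<Longrightarrow> orthogonal z w" "x = y + z"
      using orthogonal_subspace_decomp_exists[of E x] by metis
    then show ?thesis using E by (intro exI[of _ y]) (auto simp: orthogonal_def span_base span_eq_iff[THEN iffD2])
  qed
  then obtain P where PE: "\<And>x. P x \<in> E" and Porth: "\<And>x e. e \<in> E \<Longrightarrow> (x - P x) \<bullet> e = 0"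
    by metis
  define h where "h = (\<lambda>x y. (x - P x) \<bullet> (y - P y))"
  have h_left: "h x y = (x - P x) \<bullet> y" for x y
    using Porth[OF PE, of x y] by (simp add: h_def inner_diff_right)
  have h_right: "h x y = x \<bullet> (y - P y)" for x y
    using Porth[OF PE, of y x] by (simp add: h_def inner_diff_left inner_commute)
  have hb: "bilinear h"
    unfolding bilinear_def
  proof (intro conjI allI)
    show "linear (h x)" for x unfolding h_left by (auto intro!: linearI simp: inner_add_right)
    show "linear (\<lambda>x. h x y)" for y unfolding h_right by (auto intro!: linearI simp: inner_add_left)
  qed
  have hsym: "h x y = h y x" for x y by (simp add: h_def inner_commute)
  \<comment> \<open>A null vector of \<open>form\<close> need not be one of \<open>h\<close>, nor
    conversely; the sum dominates both and so satisfies the kernel condition of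
    \<open>pencil_spectral\<close>. The degenerate eigenvectors, with \<open>form x x = 0\<close> or
    \<open>x - P x = 0\<close>, lie in \<open>ker\<close> or in \<open>E\<close>.\<close>
  define g where "g = (\<lambda>x y. form x y + h x y)"
  have gb: "bilinear g"
    unfolding bilinear_def g_def
    by (auto intro!: linearI simp: bilinear_ladd[OF form_bilinear] bilinear_radd[OF form_bilinear]
        bilinear_lmul[OF form_bilinear] bilinear_rmul[OF form_bilinear] bilinear_ladd[OF hb]
        bilinear_radd[OF hb] bilinear_lmul[OF hb] bilinear_rmul[OF hb] algebra_simps)
  have eig: "S j \<subseteq> span {x \<in> S j. \<exists>l. \<forall>y\<in>S j. h x y = l * g x y}"
  proof (rule pencil_spectral[OF gb _ hb hsym S_subspace])
    show "g x y = g y x" for x y unfolding g_def using form_commute hsym by metis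
    show "0 \<le> g x x" for x using form_nonneg[of x] by (simp add: g_def h_def)
    show "h x y = 0" if "g x x = 0" for x y
    proof -
      have "h x x = 0" using that form_nonneg[of x] by (simp add: g_def h_def add_nonneg_eq_0_iff)
      then have "x - P x = 0" by (simp add: h_def)
      then show ?thesis by (simp add: h_def)
    qed
  qed
  have "x \<in> normal_part" if x: "x \<in> S j" and l: "\<And>y. y \<in> S j \<Longrightarrow> h x y = l * g x y" for x l
  proof (cases "form x x = 0 \<or> x - P x = 0")
    case True
    then show ?thesis
      using form_eq_0 ker_normal_part good PE[of x] by (auto simp: E_def)
  next
    case False
    then have h0: "h x x \<noteq> 0" and f0: "form x x \<noteq> 0" by (auto simp: h_def)
    then have l0: "l \<noteq> 0" using l[OF x] by auto
    have l1: "l \<noteq> 1" using l[OF x] f0 by (auto simp: g_def)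
    define K where "K = D x"
    have K: "skew_map K" unfolding K_def by (rule D_skew)
    have linK: "linear K" by (rule skew_map_linear[OF K])
    define w where "w = P x"
    have w: "w \<in> E" "w \<in> S j" using PE ES by (auto simp: w_def)
    have orth: "D y (x - w) \<bullet> e = 0" if "e \<in> E" for y e
      using Porth[OF DE[OF that], of x y] by (simp add: skew_map_swap[OF D_skew] w_def)
    \<comment> \<open>\<open>form x\<close> vanishes on \<open>?b\<close> by invariance, and then
      the eigenvalue equation with \<open>l \<noteq> 1\<close> gives \<open>h x ?b = 0\<close>. In
      this product \<open>br x y\<close> drops out because it is in \<open>E\<close> and
      \<open>D y x\<close> because of skewness; what remains is
      \<open>(x - w) \<bullet> D x y = 0\<close>.\<close>
    have "K (x - w) \<bullet> y = 0" if y: "y \<in> S j" for y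
    proof -
      let ?b = "br x y + D x y - D y x"
      have brE: "br x y \<in> E" unfolding E_def using x y by (rule S_bracket)
      have "?b \<in> S j" using brE ES x y S_invariant S_subspace
        by (auto intro!: subspace_diff subspace_add)
      then have "h x ?b = l * h x ?b" using l[of ?b] form_self_bracket[of x y] by (simp add: g_def)
      then have "h x ?b = 0" using l1 by simp
      then have "(x - w) \<bullet> br x y + (x - w) \<bullet> D x y - (x - w) \<bullet> D y x = 0"
        by (simp add: h_left w_def inner_add_right inner_diff_right)
      moreover have "(x - w) \<bullet> br x y = 0" using Porth[OF brE] by (simp add: w_def)
      moreover have "(x - w) \<bullet> D y x = 0"
      proof -
        have "D y (x - w) \<bullet> (x - w) = 0"
          using skew_map_swap[OF D_skew, of y "x - w" "x - w"] by (simp add: inner_commute)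
        moreover have "D y (x - w) \<bullet> w = 0" using orth w by blast
        ultimately have "D y (x - w) \<bullet> x = 0" by (simp add: inner_diff_right)
        then show ?thesis using skew_map_swap[OF D_skew, of y "x - w" x] by simp
      qed
      ultimately show ?thesis by (simp add: K_def skew_map_swap[OF D_skew])
    qed
    moreover have "K (x - w) \<in> S j"
      unfolding K_def using S_invariant subspace_diff[OF S_subspace x w(2)] by blast
    ultimately have "K (x - w) = 0" by (metis inner_eq_zero_iff)
    then have Kxw: "K x = K w" by (simp add: linear_diff[OF linK])
    define N where "N = br x"
    have linN: "linear N" unfolding N_def by (rule br_linear)
    define Q where "Q = S (Suc (Suc j))"
    define Z where "Z = E \<inter> ker"
    have Z: "subspace Z" unfolding Z_def using E ker_subspace by (rule subspace_inter)
    have Q: "subspace Q" unfolding Q_def by (rule S_subspace)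
    have QZ: "Q \<subseteq> Z" unfolding Q_def Z_def E_def using ker2 S_Suc_subset by blast
    have NE: "N u \<in> E" and KE: "K u \<in> E" if "u \<in> E" for u
      using that S_ideal[of u "Suc j"] DE unfolding N_def K_def E_def by blast+
    have NQ: "N u \<in> Q" and KQ: "K u \<in> Q" if "u \<in> Q" for u
      using that unfolding N_def K_def Q_def by (rule S_ideal, rule S_invariant)
    \<comment> \<open>Normality of \<open>u\<close> with \<open>x\<close> as second argument:
      \<open>br u x - D x u\<close> is \<open>- (N u + K u)\<close>.\<close>
    have TE: "N u + K u \<in> Z" if u: "u \<in> E" for u
    proof -
      have "br u x - D x u \<in> ker" using good u by (auto simp: E_def normal_part_def)
      then have "- (br u x - D x u) \<in> ker" by (rule subspace_neg[OF ker_subspace])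
      then have "N u + K u \<in> ker" using br_swap[of u x] by (simp add: N_def K_def add.commute)
      then show ?thesis using NE[OF u] KE[OF u] E by (simp add: Z_def subspace_add)
    qed
    \<comment> \<open>The defect is \<open>- br (D x x) u\<close>. Since \<open>D x x = K w\<close>
      is in \<open>E\<close>, it falls into the next term of the derived series.\<close>
    have NKQ: "N (K u) - K (N u) \<in> Q" if u: "u \<in> E" for u
    proof -
      have "K w \<in> E" using w KE by blast
      then have "br (K x) u \<in> Q" unfolding Kxw Q_def using u unfolding E_def by (rule S_bracket)
      then have "- br (K x) u \<in> Q" by (rule subspace_neg[OF Q])
      then show ?thesis by (simp add: N_def K_def D_derivation)
    qed
    have KZ: "K u \<in> Z" if "u \<in> Z" for u
      using invariant_real_plus_skew[OF linN ad_real[of x, folded N_def] K E NE KE Q NQ KQ Z QZ _ _ NKQ that]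
        TE by (auto simp: Z_def)
    have NZ: "N u \<in> Z" if "u \<in> Z" for u
      using subspace_diff[OF Z TE KZ[OF that], of u] that by (simp add: Z_def)
    have "K w \<in> Z"
      using kernel_real_plus_skew[OF linN ad_real[of x, folded N_def] K E NE KE Z _ NZ KZ _ w(1) TE[OF w(1)]]
        NKQ QZ by (auto simp: Z_def)
    then obtain w1 where w1: "w1 \<in> Z" "K w1 = K w"
      using skew_orthogonal_part[OF K Z KZ] by blast
    have "D (x - w1) v = K v" for v
      using w1 by (simp add: K_def Z_def ker_def D_simps)
    then have "D (x - w1) (x - w1) = 0" using w1 Kxw by (simp add: linear_diff[OF linK])
    then have "x - w1 \<in> normal_part" by (rule normal_part_if_fixed)
    moreover have "w1 \<in> normal_part" using w1 good by (auto simp: Z_def E_def)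
    ultimately have "(x - w1) + w1 \<in> normal_part" by (rule subspace_add[OF normal_part_subspace])
    then show ?thesis by simp
  qed
  then have "{x \<in> S j. \<exists>l. \<forall>y\<in>S j. h x y = l * g x y} \<subseteq> normal_part" by blast
  then have "span {x \<in> S j. \<exists>l. \<forall>y\<in>S j. h x y = l * g x y} \<subseteq> normal_part"
    by (rule span_minimal[OF _ normal_part_subspace])
  then show ?thesis using eig by blast
qed

text \<open>On the normal part \<open>x \<mapsto> - D x\<close> is a homomorphism into a Lie algebra of skew maps, where
  abelian ideals are central and central commutators vanish.\<close>
lemma ker_step:
  assumes good: "S j \<subseteq> normal_part" and ker2: "S (Suc (Suc j)) \<subseteq> ker"
  shows "S (Suc j) \<subseteq> ker"
proof -
  have hom: "D (br x y) v = - comm (D x) (D y) v" if "x \<in> S j" "y \<in> S j" for x y v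
  proof -
    have "x \<in> normal_part" "y \<in> normal_part" using that good by blast+
    then show ?thesis
      using normal_part_bracket(1)[of x y v] normal_part_bracket(2)[of y x v] by (simp add: comm_def)
  qed
  have abelian: "comm (D x) (D y) = (\<lambda>v. 0)" if "x \<in> S (Suc j)" "y \<in> S (Suc j)" for x y
  proof
    fix v
    have "br x y \<in> ker" using S_bracket[OF that] ker2 by blast
    then show "comm (D x) (D y) v = 0"
      using hom[of x y v] that S_Suc_subset by (auto simp: ker_def)
  qed
  have D_hom: "D (br x y) = comm (D y) (D x)" if "x \<in> S j" "y \<in> S j" for x y
    using hom[OF that] by (auto simp: comm_def)
  \<comment> \<open>Invariance moves \<open>D u\<close> to the other side, where it meets
    \<open>D (br w u)\<close>, with which it commutes; so the commutator has norm zero. For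
    \<open>br x y\<close> below the same computation applies, with \<open>central\<close> supplying
    the commutation.\<close>
  have central: "br w u \<in> ker" if w: "w \<in> S j" and u: "u \<in> S (Suc j)" for w u
  proof (rule form_eq_0)
    have uS: "u \<in> S j" using u S_Suc_subset by blast
    have "form (br w u) (br w u) = hs (comm (D u) (D w)) (D (br w u))"
      unfolding form_def D_hom[OF w uS] ..
    also have "\<dots> = - hs (D w) (comm (D u) (D (br w u)))"
      by (intro hs_comm D_skew D_lin)
    also have "\<dots> = 0" unfolding abelian[OF u S_ideal[OF u]] by (simp add: hs_def)
    finally show "form (br w u) (br w u) = 0" .
  qed
  have "br x y \<in> ker" if xy: "x \<in> S j" "y \<in> S j" for x y
  proof (rule form_eq_0)
    have "br x y \<in> S (Suc j)" using xy by (rule S_bracket)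
    then have "br y (br x y) \<in> ker" using central xy by blast
    moreover have "br x y \<in> S j" using S_ideal xy by blast
    ultimately have "comm (D y) (D (br x y)) = (\<lambda>v. 0)"
      using hom[OF xy(2)] by (auto simp: ker_def)
    moreover have "form (br x y) (br x y) = hs (comm (D y) (D x)) (D (br x y))"
      by (simp add: form_def flip: D_hom[OF xy])
    moreover have "\<dots> = - hs (D x) (comm (D y) (D (br x y)))"
      by (intro hs_comm D_skew D_lin)
    ultimately show "form (br x y) (br x y) = 0" by (simp add: hs_def)
  qed
  then have "{br x y |x y. x \<in> S j \<and> y \<in> S j} \<subseteq> ker" by blast
  then show ?thesis using span_minimal[OF _ ker_subspace] by simp
qed

theorem D_normal:
  assumes "solvable br"
  shows "D (br x y - D y x) v = 0"
proof -
  obtain k where k: "S k = {0}" using assms by (auto simp: solvable_def)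
  have "S j \<subseteq> normal_part \<and> S (Suc j) \<subseteq> ker" if "j \<le> k" for j
    using that
  proof (induction rule: inc_induct)
    case base
    have "S (Suc k) \<subseteq> {0}" using S_Suc_subset k by metis
    then show ?case using k subspace_0[OF normal_part_subspace] subspace_0[OF ker_subspace] by auto
  next
    case (step n)
    then show ?case using normal_part_step[of n] ker_step[of n] by blast
  qed
  from this[of 0] have "x \<in> normal_part" by auto
  then show ?thesis by (simp add: normal_part_def ker_def)
qed

end

section \<open>Smooth functions on open sets\<close>

lemma has_frechet_derivative:
  "f differentiable (at x) \<Longrightarrow> (f has_derivative frechet_derivative f (at x)) (at x)"
  using frechet_derivative_works by blast

abbreviation "fderiv \<equiv> frechet_derivative"

lemma frechet_derivativeI:
  "(f has_derivative f') (at x) \<Longrightarrow> fderiv f (at x) = f'"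
  using frechet_derivative_at by metis

lemma frechet_derivative_cong_open:
  assumes "open U" "x \<in> U" "\<And>y. y \<in> U \<Longrightarrow> f y = g y"
  shows "fderiv f (at x) = fderiv g (at x)"
    and "f differentiable (at x) \<longleftrightarrow> g differentiable (at x)"
proof -
  have "(f has_derivative D) (at x) = (g has_derivative D) (at x)" for D
  proof
    assume "(f has_derivative D) (at x)"
    then show "(g has_derivative D) (at x)"
      by (rule has_derivative_transform_within_open[OF _ assms(1,2)]) (rule assms(3))
  next
    assume "(g has_derivative D) (at x)"
    then show "(f has_derivative D) (at x)"
      by (rule has_derivative_transform_within_open[OF _ assms(1,2)]) (rule assms(3)[symmetric])
  qed
  then show "fderiv f (at x) = fderiv g (at x)"
    "f differentiable (at x) \<longleftrightarrow> g differentiable (at x)"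
    by (simp_all add: frechet_derivative_def differentiable_def)
qed

lemma Ck_on_cong:
  assumes "open U" "\<And>x. x \<in> U \<Longrightarrow> f x = g x"
  shows "Ck_on k f U \<longleftrightarrow> Ck_on k g U"
  using assms(2)
proof (induction k arbitrary: f g)
  case 0
  then show ?case by (auto cong: continuous_on_cong)
next
  case (Suc k)
  have "Ck_on k (\<lambda>x. fderiv f (at x) v) U \<longleftrightarrow> Ck_on k (\<lambda>x. fderiv g (at x) v) U" for v
  proof (rule Suc.IH)
    fix x assume "x \<in> U"
    then have "fderiv f (at x) = fderiv g (at x)"
      using Suc.prems by (intro frechet_derivative_cong_open(1)[OF assms(1)])
    then show "fderiv f (at x) v = fderiv g (at x) v" by simp
  qed
  moreover have "f differentiable (at x) \<longleftrightarrow> g differentiable (at x)" if "x \<in> U" for x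
    using Suc.prems that by (intro frechet_derivative_cong_open(2)[OF assms(1)])
  ultimately show ?case by simp
qed

lemma Ck_on_subset: "Ck_on k f U \<Longrightarrow> V \<subseteq> U \<Longrightarrow> Ck_on k f V"
  by (induction k arbitrary: f) (auto intro: continuous_on_subset)

lemma Ck_on_continuous: "Ck_on k f U \<Longrightarrow> continuous_on U f"
  by (cases k) (auto intro!: continuous_at_imp_continuous_on differentiable_imp_continuous_within)

lemma Ck_on_Suc: "Ck_on (Suc k) f U \<Longrightarrow> Ck_on k f U"
proof (induction k arbitrary: f)
  case 0
  then show ?case using Ck_on_continuous[of 1] by auto
next
  case (Suc k)
  then show ?case by simp
qed

lemma Ck_on_SucI:
  assumes U: "open U" and D: "\<And>x. x \<in> U \<Longrightarrow> (f has_derivative f' x) (at x)"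
    and f': "\<And>v. Ck_on k (\<lambda>x. f' x v) U"
  shows "Ck_on (Suc k) f U"
proof -
  have "Ck_on k (\<lambda>x. fderiv f (at x) v) U" for v
  proof -
    have "fderiv f (at x) v = f' x v" if "x \<in> U" for x
      using frechet_derivativeI[OF D[OF that]] by simp
    then show ?thesis
      using Ck_on_cong[OF U, of "\<lambda>x. fderiv f (at x) v" "\<lambda>x. f' x v"] f' by simp
  qed
  moreover have "f differentiable (at x)" if "x \<in> U" for x using D[OF that] by (rule differentiableI)
  ultimately show ?thesis by simp
qed

lemma Ck_on_SucD:
  assumes "Ck_on (Suc k) f U"
  shows "x \<in> U \<Longrightarrow> (f has_derivative fderiv f (at x)) (at x)"
    and "Ck_on k (\<lambda>x. fderiv f (at x) v) U"
  using assms has_frechet_derivative by auto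

lemma Ck_on_const: "Ck_on k (\<lambda>x. c) U"
  by (induction k arbitrary: c) (auto simp: frechet_derivative_const)

lemma Ck_on_bounded_linear:
  assumes U: "open U" and L: "bounded_linear L" and f: "Ck_on k f U"
  shows "Ck_on k (\<lambda>x. L (f x)) U"
  using f
proof (induction k arbitrary: f)
  case 0
  then show ?case using bounded_linear.continuous_on[OF L] by auto
next
  case (Suc k)
  show ?case
  proof (rule Ck_on_SucI[OF U])
    show "((\<lambda>x. L (f x)) has_derivative (\<lambda>v. L (fderiv f (at x) v))) (at x)" if "x \<in> U" for x
      using bounded_linear.has_derivative[OF L Ck_on_SucD(1)[OF Suc.prems that]] .
    show "Ck_on k (\<lambda>x. L (fderiv f (at x) v)) U" for v
      using Suc.IH Ck_on_SucD(2)[OF Suc.prems] .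
  qed
qed

lemma Ck_on_id: "open U \<Longrightarrow> Ck_on k (\<lambda>x. x) U"
proof (cases k)
  case (Suc l)
  assume "open U"
  then show ?thesis unfolding Suc by (rule Ck_on_SucI) (auto intro: has_derivative_ident Ck_on_const)
qed simp

lemma Ck_on_add:
  assumes U: "open U"
  shows "Ck_on k f U \<Longrightarrow> Ck_on k g U \<Longrightarrow> Ck_on k (\<lambda>x. f x + g x) U"
proof (induction k arbitrary: f g)
  case 0
  then show ?case by (auto intro: continuous_on_add)
next
  case (Suc k)
  show ?case
    by (rule Ck_on_SucI[OF U has_derivative_add[OF Ck_on_SucD(1)[OF Suc.prems(1)] Ck_on_SucD(1)[OF Suc.prems(2)]]])
      (assumption+, rule Suc.IH[OF Ck_on_SucD(2)[OF Suc.prems(1)] Ck_on_SucD(2)[OF Suc.prems(2)]])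
qed

lemma Ck_on_scaleR:
  fixes f :: "'a::euclidean_space \<Rightarrow> real" and g :: "'a \<Rightarrow> 'b::real_normed_vector"
  assumes U: "open U"
  shows "Ck_on k f U \<Longrightarrow> Ck_on k g U \<Longrightarrow> Ck_on k (\<lambda>x. f x *\<^sub>R g x) U"
proof (induction k arbitrary: f g)
  case 0
  then show ?case by (auto intro: continuous_on_scaleR)
next
  case (Suc k)
  note f = Suc.prems(1) and g = Suc.prems(2)
  show ?case
  proof (rule Ck_on_SucI[OF U])
    show "((\<lambda>x. f x *\<^sub>R g x) has_derivative
        (\<lambda>v. f x *\<^sub>R fderiv g (at x) v + fderiv f (at x) v *\<^sub>R g x)) (at x)"
      if "x \<in> U" for x
      by (rule has_derivative_scaleR[OF Ck_on_SucD(1)[OF f that] Ck_on_SucD(1)[OF g that]])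
    show "Ck_on k (\<lambda>x. f x *\<^sub>R fderiv g (at x) v + fderiv f (at x) v *\<^sub>R g x) U" for v
      by (intro Ck_on_add U Suc.IH Ck_on_SucD(2)[OF f] Ck_on_SucD(2)[OF g] Ck_on_Suc[OF f] Ck_on_Suc[OF g])
  qed
qed

lemma Ck_on_sum:
  assumes "open U" "\<And>i. i \<in> I \<Longrightarrow> Ck_on k (f i) U"
  shows "Ck_on k (\<lambda>x. \<Sum>i\<in>I. f i x) U"
  using assms(2) by (induction I rule: infinite_finite_induct) (auto intro: Ck_on_const Ck_on_add assms(1))

lemma Ck_on_Pair:
  fixes f :: "'a::euclidean_space \<Rightarrow> 'b::real_normed_vector" and g :: "'a \<Rightarrow> 'c::real_normed_vector"
  assumes U: "open U"
  shows "Ck_on k f U \<Longrightarrow> Ck_on k g U \<Longrightarrow> Ck_on k (\<lambda>x. (f x, g x)) U"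
proof (induction k arbitrary: f g)
  case 0
  then show ?case by (auto intro: continuous_on_Pair)
next
  case (Suc k)
  show ?case
    by (rule Ck_on_SucI[OF U has_derivative_Pair[OF Ck_on_SucD(1)[OF Suc.prems(1)] Ck_on_SucD(1)[OF Suc.prems(2)]]])
      (assumption+, rule Suc.IH[OF Ck_on_SucD(2)[OF Suc.prems(1)] Ck_on_SucD(2)[OF Suc.prems(2)]])
qed

text \<open>In the chain rule the direction \<open>fderiv g (at x) v\<close> varies with
  \<open>x\<close>, whereas \<open>Ck_on\<close> controls derivatives in fixed directions. Expanding
  that direction over \<open>Basis\<close> makes the induction hypothesis applicable.\<close>

lemma Ck_on_compose:
  fixes g :: "'a::euclidean_space \<Rightarrow> 'b::euclidean_space" and f :: "'b \<Rightarrow> 'c::real_normed_vector"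
  assumes U: "open U" and V: "open V" and gUV: "\<And>x. x \<in> U \<Longrightarrow> g x \<in> V"
  shows "Ck_on k f V \<Longrightarrow> Ck_on k g U \<Longrightarrow> Ck_on k (\<lambda>x. f (g x)) U"
proof (induction k arbitrary: f)
  case 0
  then show ?case using gUV by (auto intro: continuous_on_compose2)
next
  case (Suc k)
  note f = Suc.prems(1) and g = Suc.prems(2)
  show ?case
  proof (rule Ck_on_SucI[OF U])
    fix x assume x: "x \<in> U"
    let ?f' = "fderiv f (at (g x))" and ?g' = "fderiv g (at x)"
    have f': "(f has_derivative ?f') (at (g x))" using Ck_on_SucD(1)[OF f gUV[OF x]] .
    have "?f' w = (\<Sum>b\<in>Basis. (w \<bullet> b) *\<^sub>R ?f' b)" for w
      using linear_sum[OF has_derivative_linear[OF f'], of "\<lambda>b. (w \<bullet> b) *\<^sub>R b" Basis]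
      by (simp add: euclidean_representation linear_cmul[OF has_derivative_linear[OF f']])
    then have eq: "(\<lambda>v. ?f' (?g' v)) = (\<lambda>v. \<Sum>b\<in>Basis. (?g' v \<bullet> b) *\<^sub>R ?f' b)"
      by (rule ext)
    have "((\<lambda>x. f (g x)) has_derivative (\<lambda>v. ?f' (?g' v))) (at x)"
      using has_derivative_compose[OF Ck_on_SucD(1)[OF g x] f'] .
    then show "((\<lambda>x. f (g x)) has_derivative (\<lambda>v. \<Sum>b\<in>Basis. (?g' v \<bullet> b) *\<^sub>R ?f' b)) (at x)"
      unfolding eq .
  next
    fix v
    show "Ck_on k (\<lambda>x. \<Sum>b\<in>Basis. (fderiv g (at x) v \<bullet> b) *\<^sub>R fderiv f (at (g x)) b) U"
      by (intro Ck_on_sum Ck_on_scaleR U Suc.IH Ck_on_SucD(2)[OF f] Ck_on_Suc[OF g]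
          Ck_on_bounded_linear[OF U bounded_linear_inner_left] Ck_on_SucD(2)[OF g])
  qed
qed

lemma Ck_on_local:
  assumes "\<And>x. x \<in> U \<Longrightarrow> \<exists>V. open V \<and> x \<in> V \<and> Ck_on k f V"
  shows "Ck_on k f U"
  using assms
proof (induction k arbitrary: f)
  case 0
  have "continuous (at x) f" if x: "x \<in> U" for x
  proof -
    obtain V where "open V" "x \<in> V" "continuous_on V f" using 0[OF x] by auto
    then show ?thesis by (simp add: continuous_on_eq_continuous_at)
  qed
  then show ?case by (simp add: continuous_at_imp_continuous_on)
next
  case (Suc k)
  have "f differentiable (at x)" if x: "x \<in> U" for x
    using Suc.prems[OF x] by auto
  moreover have "Ck_on k (\<lambda>x. fderiv f (at x) v) U" for v
  proof (rule Suc.IH)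
    fix x assume "x \<in> U"
    then obtain V where "open V" "x \<in> V" "Ck_on (Suc k) f V" using Suc.prems by blast
    then show "\<exists>V. open V \<and> x \<in> V \<and> Ck_on k (\<lambda>x. fderiv f (at x) v) V"
      using Ck_on_SucD(2) by blast
  qed
  ultimately show ?case by simp
qed

lemma smooth_onI: "(\<And>k. Ck_on k f U) \<Longrightarrow> smooth_on f U"
  by (simp add: smooth_on_def)

lemma smooth_onD: "smooth_on f U \<Longrightarrow> Ck_on k f U"
  by (simp add: smooth_on_def)

lemma smooth_on_continuous: "smooth_on f U \<Longrightarrow> continuous_on U f"
  by (rule Ck_on_continuous[OF smooth_onD])

lemma smooth_on_has_derivative:
  "smooth_on f U \<Longrightarrow> x \<in> U \<Longrightarrow> (f has_derivative fderiv f (at x)) (at x)"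
  by (rule Ck_on_SucD(1)[OF smooth_onD])

lemma smooth_on_derivative: "smooth_on f U \<Longrightarrow> smooth_on (\<lambda>x. fderiv f (at x) v) U"
  by (rule smooth_onI, rule Ck_on_SucD(2)[OF smooth_onD])

lemma smooth_on_cong:
  assumes "open U" "\<And>x. x \<in> U \<Longrightarrow> f x = g x"
  shows "smooth_on f U \<longleftrightarrow> smooth_on g U"
  using Ck_on_cong[OF assms] by (simp add: smooth_on_def)

lemma smooth_on_subset: "smooth_on f U \<Longrightarrow> V \<subseteq> U \<Longrightarrow> smooth_on f V"
  by (rule smooth_onI, rule Ck_on_subset[OF smooth_onD])

lemma smooth_on_const: "smooth_on (\<lambda>x. c) U"
  by (rule smooth_onI, rule Ck_on_const)

lemma smooth_on_id: "open U \<Longrightarrow> smooth_on (\<lambda>x. x) U"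
  by (rule smooth_onI, rule Ck_on_id)

lemma smooth_on_bounded_linear:
  "open U \<Longrightarrow> bounded_linear L \<Longrightarrow> smooth_on f U \<Longrightarrow> smooth_on (\<lambda>x. L (f x)) U"
  by (rule smooth_onI, rule Ck_on_bounded_linear[OF _ _ smooth_onD])

lemma smooth_on_add:
  "open U \<Longrightarrow> smooth_on f U \<Longrightarrow> smooth_on g U \<Longrightarrow> smooth_on (\<lambda>x. f x + g x) U"
  by (rule smooth_onI, rule Ck_on_add[OF _ smooth_onD smooth_onD])

lemma smooth_on_Pair:
  fixes f :: "'a::euclidean_space \<Rightarrow> 'b::real_normed_vector" and g :: "'a \<Rightarrow> 'c::real_normed_vector"
  shows "open U \<Longrightarrow> smooth_on f U \<Longrightarrow> smooth_on g U \<Longrightarrow> smooth_on (\<lambda>x. (f x, g x)) U"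
  by (rule smooth_onI, rule Ck_on_Pair[OF _ smooth_onD smooth_onD])

lemma smooth_on_compose:
  fixes g :: "'a::euclidean_space \<Rightarrow> 'b::euclidean_space"
  assumes "open U" "open V" "\<And>x. x \<in> U \<Longrightarrow> g x \<in> V" "smooth_on f V" "smooth_on g U"
  shows "smooth_on (\<lambda>x. f (g x)) U"
  using Ck_on_compose[OF assms(1-3) smooth_onD[OF assms(4)] smooth_onD[OF assms(5)]]
  by (rule smooth_onI)

lemma smooth_on_local:
  assumes "\<And>x. x \<in> U \<Longrightarrow> \<exists>V. open V \<and> x \<in> V \<and> smooth_on f V"
  shows "smooth_on f U"
proof (rule smooth_onI, rule Ck_on_local)
  fix k x assume "x \<in> U"
  then obtain V where "open V" "x \<in> V" "smooth_on f V" using assms by blast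
  then show "\<exists>V. open V \<and> x \<in> V \<and> Ck_on k f V" by (auto intro: smooth_onD)
qed

text \<open>Both second derivatives are limits of the same second difference, by the mean value theorem.\<close>
lemma second_difference_mean_value:
  fixes f :: "'a::euclidean_space \<Rightarrow> real"
  assumes f: "smooth_on f W" and h: "0 < h"
    and par: "\<And>s t. 0 \<le> s \<Longrightarrow> s \<le> h \<Longrightarrow> 0 \<le> t \<Longrightarrow> t \<le> h \<Longrightarrow> x + s *\<^sub>R u + t *\<^sub>R v \<in> W"
  obtains s t where "0 < s" "s < h" "0 < t" "t < h"
    "f (x + h *\<^sub>R u + h *\<^sub>R v) - f (x + h *\<^sub>R u) - f (x + h *\<^sub>R v) + f x =
     h * h * fderiv (\<lambda>y. fderiv f (at y) u) (at (x + s *\<^sub>R u + t *\<^sub>R v)) v"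
proof -
  have line: "((\<lambda>r. F (p + r *\<^sub>R w)) has_real_derivative F' w) (at r)"
    if "(F has_derivative F') (at (p + r *\<^sub>R w))" for F :: "'a \<Rightarrow> real" and F' p w r
  proof -
    have "((\<lambda>r. p + r *\<^sub>R w) has_derivative (\<lambda>d. d *\<^sub>R w)) (at r)"
      by (auto intro!: derivative_eq_intros)
    from has_derivative_compose[OF this that] show ?thesis
      unfolding has_field_derivative_def
      by (simp add: linear_cmul[OF has_derivative_linear[OF that]] mult_commute_abs)
  qed
  define g where "g = (\<lambda>s. f (x + h *\<^sub>R v + s *\<^sub>R u) - f (x + s *\<^sub>R u))"
  define f1 where "f1 = (\<lambda>y. fderiv f (at y) u)"
  have f1: "smooth_on f1 W" unfolding f1_def by (rule smooth_on_derivative[OF f])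
  have "(g has_real_derivative f1 (x + h *\<^sub>R v + s *\<^sub>R u) - f1 (x + s *\<^sub>R u)) (at s)"
    if "0 \<le> s" "s \<le> h" for s
    unfolding g_def f1_def
    by (intro DERIV_diff line smooth_on_has_derivative[OF f])
      (use par[of s h] par[of s 0] that h in \<open>simp_all add: algebra_simps\<close>)
  then obtain s where s: "0 < s" "s < h"
    "g h - g 0 = (h - 0) * (f1 (x + h *\<^sub>R v + s *\<^sub>R u) - f1 (x + s *\<^sub>R u))"
    using MVT2[OF h, of g "\<lambda>s. f1 (x + h *\<^sub>R v + s *\<^sub>R u) - f1 (x + s *\<^sub>R u)"] by auto
  have "((\<lambda>t. f1 (x + s *\<^sub>R u + t *\<^sub>R v)) has_real_derivative
      fderiv f1 (at (x + s *\<^sub>R u + t *\<^sub>R v)) v) (at t)" if "0 \<le> t" "t \<le> h" for t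
    by (intro line smooth_on_has_derivative[OF f1] par) (use s that in auto)
  then obtain t where t: "0 < t" "t < h"
    "f1 (x + s *\<^sub>R u + h *\<^sub>R v) - f1 (x + s *\<^sub>R u + 0 *\<^sub>R v) =
      (h - 0) * fderiv f1 (at (x + s *\<^sub>R u + t *\<^sub>R v)) v"
    using MVT2[OF h, of "\<lambda>t. f1 (x + s *\<^sub>R u + t *\<^sub>R v)"
        "\<lambda>t. fderiv f1 (at (x + s *\<^sub>R u + t *\<^sub>R v)) v"] by auto
  have "g h - g 0 = h * (f1 (x + s *\<^sub>R u + h *\<^sub>R v) - f1 (x + s *\<^sub>R u + 0 *\<^sub>R v))"
    using s(3) by (simp add: algebra_simps)
  then have "g h - g 0 = h * h * fderiv f1 (at (x + s *\<^sub>R u + t *\<^sub>R v)) v"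
    unfolding t(3) by simp
  then show thesis
    using that[OF s(1,2) t(1,2)] by (simp add: g_def f1_def algebra_simps)
qed

lemma symmetric_second_derivative:
  fixes f :: "'a::euclidean_space \<Rightarrow> real"
  assumes f: "smooth_on f W" and W: "open W" "x \<in> W"
  shows "fderiv (\<lambda>y. fderiv f (at y) u) (at x) v =
    fderiv (\<lambda>y. fderiv f (at y) v) (at x) u"
proof (rule ccontr)
  define A where "A = (\<lambda>y. fderiv (\<lambda>y. fderiv f (at y) u) (at y) v)"
  define B where "B = (\<lambda>y. fderiv (\<lambda>y. fderiv f (at y) v) (at y) u)"
  assume "\<not> ?thesis"
  then have ne: "A x \<noteq> B x" by (simp add: A_def B_def)
  define e where "e = \<bar>A x - B x\<bar> / 2"
  have e: "0 < e" using ne by (simp add: e_def)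
  have "continuous_on W A" "continuous_on W B"
    unfolding A_def B_def by (intro smooth_on_continuous smooth_on_derivative f)+
  then have "continuous (at x) A" "continuous (at x) B"
    using W by (auto simp: continuous_on_eq_continuous_at)
  then obtain d1 d2 where d: "0 < d1" "0 < d2"
    "\<And>y. dist y x < d1 \<Longrightarrow> dist (A y) (A x) < e" "\<And>y. dist y x < d2 \<Longrightarrow> dist (B y) (B x) < e"
    using e unfolding continuous_at_eps_delta by metis
  obtain d3 where d3: "0 < d3" "ball x d3 \<subseteq> W" using W open_contains_ball by blast
  define d where "d = min d3 (min d1 d2)"
  have d0: "0 < d" using d d3 by (simp add: d_def)
  \<comment> \<open>\<open>h\<close> is chosen so that the parallelogram spanned by \<open>h\<close>
    times \<open>u\<close> and \<open>h\<close> times \<open>v\<close> at \<open>x\<close> stays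
    within distance \<open>d\<close>; the summand 1 keeps \<open>n\<close> positive when
    \<open>u\<close> and \<open>v\<close> are zero.\<close>
  define n where "n = norm u + norm v + 1"
  have n: "1 \<le> n" by (simp add: n_def)
  define h where "h = d / (2 * n)"
  have h: "0 < h" unfolding h_def using d0 n by simp
  have near: "dist (x + s *\<^sub>R u + t *\<^sub>R v) x < d" if "0 \<le> s" "s \<le> h" "0 \<le> t" "t \<le> h" for s t
  proof -
    have "dist (x + s *\<^sub>R u + t *\<^sub>R v) x \<le> norm (s *\<^sub>R u) + norm (t *\<^sub>R v)"
      using norm_triangle_ineq[of "s *\<^sub>R u" "t *\<^sub>R v"] by (simp add: dist_norm add.assoc)
    also have "\<dots> \<le> h * norm u + h * norm v"
      using that by (simp add: add_mono mult_right_mono)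
    also have "\<dots> \<le> h * n" using h by (simp add: n_def distrib_left)
    also have "\<dots> < d" using n d0 by (simp add: h_def)
    finally show ?thesis .
  qed
  have par: "x + s *\<^sub>R u + t *\<^sub>R v \<in> W" if "0 \<le> s" "s \<le> h" "0 \<le> t" "t \<le> h" for s t
    using near[OF that] d3 by (auto simp: d_def dist_commute)
  have par': "x + s *\<^sub>R v + t *\<^sub>R u \<in> W" if "0 \<le> s" "s \<le> h" "0 \<le> t" "t \<le> h" for s t
    using par[OF that(3,4,1,2)] by (simp add: algebra_simps)
  obtain s t where st: "0 < s" "s < h" "0 < t" "t < h"
    "f (x + h *\<^sub>R u + h *\<^sub>R v) - f (x + h *\<^sub>R u) - f (x + h *\<^sub>R v) + f x = h * h * A (x + s *\<^sub>R u + t *\<^sub>R v)"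
    unfolding A_def by (rule second_difference_mean_value[OF f h par])
  obtain s' t' where st': "0 < s'" "s' < h" "0 < t'" "t' < h"
    "f (x + h *\<^sub>R v + h *\<^sub>R u) - f (x + h *\<^sub>R v) - f (x + h *\<^sub>R u) + f x = h * h * B (x + s' *\<^sub>R v + t' *\<^sub>R u)"
    unfolding B_def by (rule second_difference_mean_value[OF f h par'])
  have "h * h * A (x + s *\<^sub>R u + t *\<^sub>R v) = h * h * B (x + t' *\<^sub>R u + s' *\<^sub>R v)"
    using st(5) st'(5) by (simp add: algebra_simps)
  then have "A (x + s *\<^sub>R u + t *\<^sub>R v) = B (x + t' *\<^sub>R u + s' *\<^sub>R v)" using h by simp
  moreover have "dist (A (x + s *\<^sub>R u + t *\<^sub>R v)) (A x) < e"
    using d(3) near[of s t] st by (simp add: d_def)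
  moreover have "dist (B (x + t' *\<^sub>R u + s' *\<^sub>R v)) (B x) < e"
    using d(4) near[of t' s'] st' by (simp add: d_def)
  ultimately show False by (simp add: e_def dist_real_def abs_if split: if_splits)
qed

lemma smooth_on_partial_derivative:
  fixes H :: "'a::euclidean_space \<times> 'b::euclidean_space \<Rightarrow> real"
  assumes H: "smooth_on H W" and ab: "(a, b) \<in> W"
  shows "((\<lambda>a. H (a, b)) has_derivative (\<lambda>u. fderiv H (at (a, b)) (u, 0))) (at a)"
    and "((\<lambda>b. H (a, b)) has_derivative (\<lambda>v. fderiv H (at (a, b)) (0, v))) (at b)"
proof -
  note D = smooth_on_has_derivative[OF H ab]
  show "((\<lambda>a. H (a, b)) has_derivative (\<lambda>u. fderiv H (at (a, b)) (u, 0))) (at a)"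
    by (rule has_derivative_compose[of "\<lambda>a. (a, b)" "\<lambda>u. (u, 0)", OF _ D])
      (auto intro!: derivative_eq_intros)
  show "((\<lambda>b. H (a, b)) has_derivative (\<lambda>v. fderiv H (at (a, b)) (0, v))) (at b)"
    by (rule has_derivative_compose[of "Pair a" "Pair 0", OF _ D])
      (auto intro!: derivative_eq_intros)
qed

lemma mixed_partial_derivatives:
  fixes H :: "'a::euclidean_space \<times> 'b::euclidean_space \<Rightarrow> real"
  assumes H: "smooth_on H W" and W: "open W" "(a, b) \<in> W"
  shows "fderiv (\<lambda>a. fderiv (\<lambda>b. H (a, b)) (at b) v) (at a) u =
    fderiv (\<lambda>b. fderiv (\<lambda>a. H (a, b)) (at a) u) (at b) v"
proof -
  let ?Hv = "\<lambda>y. fderiv H (at y) (0, v)" and ?Hu = "\<lambda>y. fderiv H (at y) (u, 0)"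
  have sl: "open ((\<lambda>a. (a, b)) -` W)" "open (Pair a -` W)"
    using W(1) by (intro open_vimage continuous_intros; simp)+
  have "fderiv (\<lambda>a. fderiv (\<lambda>b. H (a, b)) (at b) v) (at a) u =
      fderiv (\<lambda>a. ?Hv (a, b)) (at a) u"
    by (rule fun_cong[OF frechet_derivative_cong_open(1)[OF sl(1)]])
      (use W frechet_derivativeI[OF smooth_on_partial_derivative(2)[OF H]] in auto)
  also have "\<dots> = fderiv ?Hv (at (a, b)) (u, 0)"
    using frechet_derivativeI[OF smooth_on_partial_derivative(1)[OF smooth_on_derivative[OF H] W(2)]] by simp
  also have "\<dots> = fderiv ?Hu (at (a, b)) (0, v)"
    by (rule symmetric_second_derivative[OF H W])
  also have "\<dots> = fderiv (\<lambda>b. ?Hu (a, b)) (at b) v"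
    using frechet_derivativeI[OF smooth_on_partial_derivative(2)[OF smooth_on_derivative[OF H] W(2)]] by simp
  also have "\<dots> = fderiv (\<lambda>b. fderiv (\<lambda>a. H (a, b)) (at a) u) (at b) v"
    by (rule fun_cong[OF frechet_derivative_cong_open(1)[OF sl(2)]])
      (use W frechet_derivativeI[OF smooth_on_partial_derivative(1)[OF H]] in auto)
  finally show ?thesis .
qed

section \<open>Charts and tangent vectors\<close>

locale manifold =
  fixes A :: "('m::topological_space, 'e::euclidean_space) atlas"
  assumes atlas: "smooth_atlas A"
begin

lemma chart_cover: obtains U \<kappa> where "(U, \<kappa>) \<in> A" "p \<in> U"
proof -
  have "p \<in> (\<Union>(U, \<kappa>)\<in>A. U)" using atlas by (simp add: smooth_atlas_def)
  then show thesis using that by auto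
qed

lemma chart:
  assumes "(U, \<kappa>) \<in> A"
  shows chart_open: "open U" and chart_image_open: "open (\<kappa> ` U)"
    and chart_homeomorphism: "homeomorphism U (\<kappa> ` U) \<kappa> (inv_into U \<kappa>)"
  using atlas assms by (auto simp: smooth_atlas_def)

lemma chart_transition:
  "(U, \<kappa>) \<in> A \<Longrightarrow> (V, \<eta>) \<in> A \<Longrightarrow> smooth_on (\<eta> \<circ> inv_into U \<kappa>) (\<kappa> ` (U \<inter> V))"
  using atlas unfolding smooth_atlas_def by fast

lemma chart_inv:
  assumes "(U, \<kappa>) \<in> A"
  shows chart_inv_left: "p \<in> U \<Longrightarrow> inv_into U \<kappa> (\<kappa> p) = p"
    and chart_inv_right: "a \<in> \<kappa> ` U \<Longrightarrow> \<kappa> (inv_into U \<kappa> a) = a"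
    and chart_inv_in: "a \<in> \<kappa> ` U \<Longrightarrow> inv_into U \<kappa> a \<in> U"
  using chart_homeomorphism[OF assms] by (auto simp: homeomorphism_def inv_into_into f_inv_into_f)

lemma chart_continuous:
  assumes "(U, \<kappa>) \<in> A"
  shows "continuous_on U \<kappa>" "continuous_on (\<kappa> ` U) (inv_into U \<kappa>)"
  using chart_homeomorphism[OF assms] by (auto simp: homeomorphism_def)

lemma chart_image_Int:
  assumes "(U, \<kappa>) \<in> A"
  shows "\<kappa> ` (U \<inter> W) = \<kappa> ` U \<inter> inv_into U \<kappa> -` W"
  using chart_inv[OF assms] by (auto intro: rev_image_eqI)

lemma chart_image_Int_open:
  assumes "(U, \<kappa>) \<in> A" "open W"
  shows "open (\<kappa> ` (U \<inter> W))"
  unfolding chart_image_Int[OF assms(1)]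
  by (rule continuous_open_preimage[OF chart_continuous(2)[OF assms(1)] chart_image_open[OF assms(1)] assms(2)])

lemma chart_preimage_open:
  assumes "(U, \<kappa>) \<in> A" "open O'"
  shows "open (U \<inter> \<kappa> -` O')"
  by (rule continuous_open_preimage[OF chart_continuous(1)[OF assms(1)] chart_open[OF assms(1)] assms(2)])

text \<open>Transition maps carry smoothness from one chart to all others, so a single chart around
  \<open>p\<close> is enough.\<close>

lemma smooth_near_chartI:
  assumes c: "(U, \<kappa>) \<in> A" "p \<in> U"
    and W: "open W" "\<kappa> p \<in> W" "W \<subseteq> \<kappa> ` U" "smooth_on (\<lambda>a. f (inv_into U \<kappa> a)) W"
  shows "smooth_near A p f"
proof -
  let ?W = "U \<inter> \<kappa> -` W"
  have "open ?W" using c(1) W(1) by (rule chart_preimage_open)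
  have "smooth_on (f \<circ> inv_into V \<eta>) (\<eta> ` (V \<inter> ?W))" if d: "(V, \<eta>) \<in> A" for V \<eta>
  proof -
  have op: "open (\<eta> ` (V \<inter> ?W))"
    using d \<open>open ?W\<close> by (rule chart_image_Int_open)
  have mem: "inv_into V \<eta> b \<in> U" "\<kappa> (inv_into V \<eta> b) \<in> W" if "b \<in> \<eta> ` (V \<inter> ?W)" for b
    using that unfolding chart_image_Int[OF d] by auto
  have tr: "smooth_on (\<lambda>b. \<kappa> (inv_into V \<eta> b)) (\<eta> ` (V \<inter> ?W))"
    using smooth_on_subset[OF chart_transition[OF d c(1)], of "\<eta> ` (V \<inter> ?W)"]
    by (auto simp: o_def)
  have "smooth_on (\<lambda>b. f (inv_into U \<kappa> (\<kappa> (inv_into V \<eta> b)))) (\<eta> ` (V \<inter> ?W))"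
    by (rule smooth_on_compose[OF op W(1) mem(2) W(4) tr])
  then show ?thesis
    by (subst smooth_on_cong[OF op, of _ "\<lambda>b. f (inv_into U \<kappa> (\<kappa> (inv_into V \<eta> b)))"])
      (simp_all add: chart_inv_left[OF c(1)] mem)
  qed
  moreover have "p \<in> ?W" using c(2) W(2) by simp
  ultimately show ?thesis unfolding smooth_near_def using \<open>open ?W\<close> by blast
qed

lemma smooth_near_chartE:
  assumes c: "(U, \<kappa>) \<in> A" "p \<in> U" and f: "smooth_near A p f"
  obtains W where "open W" "\<kappa> p \<in> W" "W \<subseteq> \<kappa> ` U" "smooth_on (\<lambda>a. f (inv_into U \<kappa> a)) W"
proof -
  obtain W where W: "open W" "p \<in> W" "\<forall>(U, \<kappa>)\<in>A. smooth_on (f \<circ> inv_into U \<kappa>) (\<kappa> ` (U \<inter> W))"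
    using f by (auto simp: smooth_near_def)
  show thesis
  proof (rule that)
    show "open (\<kappa> ` (U \<inter> W))" using c(1) W(1) by (rule chart_image_Int_open)
    show "smooth_on (\<lambda>a. f (inv_into U \<kappa> a)) (\<kappa> ` (U \<inter> W))"
      using W(3) c(1) by (auto simp: o_def)
  qed (use c(2) W(2) in auto)
qed

lemma smooth_near_has_derivative:
  assumes "(U, \<kappa>) \<in> A" "p \<in> U" "smooth_near A p f"
  shows "((\<lambda>a. f (inv_into U \<kappa> a)) has_derivative fderiv (\<lambda>a. f (inv_into U \<kappa> a)) (at (\<kappa> p))) (at (\<kappa> p))"
  using smooth_near_chartE[OF assms] smooth_on_has_derivative by metis

lemma smooth_near_nhd:
  assumes "smooth_near A p f"
  obtains W where "open W" "p \<in> W" "\<forall>q\<in>W. smooth_near A q f"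
  using assms unfolding smooth_near_def by blast

lemma smooth_near_transform:
  assumes f: "smooth_near A p f" and W: "open W" "p \<in> W" and eq: "\<And>q. q \<in> W \<Longrightarrow> f q = g q"
  shows "smooth_near A p g"
proof -
  obtain U \<kappa> where c: "(U, \<kappa>) \<in> A" "p \<in> U" by (rule chart_cover)
  obtain O' where O': "open O'" "\<kappa> p \<in> O'" "O' \<subseteq> \<kappa> ` U" "smooth_on (\<lambda>a. f (inv_into U \<kappa> a)) O'"
    using smooth_near_chartE[OF c f] .
  let ?O = "O' \<inter> \<kappa> ` (U \<inter> W)"
  have op: "open ?O" using O'(1) chart_image_Int_open[OF c(1) W(1)] by blast
  show ?thesis
  proof (rule smooth_near_chartI[OF c op])
    show "\<kappa> p \<in> ?O" "?O \<subseteq> \<kappa> ` U" using O' c W by auto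
    have "inv_into U \<kappa> a \<in> W" if "a \<in> ?O" for a
      using that unfolding chart_image_Int[OF c(1)] by auto
    then show "smooth_on (\<lambda>a. g (inv_into U \<kappa> a)) ?O"
      using smooth_on_cong[OF op, of "\<lambda>a. f (inv_into U \<kappa> a)" "\<lambda>a. g (inv_into U \<kappa> a)"] eq
        smooth_on_subset[OF O'(4), of ?O] by auto
  qed
qed

lemma smooth_near_add:
  assumes "smooth_near A p f" "smooth_near A p g"
  shows "smooth_near A p (\<lambda>q. f q + g q)"
proof -
  obtain U \<kappa> where c: "(U, \<kappa>) \<in> A" "p \<in> U" by (rule chart_cover)
  obtain O1 where O1: "open O1" "\<kappa> p \<in> O1" "O1 \<subseteq> \<kappa> ` U" "smooth_on (\<lambda>a. f (inv_into U \<kappa> a)) O1"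
    using smooth_near_chartE[OF c assms(1)] .
  obtain O2 where O2: "open O2" "\<kappa> p \<in> O2" "O2 \<subseteq> \<kappa> ` U" "smooth_on (\<lambda>a. g (inv_into U \<kappa> a)) O2"
    using smooth_near_chartE[OF c assms(2)] .
  show ?thesis
  proof (rule smooth_near_chartI[OF c, of "O1 \<inter> O2"])
    show "smooth_on (\<lambda>a. f (inv_into U \<kappa> a) + g (inv_into U \<kappa> a)) (O1 \<inter> O2)"
      by (intro smooth_on_add open_Int O1(1) O2(1) smooth_on_subset[OF O1(4)] smooth_on_subset[OF O2(4)]) auto
  qed (use O1 O2 in auto)
qed

lemma smooth_near_cmult:
  assumes "smooth_near A p f"
  shows "smooth_near A p (\<lambda>q. c * f q)"
proof -
  obtain U \<kappa> where ch: "(U, \<kappa>) \<in> A" "p \<in> U" by (rule chart_cover)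
  obtain O1 where O1: "open O1" "\<kappa> p \<in> O1" "O1 \<subseteq> \<kappa> ` U" "smooth_on (\<lambda>a. f (inv_into U \<kappa> a)) O1"
    using smooth_near_chartE[OF ch assms] .
  show ?thesis
    by (rule smooth_near_chartI[OF ch O1(1-3)])
      (rule smooth_on_bounded_linear[OF O1(1) bounded_linear_mult_right O1(4)])
qed

lemma smooth_near_coordinate:
  assumes c: "(U, \<kappa>) \<in> A" "p \<in> U"
  shows "smooth_near A p (\<lambda>q. \<kappa> q \<bullet> b)"
proof (rule smooth_near_chartI[OF c chart_image_open[OF c(1)]])
  show "smooth_on (\<lambda>a. \<kappa> (inv_into U \<kappa> a) \<bullet> b) (\<kappa> ` U)"
    using smooth_on_bounded_linear[OF chart_image_open[OF c(1)] bounded_linear_inner_left[of b]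
        smooth_on_id[OF chart_image_open[OF c(1)]]]
    by (subst smooth_on_cong[OF chart_image_open[OF c(1)], of _ "\<lambda>a. a \<bullet> b"])
      (simp_all add: chart_inv_right[OF c(1)])
qed (use c in auto)

text \<open>The chain rule read in the chart \<open>\<eta>\<close>. Since \<open>f\<close> is smooth
  only near \<open>g a\<close>, the domain shrinks to a neighbourhood of \<open>a\<close>.\<close>

lemma pullback_smooth:
  fixes g :: "'f::euclidean_space \<Rightarrow> 'm"
  assumes c: "(V, \<eta>) \<in> A" and W: "open W" "a \<in> W" "\<And>x. x \<in> W \<Longrightarrow> g x \<in> V"
    and g: "smooth_on (\<lambda>x. \<eta> (g x)) W" and f: "smooth_near A (g a) f"
  shows pullback_smooth_on: "\<exists>W'. open W' \<and> a \<in> W' \<and> W' \<subseteq> W \<and> smooth_on (\<lambda>x. f (g x)) W'"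
    and pullback_derivative: "fderiv (\<lambda>x. f (g x)) (at a) w =
      fderiv (\<lambda>b. f (inv_into V \<eta> b)) (at (\<eta> (g a))) (fderiv (\<lambda>x. \<eta> (g x)) (at a) w)"
proof -
  have ga: "g a \<in> V" using W by blast
  obtain O' where O': "open O'" "\<eta> (g a) \<in> O'" "O' \<subseteq> \<eta> ` V" "smooth_on (\<lambda>b. f (inv_into V \<eta> b)) O'"
    using smooth_near_chartE[OF c ga f] .
  let ?W = "W \<inter> (\<lambda>x. \<eta> (g x)) -` O'"
  have op: "open ?W"
    by (rule continuous_open_preimage[OF smooth_on_continuous[OF g] W(1) O'(1)])
  have eq: "f (g x) = f (inv_into V \<eta> (\<eta> (g x)))" if "x \<in> ?W" for x
    using that W(3) by (simp add: chart_inv_left[OF c])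
  have "smooth_on (\<lambda>x. f (inv_into V \<eta> (\<eta> (g x)))) ?W"
    by (rule smooth_on_compose[OF op O'(1) _ O'(4) smooth_on_subset[OF g]]) auto
  then have sm: "smooth_on (\<lambda>x. f (g x)) ?W"
    using smooth_on_cong[OF op, of "\<lambda>x. f (g x)" "\<lambda>x. f (inv_into V \<eta> (\<eta> (g x)))"] eq by simp
  have a: "a \<in> ?W" using W O' by simp
  have "fderiv (\<lambda>x. f (g x)) (at a) =
      fderiv (\<lambda>x. f (inv_into V \<eta> (\<eta> (g x)))) (at a)"
    by (rule frechet_derivative_cong_open(1)[OF op a eq])
  also have "\<dots> = (\<lambda>w. fderiv (\<lambda>b. f (inv_into V \<eta> b)) (at (\<eta> (g a)))
      (fderiv (\<lambda>x. \<eta> (g x)) (at a) w))"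
    by (rule frechet_derivativeI[OF has_derivative_compose[OF
        smooth_on_has_derivative[OF g W(2)] smooth_on_has_derivative[OF O'(4,2)]]])
  finally show "fderiv (\<lambda>x. f (g x)) (at a) w =
      fderiv (\<lambda>b. f (inv_into V \<eta> b)) (at (\<eta> (g a))) (fderiv (\<lambda>x. \<eta> (g x)) (at a) w)"
    by simp
  show "\<exists>W'. open W' \<and> a \<in> W' \<and> W' \<subseteq> W \<and> smooth_on (\<lambda>x. f (g x)) W'"
    using op a sm by blast
qed

abbreviation chart_deriv :: "'m set \<Rightarrow> ('m \<Rightarrow> 'e) \<Rightarrow> 'm \<Rightarrow> ('m \<Rightarrow> real) \<Rightarrow> 'e \<Rightarrow> real" where
  "chart_deriv U \<kappa> p f \<equiv> fderiv (\<lambda>a. f (inv_into U \<kappa> a)) (at (\<kappa> p))"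

text \<open>A tangent vector comes with some chart; the derivative of the transition map converts
  its direction to any other chart at \<open>p\<close>.\<close>

lemma tangent_space_chart:
  assumes v: "v \<in> tangent_space A p" and c: "(U, \<kappa>) \<in> A" "p \<in> U"
  obtains w where "\<forall>f. v f = (if smooth_near A p f then chart_deriv U \<kappa> p f w else 0)"
proof -
  obtain V \<eta> w0 where d: "(V, \<eta>) \<in> A" "p \<in> V" and
    v: "v = (\<lambda>f. if smooth_near A p f then fderiv (f \<circ> inv_into V \<eta>) (at (\<eta> p)) w0 else 0)"
    using v unfolding tangent_space_def by blast
  let ?W = "\<eta> ` (V \<inter> U)"
  have op: "open ?W" using d(1) chart_open[OF c(1)] by (rule chart_image_Int_open)
  have mem: "\<eta> p \<in> ?W" using c d by auto
  have U: "inv_into V \<eta> x \<in> U" if "x \<in> ?W" for x using that unfolding chart_image_Int[OF d(1)] by auto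
  have sm: "smooth_on (\<lambda>x. \<kappa> (inv_into V \<eta> x)) ?W"
    using chart_transition[OF d(1) c(1)] by (simp add: o_def)
  have p: "inv_into V \<eta> (\<eta> p) = p" by (rule chart_inv_left[OF d])
  let ?w = "fderiv (\<lambda>x. \<kappa> (inv_into V \<eta> x)) (at (\<eta> p)) w0"
  have "v f = (if smooth_near A p f then chart_deriv U \<kappa> p f ?w else 0)" for f
  proof (cases "smooth_near A p f")
    case True
    then have "smooth_near A (inv_into V \<eta> (\<eta> p)) f" using p by simp
    from pullback_derivative[OF c(1) op mem U sm this, of w0] True show ?thesis
      by (simp add: v p o_def)
  qed (simp add: v)
  then show thesis using that by blast
qed

lemma tangent_spaceI:
  assumes c: "(U, \<kappa>) \<in> A" "p \<in> U"
    and v: "\<And>f. smooth_near A p f \<Longrightarrow> v f = chart_deriv U \<kappa> p f w"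
    and v0: "\<And>f. \<not> smooth_near A p f \<Longrightarrow> v f = 0"
  shows "v \<in> tangent_space A p"
proof -
  have "v = (\<lambda>f. if smooth_near A p f then fderiv (f \<circ> inv_into U \<kappa>) (at (\<kappa> p)) w else 0)"
    using v v0 by (auto simp: o_def)
  then show ?thesis unfolding tangent_space_def using c by blast
qed

lemma tangent_space_not_smooth: "v \<in> tangent_space A p \<Longrightarrow> \<not> smooth_near A p f \<Longrightarrow> v f = 0"
  by (auto simp: tangent_space_def)

lemma tangent_space_local:
  assumes v: "v \<in> tangent_space A p" and W: "open W" "p \<in> W" and eq: "\<And>q. q \<in> W \<Longrightarrow> f q = g q"
  shows "v f = v g"
proof -
  obtain U \<kappa> where c: "(U, \<kappa>) \<in> A" "p \<in> U" by (rule chart_cover)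
  obtain w where w: "\<forall>f. v f = (if smooth_near A p f then chart_deriv U \<kappa> p f w else 0)"
    using tangent_space_chart[OF v c] .
  have "smooth_near A p f \<longleftrightarrow> smooth_near A p g"
    using smooth_near_transform[OF _ W, of f g] smooth_near_transform[OF _ W, of g f] eq by metis
  moreover have "chart_deriv U \<kappa> p f = chart_deriv U \<kappa> p g"
  proof (rule frechet_derivative_cong_open(1)[OF chart_image_Int_open[OF c(1) W(1)]])
    show "\<kappa> p \<in> \<kappa> ` (U \<inter> W)" using c W by auto
    show "f (inv_into U \<kappa> a) = g (inv_into U \<kappa> a)" if "a \<in> \<kappa> ` (U \<inter> W)" for a
      using that eq unfolding chart_image_Int[OF c(1)] by auto
  qed
  ultimately show ?thesis by (simp add: w)
qed

lemma tangent_space_add: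
  assumes v: "v \<in> tangent_space A p" and f: "smooth_near A p f" and g: "smooth_near A p g"
  shows "v (\<lambda>q. f q + g q) = v f + v g"
proof -
  obtain U \<kappa> where c: "(U, \<kappa>) \<in> A" "p \<in> U" by (rule chart_cover)
  obtain w where w: "\<forall>f. v f = (if smooth_near A p f then chart_deriv U \<kappa> p f w else 0)"
    using tangent_space_chart[OF v c] .
  have "fderiv (\<lambda>a. f (inv_into U \<kappa> a) + g (inv_into U \<kappa> a)) (at (\<kappa> p)) =
     (\<lambda>w. chart_deriv U \<kappa> p f w + chart_deriv U \<kappa> p g w)"
    by (rule frechet_derivativeI[OF has_derivative_add[OF smooth_near_has_derivative[OF c f]
        smooth_near_has_derivative[OF c g]]])
  then show ?thesis using f g smooth_near_add[OF f g] by (simp add: w)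
qed

lemma tangent_space_cmult:
  assumes v: "v \<in> tangent_space A p" and f: "smooth_near A p f"
  shows "v (\<lambda>q. c * f q) = c * v f"
proof -
  obtain U \<kappa> where ch: "(U, \<kappa>) \<in> A" "p \<in> U" by (rule chart_cover)
  obtain w where w: "\<forall>f. v f = (if smooth_near A p f then chart_deriv U \<kappa> p f w else 0)"
    using tangent_space_chart[OF v ch] .
  have "fderiv (\<lambda>a. c * f (inv_into U \<kappa> a)) (at (\<kappa> p)) =
     (\<lambda>w. c * chart_deriv U \<kappa> p f w)"
    by (rule frechet_derivativeI[OF has_derivative_mult_right[OF smooth_near_has_derivative[OF ch f]]])
  then show ?thesis using f smooth_near_cmult[OF f] by (simp add: w)
qed

lemma tangent_space_diff:
  assumes v: "v \<in> tangent_space A p" and f: "smooth_near A p f" and g: "smooth_near A p g"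
  shows "v (\<lambda>q. f q - g q) = v f - v g"
  using tangent_space_add[OF v f smooth_near_cmult[OF g, of "- 1"]] tangent_space_cmult[OF v g, of "- 1"]
  by simp

lemma tangent_space_coordinates:
  assumes v: "v \<in> tangent_space A p" and c: "(U, \<kappa>) \<in> A" "p \<in> U" and f: "smooth_near A p f"
  shows "v f = chart_deriv U \<kappa> p f (\<Sum>b\<in>Basis. v (\<lambda>q. \<kappa> q \<bullet> b) *\<^sub>R b)"
proof -
  obtain w where w: "\<forall>f. v f = (if smooth_near A p f then chart_deriv U \<kappa> p f w else 0)"
    using tangent_space_chart[OF v c] .
  have "v (\<lambda>q. \<kappa> q \<bullet> b) = w \<bullet> b" for b
  proof -
    have "fderiv (\<lambda>a. \<kappa> (inv_into U \<kappa> a) \<bullet> b) (at (\<kappa> p)) = fderiv (\<lambda>a. a \<bullet> b) (at (\<kappa> p))"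
      by (rule frechet_derivative_cong_open(1)[OF chart_image_open[OF c(1)]])
        (use c chart_inv_right[OF c(1)] in auto)
    also have "\<dots> = (\<lambda>w. w \<bullet> b)"
      by (rule frechet_derivativeI) (auto intro!: derivative_eq_intros)
    finally show ?thesis by (simp add: w smooth_near_coordinate[OF c])
  qed
  then show ?thesis using f by (simp add: w euclidean_representation)
qed

end

lemma smooth_map_chart:
  assumes A: "smooth_atlas A" and F: "smooth_map A A F"
    and c: "(U, \<kappa>) \<in> A" "p \<in> U" and d: "(V, \<eta>) \<in> A" "F p \<in> V"
  obtains W where "open W" "\<kappa> p \<in> W" "W \<subseteq> \<kappa> ` U" "\<forall>a\<in>W. F (inv_into U \<kappa> a) \<in> V"
    "smooth_on (\<lambda>a. \<eta> (F (inv_into U \<kappa> a))) W"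
proof -
  interpret manifold A by unfold_locales (rule A)
  have "open (F -` V)"
    using F chart_open[OF d(1)] by (intro open_vimage) (auto simp: smooth_map_def)
  then have "open (\<kappa> ` (U \<inter> F -` V))" by (rule chart_image_Int_open[OF c(1)])
  moreover have "smooth_on (\<lambda>a. \<eta> (F (inv_into U \<kappa> a))) (\<kappa> ` (U \<inter> F -` V))"
    using F c d by (auto simp: smooth_map_def o_def)
  ultimately show thesis
    using c d by (intro that) (auto simp: chart_image_Int[OF c(1)] chart_inv[OF c(1)])
qed

lemma (in manifold) smooth_near_comp:
  assumes F: "smooth_map A A F" and f: "smooth_near A (F p) f"
  shows "smooth_near A p (\<lambda>q. f (F q))"
proof -
  obtain U \<kappa> where c: "(U, \<kappa>) \<in> A" "p \<in> U" by (rule chart_cover)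
  obtain V \<eta> where d: "(V, \<eta>) \<in> A" "F p \<in> V" by (rule chart_cover)
  obtain W where W: "open W" "\<kappa> p \<in> W" "W \<subseteq> \<kappa> ` U" "\<forall>a\<in>W. F (inv_into U \<kappa> a) \<in> V"
    "smooth_on (\<lambda>a. \<eta> (F (inv_into U \<kappa> a))) W"
    using smooth_map_chart[OF atlas F c d] .
  have "smooth_near A (F (inv_into U \<kappa> (\<kappa> p))) f" using f by (simp add: chart_inv_left[OF c])
  from pullback_smooth_on[OF d(1) W(1,2) W(4)[rule_format] W(5) this] obtain W' where
    "open W'" "\<kappa> p \<in> W'" "W' \<subseteq> W" "smooth_on (\<lambda>a. f (F (inv_into U \<kappa> a))) W'" by blast
  then show ?thesis using W(3) by (intro smooth_near_chartI[OF c, of W']) auto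
qed

lemma (in manifold) push_tangent:
  assumes F: "smooth_map A A F" and v: "v \<in> tangent_space A p"
  shows "push A F p v \<in> tangent_space A (F p)"
proof -
  obtain U \<kappa> where c: "(U, \<kappa>) \<in> A" "p \<in> U" by (rule chart_cover)
  obtain V \<eta> where d: "(V, \<eta>) \<in> A" "F p \<in> V" by (rule chart_cover)
  obtain w where w: "\<forall>f. v f = (if smooth_near A p f then chart_deriv U \<kappa> p f w else 0)"
    using tangent_space_chart[OF v c] .
  obtain W where W: "open W" "\<kappa> p \<in> W" "W \<subseteq> \<kappa> ` U" "\<forall>a\<in>W. F (inv_into U \<kappa> a) \<in> V"
    "smooth_on (\<lambda>a. \<eta> (F (inv_into U \<kappa> a))) W"
    using smooth_map_chart[OF atlas F c d] .
  show ?thesis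
  proof (rule tangent_spaceI[OF d])
    fix f assume f: "smooth_near A (F p) f"
    then have "smooth_near A (F (inv_into U \<kappa> (\<kappa> p))) f" by (simp add: chart_inv_left[OF c])
    from pullback_derivative[OF d(1) W(1,2) W(4)[rule_format] W(5) this, of w]
    have "fderiv (\<lambda>a. f (F (inv_into U \<kappa> a))) (at (\<kappa> p)) w =
      chart_deriv V \<eta> (F p) f
        (fderiv (\<lambda>a. \<eta> (F (inv_into U \<kappa> a))) (at (\<kappa> p)) w)"
      by (simp add: chart_inv_left[OF c])
    then show "push A F p v f = chart_deriv V \<eta> (F p) f
        (fderiv (\<lambda>a. \<eta> (F (inv_into U \<kappa> a))) (at (\<kappa> p)) w)"
      using f smooth_near_comp[OF F f] by (simp add: push_def w o_def)
  qed (simp add: push_def)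
qed

text \<open>The properties of the charts are hypotheses rather than consequences of an atlas, so
  that one factor may be the real line with the chart \<open>id\<close> as well as the
  group.\<close>

lemma smooth_map_prod_chart:
  assumes \<Phi>: "smooth_map (prod_atlas B A) C (\<lambda>(x, y). \<Phi> x y)"
    and c: "(U, \<kappa>) \<in> B" "open (\<kappa> ` U)" "inj_on \<kappa> U" "continuous_on (\<kappa> ` U) (inv_into U \<kappa>)" "x \<in> U"
    and d: "(V, \<eta>) \<in> A" "open (\<eta> ` V)" "inj_on \<eta> V" "continuous_on (\<eta> ` V) (inv_into V \<eta>)" "y \<in> V"
    and e: "(T, \<zeta>) \<in> C" "open T" "\<Phi> x y \<in> T"
  obtains W where "open W" "(\<kappa> x, \<eta> y) \<in> W" "W \<subseteq> \<kappa> ` U \<times> \<eta> ` V"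
    "\<forall>z\<in>W. \<Phi> (inv_into U \<kappa> (fst z)) (inv_into V \<eta> (snd z)) \<in> T"
    "smooth_on (\<lambda>z. \<zeta> (\<Phi> (inv_into U \<kappa> (fst z)) (inv_into V \<eta> (snd z)))) W"
proof -
  let ?\<Phi> = "\<lambda>(x, y). \<Phi> x y"
  let ?i = "\<lambda>z. (inv_into U \<kappa> (fst z), inv_into V \<eta> (snd z))"
  let ?W = "map_prod \<kappa> \<eta> ` ((U \<times> V) \<inter> ?\<Phi> -` T)"
  have inj: "inj_on (map_prod \<kappa> \<eta>) (U \<times> V)" using c(3) d(3) by (rule map_prod_inj_on)
  have inv: "inv_into (U \<times> V) (map_prod \<kappa> \<eta>) z = ?i z" if "z \<in> \<kappa> ` U \<times> \<eta> ` V" for z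
    using that c(3) d(3) by (intro inv_into_f_eq[OF inj]) (auto simp: inv_into_into f_inv_into_f)
  have W: "?W = (\<kappa> ` U \<times> \<eta> ` V) \<inter> ?i -` (?\<Phi> -` T)"
  proof (intro set_eqI iffI)
    fix z assume "z \<in> (\<kappa> ` U \<times> \<eta> ` V) \<inter> ?i -` (?\<Phi> -` T)"
    then have "?i z \<in> (U \<times> V) \<inter> ?\<Phi> -` T" "z = map_prod \<kappa> \<eta> (?i z)"
      by (auto simp: inv_into_into f_inv_into_f)
    then show "z \<in> ?W" by blast
  qed (use c(3) d(3) in auto)
  have "open (?\<Phi> -` T)" using \<Phi> e(2) by (intro open_vimage) (auto simp: smooth_map_def)
  then have op: "open ?W"
    unfolding W
    by (intro continuous_open_preimage open_Times c d continuous_on_Pair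
        continuous_on_compose2[OF c(4)] continuous_on_compose2[OF d(4)] continuous_on_fst
        continuous_on_snd continuous_on_id) auto
  have "(U \<times> V, map_prod \<kappa> \<eta>) \<in> prod_atlas B A" using c(1) d(1) by (auto simp: prod_atlas_def)
  then have "smooth_on (\<zeta> \<circ> ?\<Phi> \<circ> inv_into (U \<times> V) (map_prod \<kappa> \<eta>)) ?W"
    using \<Phi> e(1) unfolding smooth_map_def by fast
  then have sm: "smooth_on (\<lambda>z. \<zeta> (\<Phi> (inv_into U \<kappa> (fst z)) (inv_into V \<eta> (snd z)))) ?W"
    by (subst smooth_on_cong[OF op, of _ "\<zeta> \<circ> ?\<Phi> \<circ> inv_into (U \<times> V) (map_prod \<kappa> \<eta>)"])
      (auto simp: W inv)
  show thesis
    by (rule that[OF op _ _ _ sm]) (use c d e in \<open>auto simp: W\<close>)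
qed

section \<open>Smooth vector fields\<close>

lemma inv_into_UNIV_id: "inv_into UNIV (id :: 'a \<Rightarrow> 'a) = id"
  using inv_id by simp

lemma real_chart:
  "(UNIV, id) \<in> real_atlas" "open (id ` UNIV :: real set)" "inj_on id (UNIV :: real set)"
  "continuous_on (id ` UNIV) (inv_into UNIV (id :: real \<Rightarrow> real))"
  by (simp_all add: real_atlas_def inv_into_UNIV_id)

lemma open_slice_left: "open W \<Longrightarrow> open {a. (a, b) \<in> W}"
  using open_vimage[of W "\<lambda>a. (a, b)"] by (simp add: vimage_def continuous_on_Pair)

lemma open_slice_right: "open W \<Longrightarrow> open {b. (a, b) \<in> W}"
  using open_vimage[of W "\<lambda>b. (a, b)"] by (simp add: vimage_def continuous_on_Pair)

lemma smooth_on_slice_left: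
  fixes H :: "'a::euclidean_space \<times> 'b::euclidean_space \<Rightarrow> 'c::real_normed_vector"
  assumes "open W" "smooth_on H W"
  shows "smooth_on (\<lambda>a. H (a, b)) {a. (a, b) \<in> W}"
  by (rule smooth_on_compose[OF open_slice_left[OF assms(1)] assms(1) _ assms(2)
        smooth_on_Pair[OF open_slice_left[OF assms(1)] smooth_on_id[OF open_slice_left[OF assms(1)]] smooth_on_const]])
    simp

lemma smooth_on_slice_right:
  fixes H :: "'a::euclidean_space \<times> 'b::euclidean_space \<Rightarrow> 'c::real_normed_vector"
  assumes "open W" "smooth_on H W"
  shows "smooth_on (\<lambda>b. H (a, b)) {b. (a, b) \<in> W}"
  by (rule smooth_on_compose[OF open_slice_right[OF assms(1)] assms(1) _ assms(2)
        smooth_on_Pair[OF open_slice_right[OF assms(1)] smooth_on_const smooth_on_id[OF open_slice_right[OF assms(1)]]]])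
    simp

context manifold
begin

lemma chart_inj: "(U, \<kappa>) \<in> A \<Longrightarrow> inj_on \<kappa> U"
  using chart_inv_left by (metis inj_on_inverseI)

definition smooth_field :: "'m vfield \<Rightarrow> bool" where
  "smooth_field X \<longleftrightarrow> (\<forall>p. X p \<in> tangent_space A p) \<and>
     (\<forall>p f. smooth_near A p f \<longrightarrow> smooth_near A p (\<lambda>q. X q f))"

lemma smooth_field_tangent: "smooth_field X \<Longrightarrow> X p \<in> tangent_space A p"
  by (simp add: smooth_field_def)

lemma smooth_field_apply: "smooth_field X \<Longrightarrow> smooth_near A p f \<Longrightarrow> smooth_near A p (\<lambda>q. X q f)"
  by (simp add: smooth_field_def)

lemma vf_bracket_eq:
  "smooth_near A p f \<Longrightarrow> vf_bracket A X Y p f = X p (\<lambda>q. Y q f) - Y p (\<lambda>q. X q f)"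
  by (simp add: vf_bracket_def)

text \<open>The guard in \<open>vf_bracket\<close> leaves the commutator formula valid near
  \<open>p\<close> only; this suffices because tangent vectors depend on germs.\<close>

lemma tangent_vf_bracket:
  assumes v: "v \<in> tangent_space A p" and X: "smooth_field X" and Y: "smooth_field Y"
    and f: "smooth_near A p f"
  shows "v (\<lambda>q. vf_bracket A X Y q f) = v (\<lambda>q. X q (\<lambda>r. Y r f)) - v (\<lambda>q. Y q (\<lambda>r. X r f))"
proof -
  obtain W where W: "open W" "p \<in> W" "\<forall>q\<in>W. smooth_near A q f"
    using smooth_near_nhd[OF f] .
  have "v (\<lambda>q. vf_bracket A X Y q f) = v (\<lambda>q. X q (\<lambda>r. Y r f) - Y q (\<lambda>r. X r f))"
    by (rule tangent_space_local[OF v W(1,2)]) (simp add: vf_bracket_eq W(3))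
  also have "\<dots> = v (\<lambda>q. X q (\<lambda>r. Y r f)) - v (\<lambda>q. Y q (\<lambda>r. X r f))"
    by (rule tangent_space_diff[OF v smooth_field_apply[OF X smooth_field_apply[OF Y f]]
          smooth_field_apply[OF Y smooth_field_apply[OF X f]]])
  finally show ?thesis .
qed

lemma vf_bracket_jacobi:
  assumes X: "smooth_field X" and Y: "smooth_field Y" and Z: "smooth_field Z"
  shows "vf_bracket A X (vf_bracket A Y Z) =
    vf_add (vf_bracket A (vf_bracket A X Y) Z) (vf_bracket A Y (vf_bracket A X Z))"
proof (rule ext, rule ext)
  fix p f
  show "vf_bracket A X (vf_bracket A Y Z) p f =
    vf_add (vf_bracket A (vf_bracket A X Y) Z) (vf_bracket A Y (vf_bracket A X Z)) p f"
  proof (cases "smooth_near A p f")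
    case f: True
    have s: "smooth_near A p (\<lambda>q. X q f)" "smooth_near A p (\<lambda>q. Y q f)" "smooth_near A p (\<lambda>q. Z q f)"
      using smooth_field_apply f X Y Z by auto
    show ?thesis
      by (simp add: vf_add_def vf_bracket_eq f s tangent_vf_bracket[OF smooth_field_tangent] X Y Z)
  qed (simp add: vf_bracket_def vf_add_def)
qed

lemma vf_bracket_add_right:
  assumes "smooth_field X" "smooth_field Y" "smooth_field Z"
  shows "vf_bracket A X (vf_add Y Z) = vf_add (vf_bracket A X Y) (vf_bracket A X Z)"
proof (rule ext, rule ext)
  fix p f
  show "vf_bracket A X (vf_add Y Z) p f = vf_add (vf_bracket A X Y) (vf_bracket A X Z) p f"
  proof (cases "smooth_near A p f")
    case f: True
    show ?thesis
      by (simp add: vf_add_def vf_bracket_eq f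
          tangent_space_add[OF smooth_field_tangent[OF assms(1)] smooth_field_apply[OF assms(2) f] smooth_field_apply[OF assms(3) f]])
  qed (simp add: vf_bracket_def vf_add_def)
qed

lemma vf_bracket_swap: "vf_bracket A X Y = vf_scale (- 1) (vf_bracket A Y X)"
  by (rule ext, rule ext) (simp add: vf_bracket_def vf_scale_def)

context
  fixes B :: "('n::topological_space, 'f::euclidean_space) atlas"
    and C :: "('k::topological_space, 'h::euclidean_space) atlas"
    and \<Phi> :: "'n \<Rightarrow> 'k \<Rightarrow> 'm" and U \<kappa> V \<eta> x y f
  assumes \<Phi>: "smooth_map (prod_atlas B C) A (\<lambda>(x, y). \<Phi> x y)"
    and c: "(U, \<kappa>) \<in> B" "open (\<kappa> ` U)" "inj_on \<kappa> U" "continuous_on (\<kappa> ` U) (inv_into U \<kappa>)" "x \<in> U"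
    and d: "(V, \<eta>) \<in> C" "open (\<eta> ` V)" "inj_on \<eta> V" "continuous_on (\<eta> ` V) (inv_into V \<eta>)" "y \<in> V"
    and f: "smooth_near A (\<Phi> x y) f"
begin

lemma product_pullback:
  obtains W where "open W" "(\<kappa> x, \<eta> y) \<in> W" "W \<subseteq> \<kappa> ` U \<times> \<eta> ` V"
    "smooth_on (\<lambda>z. f (\<Phi> (inv_into U \<kappa> (fst z)) (inv_into V \<eta> (snd z)))) W"
proof -
  obtain T \<zeta> where e: "(T, \<zeta>) \<in> A" "\<Phi> x y \<in> T" by (rule chart_cover)
  obtain W where W: "open W" "(\<kappa> x, \<eta> y) \<in> W" "W \<subseteq> \<kappa> ` U \<times> \<eta> ` V"
    "\<forall>z\<in>W. \<Phi> (inv_into U \<kappa> (fst z)) (inv_into V \<eta> (snd z)) \<in> T"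
    "smooth_on (\<lambda>z. \<zeta> (\<Phi> (inv_into U \<kappa> (fst z)) (inv_into V \<eta> (snd z)))) W"
    using smooth_map_prod_chart[OF \<Phi> c d e(1) chart_open[OF e(1)] e(2)] .
  have "smooth_near A (\<Phi> (inv_into U \<kappa> (fst (\<kappa> x, \<eta> y))) (inv_into V \<eta> (snd (\<kappa> x, \<eta> y)))) f"
    using f c(3,5) d(3,5) by simp
  from pullback_smooth_on[OF e(1) W(1,2) W(4)[rule_format] W(5) this] W(3) show thesis
    using that by blast
qed

text \<open>Applied to the group multiplication this interchanges derivatives in the left and right
  factor; applied to a flow, those in time and space.\<close>

lemma product_mixed_derivatives:
  shows "fderiv (\<lambda>a. fderiv (\<lambda>b. f (\<Phi> (inv_into U \<kappa> a) (inv_into V \<eta> b))) (at (\<eta> y)) v) (at (\<kappa> x)) u =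
    fderiv (\<lambda>b. fderiv (\<lambda>a. f (\<Phi> (inv_into U \<kappa> a) (inv_into V \<eta> b))) (at (\<kappa> x)) u) (at (\<eta> y)) v"
proof -
  obtain W where W: "open W" "(\<kappa> x, \<eta> y) \<in> W" "W \<subseteq> \<kappa> ` U \<times> \<eta> ` V"
    "smooth_on (\<lambda>z. f (\<Phi> (inv_into U \<kappa> (fst z)) (inv_into V \<eta> (snd z)))) W"
    using product_pullback .
  from mixed_partial_derivatives[OF W(4,1,2), of v u] show ?thesis by simp
qed

lemma product_partial_smooth:
  shows "\<exists>W. open W \<and> \<eta> y \<in> W \<and> smooth_on
      (\<lambda>b. fderiv (\<lambda>a. f (\<Phi> (inv_into U \<kappa> a) (inv_into V \<eta> b))) (at (\<kappa> x)) u) W"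
    and "\<exists>W. open W \<and> \<kappa> x \<in> W \<and> smooth_on
      (\<lambda>a. fderiv (\<lambda>b. f (\<Phi> (inv_into U \<kappa> a) (inv_into V \<eta> b))) (at (\<eta> y)) v) W"
proof -
  let ?H = "\<lambda>z. f (\<Phi> (inv_into U \<kappa> (fst z)) (inv_into V \<eta> (snd z)))"
  obtain W where W: "open W" "(\<kappa> x, \<eta> y) \<in> W" "W \<subseteq> \<kappa> ` U \<times> \<eta> ` V" "smooth_on ?H W"
    using product_pullback .
  have r: "smooth_on (\<lambda>b. fderiv ?H (at (\<kappa> x, b)) (u, 0)) {b. (\<kappa> x, b) \<in> W}"
    using smooth_on_slice_right[OF W(1) smooth_on_derivative[OF W(4)]] .
  have "smooth_on (\<lambda>b. fderiv (\<lambda>a. f (\<Phi> (inv_into U \<kappa> a) (inv_into V \<eta> b))) (at (\<kappa> x)) u)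
      {b. (\<kappa> x, b) \<in> W}"
  proof (subst smooth_on_cong[OF open_slice_right[OF W(1)]])
    show "fderiv (\<lambda>a. f (\<Phi> (inv_into U \<kappa> a) (inv_into V \<eta> b))) (at (\<kappa> x)) u =
        fderiv ?H (at (\<kappa> x, b)) (u, 0)" if "b \<in> {b. (\<kappa> x, b) \<in> W}" for b
      using frechet_derivativeI[OF smooth_on_partial_derivative(1)[OF W(4), of "\<kappa> x" b]] that by simp
  qed (rule r)
  then show "\<exists>W. open W \<and> \<eta> y \<in> W \<and> smooth_on
      (\<lambda>b. fderiv (\<lambda>a. f (\<Phi> (inv_into U \<kappa> a) (inv_into V \<eta> b))) (at (\<kappa> x)) u) W"
    using W(2) open_slice_right[OF W(1)] by blast
  have l: "smooth_on (\<lambda>a. fderiv ?H (at (a, \<eta> y)) (0, v)) {a. (a, \<eta> y) \<in> W}"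
    using smooth_on_slice_left[OF W(1) smooth_on_derivative[OF W(4)]] .
  have "smooth_on (\<lambda>a. fderiv (\<lambda>b. f (\<Phi> (inv_into U \<kappa> a) (inv_into V \<eta> b))) (at (\<eta> y)) v)
      {a. (a, \<eta> y) \<in> W}"
  proof (subst smooth_on_cong[OF open_slice_left[OF W(1)]])
    show "fderiv (\<lambda>b. f (\<Phi> (inv_into U \<kappa> a) (inv_into V \<eta> b))) (at (\<eta> y)) v =
        fderiv ?H (at (a, \<eta> y)) (0, v)" if "a \<in> {a. (a, \<eta> y) \<in> W}" for a
      using frechet_derivativeI[OF smooth_on_partial_derivative(2)[OF W(4), of a "\<eta> y"]] that by simp
  qed (rule l)
  then show "\<exists>W. open W \<and> \<kappa> x \<in> W \<and> smooth_on
      (\<lambda>a. fderiv (\<lambda>b. f (\<Phi> (inv_into U \<kappa> a) (inv_into V \<eta> b))) (at (\<eta> y)) v) W"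
    using W(2) open_slice_left[OF W(1)] by blast
qed

end

text \<open>This covers both generators of flows and translation fields.\<close>
lemma action_field:
  fixes B :: "('n::topological_space, 'f::euclidean_space) atlas"
  assumes \<Phi>: "smooth_map (prod_atlas B A) A (\<lambda>(x, y). \<Phi> x y)"
    and c: "(U, \<kappa>) \<in> B" "open (\<kappa> ` U)" "inj_on \<kappa> U" "continuous_on (\<kappa> ` U) (inv_into U \<kappa>)" "x0 \<in> U"
    and unit: "\<And>p. \<Phi> x0 p = p"
    and X: "\<And>p f. smooth_near A p f \<Longrightarrow> X p f = fderiv (\<lambda>a. f (\<Phi> (inv_into U \<kappa> a) p)) (at (\<kappa> x0)) w"
    and X0: "\<And>p f. \<not> smooth_near A p f \<Longrightarrow> X p f = 0"
  shows "smooth_field X"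
proof -
  have x0: "inv_into U \<kappa> (\<kappa> x0) = x0" using c(3,5) by simp
  have "X p \<in> tangent_space A p" for p
  proof -
    obtain V \<eta> where d: "(V, \<eta>) \<in> A" "p \<in> V" by (rule chart_cover)
    have "\<Phi> x0 p \<in> V" using d unit by simp
    then obtain W where W: "open W" "(\<kappa> x0, \<eta> p) \<in> W" "W \<subseteq> \<kappa> ` U \<times> \<eta> ` V"
      "\<forall>z\<in>W. \<Phi> (inv_into U \<kappa> (fst z)) (inv_into V \<eta> (snd z)) \<in> V"
      "smooth_on (\<lambda>z. \<eta> (\<Phi> (inv_into U \<kappa> (fst z)) (inv_into V \<eta> (snd z)))) W"
      using smooth_map_prod_chart[OF \<Phi> c d(1) chart_image_open[OF d(1)] chart_inj[OF d(1)]
          chart_continuous(2)[OF d(1)] d(2) d(1) chart_open[OF d(1)]] by blast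
    let ?W = "{a. (a, \<eta> p) \<in> W}"
    have g: "\<Phi> (inv_into U \<kappa> a) p \<in> V" if "a \<in> ?W" for a
      using W(4) that chart_inv_left[OF d] by force
    have sm: "smooth_on (\<lambda>a. \<eta> (\<Phi> (inv_into U \<kappa> a) p)) ?W"
      using smooth_on_slice_left[OF W(1,5), of "\<eta> p"] chart_inv_left[OF d] by simp
    show ?thesis
    proof (rule tangent_spaceI[OF d])
      fix f assume f: "smooth_near A p f"
      then have "smooth_near A (\<Phi> (inv_into U \<kappa> (\<kappa> x0)) p) f" by (simp add: x0 unit)
      from pullback_derivative[OF d(1) open_slice_left[OF W(1)] _ g sm this, of w] W(2)
      show "X p f = chart_deriv V \<eta> p f
          (fderiv (\<lambda>a. \<eta> (\<Phi> (inv_into U \<kappa> a) p)) (at (\<kappa> x0)) w)"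
        by (simp add: X f x0 unit)
    qed (rule X0)
  qed
  moreover have "smooth_near A p (\<lambda>q. X q f)" if f: "smooth_near A p f" for p f
  proof -
    obtain V \<eta> where d: "(V, \<eta>) \<in> A" "p \<in> V" by (rule chart_cover)
    obtain N where N: "open N" "p \<in> N" "\<forall>q\<in>N. smooth_near A q f"
      using smooth_near_nhd[OF f] .
    have "smooth_near A (\<Phi> x0 p) f" using f by (simp add: unit)
    then obtain W where W: "open W" "(\<kappa> x0, \<eta> p) \<in> W" "W \<subseteq> \<kappa> ` U \<times> \<eta> ` V"
      "smooth_on (\<lambda>z. f (\<Phi> (inv_into U \<kappa> (fst z)) (inv_into V \<eta> (snd z)))) W"
      using product_pullback[OF \<Phi> c d(1) chart_image_open[OF d(1)] chart_inj[OF d(1)]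
          chart_continuous(2)[OF d(1)] d(2)] by blast
    let ?H = "\<lambda>z. f (\<Phi> (inv_into U \<kappa> (fst z)) (inv_into V \<eta> (snd z)))"
    let ?W = "{b. (\<kappa> x0, b) \<in> W} \<inter> \<eta> ` (V \<inter> N)"
    have op: "open ?W"
      using open_slice_right[OF W(1)] chart_image_Int_open[OF d(1) N(1)] by (rule open_Int)
    have "X (inv_into V \<eta> b) f = fderiv ?H (at (\<kappa> x0, b)) (w, 0)" if "b \<in> ?W" for b
    proof -
      have "inv_into V \<eta> b \<in> N" using that unfolding chart_image_Int[OF d(1)] by auto
      moreover have "(\<kappa> x0, b) \<in> W" using that by blast
      ultimately show ?thesis
        using frechet_derivativeI[OF smooth_on_partial_derivative(1)[OF W(4), of "\<kappa> x0" b]] by (simp add: X N(3))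
    qed
    moreover have "smooth_on (\<lambda>b. fderiv ?H (at (\<kappa> x0, b)) (w, 0)) ?W"
      using smooth_on_slice_right[OF W(1) smooth_on_derivative[OF W(4)], of "\<kappa> x0" "(w, 0)"]
      by (rule smooth_on_subset) blast
    ultimately have "smooth_on (\<lambda>b. X (inv_into V \<eta> b) f) ?W"
      by (subst smooth_on_cong[OF op, of _ "\<lambda>b. fderiv ?H (at (\<kappa> x0, b)) (w, 0)"]) auto
    then show ?thesis
      by (intro smooth_near_chartI[OF d op]) (use W(2) N(2) d(2) in auto)
  qed
  ultimately show ?thesis by (simp add: smooth_field_def)
qed

section \<open>Generators of one-parameter groups and slices of smooth maps\<close>

lemma generator_eq:
  assumes "one_parameter_group A H \<theta>" "smooth_near A p f"
  shows "generator A \<theta> p f = fderiv (\<lambda>t. f (\<theta> t p)) (at 0) 1"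
    and "((\<lambda>t. f (\<theta> t p)) has_real_derivative generator A \<theta> p f) (at 0)"
proof -
  have \<Phi>: "smooth_map (prod_atlas real_atlas A) A (\<lambda>(t, p). \<theta> t p)" and \<theta>0: "\<theta> 0 = id"
    using assms(1) by (auto simp: one_parameter_group_def)
  obtain V \<eta> where d: "(V, \<eta>) \<in> A" "p \<in> V" by (rule chart_cover)
  have f: "smooth_near A (\<theta> 0 p) f" using assms(2) by (simp add: \<theta>0)
  obtain W where W: "open W" "(id 0, \<eta> p) \<in> W" "W \<subseteq> id ` UNIV \<times> \<eta> ` V"
    "smooth_on (\<lambda>z. f (\<theta> (inv_into UNIV id (fst z)) (inv_into V \<eta> (snd z)))) W"
    using product_pullback[OF \<Phi> real_chart UNIV_I d(1) chart_image_open[OF d(1)] chart_inj[OF d(1)]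
          chart_continuous(2)[OF d(1)] d(2) f] .
  have "((\<lambda>t. f (\<theta> t p)) has_derivative (\<lambda>u. fderiv (\<lambda>z. f (\<theta> (inv_into UNIV id (fst z)) (inv_into V \<eta> (snd z)))) (at (0, \<eta> p)) (u, 0))) (at 0)"
    using smooth_on_partial_derivative(1)[OF W(4), of 0 "\<eta> p"] W(2)
    by (simp add: inv_into_UNIV_id chart_inv_left[OF d])
  then have diff: "(\<lambda>t. f (\<theta> t p)) differentiable (at 0)" by (rule differentiableI)
  then have D: "((\<lambda>t. f (\<theta> t p)) has_derivative fderiv (\<lambda>t. f (\<theta> t p)) (at 0)) (at 0)"
    by (rule has_frechet_derivative)
  have "fderiv (\<lambda>t. f (\<theta> t p)) (at 0) u = fderiv (\<lambda>t. f (\<theta> t p)) (at 0) 1 * u" for u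
    using linear_cmul[OF has_derivative_linear[OF D], of u 1] by (simp add: mult.commute)
  then have "fderiv (\<lambda>t. f (\<theta> t p)) (at 0) = (*) (fderiv (\<lambda>t. f (\<theta> t p)) (at 0) 1)"
    by (rule ext)
  then have D': "((\<lambda>t. f (\<theta> t p)) has_real_derivative fderiv (\<lambda>t. f (\<theta> t p)) (at 0) 1) (at 0)"
    using D unfolding has_field_derivative_def by metis
  then show eq: "generator A \<theta> p f = fderiv (\<lambda>t. f (\<theta> t p)) (at 0) 1"
    using assms(2) by (simp add: generator_def DERIV_imp_deriv)
  show "((\<lambda>t. f (\<theta> t p)) has_real_derivative generator A \<theta> p f) (at 0)"
    unfolding eq by (rule D')
qed

lemma generator_smooth_field:
  assumes "one_parameter_group A H \<theta>"
  shows "smooth_field (generator A \<theta>)"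
proof (rule action_field[OF _ real_chart UNIV_I])
  show "smooth_map (prod_atlas real_atlas A) A (\<lambda>(t, p). \<theta> t p)" "\<And>p. \<theta> 0 p = p"
    using assms by (auto simp: one_parameter_group_def)
  show "generator A \<theta> p f = fderiv (\<lambda>a. f (\<theta> (inv_into UNIV id a) p)) (at (id 0)) 1"
    if "smooth_near A p f" for p f
    using generator_eq(1)[OF assms that] by (simp add: inv_into_UNIV_id)
qed (simp_all add: generator_def)

lemma smooth_map_slice:
  assumes A: "smooth_map (prod_atlas A A) A (\<lambda>(x, y). \<Phi> x y)"
  shows "smooth_map A A (\<lambda>x. \<Phi> x q)" and "smooth_map A A (\<lambda>x. \<Phi> q x)"
proof -
  have cont: "continuous_on UNIV (\<lambda>(x, y). \<Phi> x y)" using A by (simp add: smooth_map_def)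
  note d' = chart_image_open chart_inj chart_continuous(2)
  have "smooth_on (\<eta> \<circ> (\<lambda>x. \<Phi> x q) \<circ> inv_into U \<kappa>) (\<kappa> ` (U \<inter> (\<lambda>x. \<Phi> x q) -` V))"
    if c: "(U, \<kappa>) \<in> A" and e: "(V, \<eta>) \<in> A" for U \<kappa> V \<eta>
  proof (rule smooth_on_local)
    fix a assume "a \<in> \<kappa> ` (U \<inter> (\<lambda>x. \<Phi> x q) -` V)"
    then obtain x where x: "x \<in> U" "\<Phi> x q \<in> V" "a = \<kappa> x" by blast
    obtain T \<zeta> where d: "(T, \<zeta>) \<in> A" "q \<in> T" by (rule chart_cover)
    obtain W where W: "open W" "(\<kappa> x, \<zeta> q) \<in> W" "W \<subseteq> \<kappa> ` U \<times> \<zeta> ` T"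
      "\<forall>z\<in>W. \<Phi> (inv_into U \<kappa> (fst z)) (inv_into T \<zeta> (snd z)) \<in> V"
      "smooth_on (\<lambda>z. \<eta> (\<Phi> (inv_into U \<kappa> (fst z)) (inv_into T \<zeta> (snd z)))) W"
      using smooth_map_prod_chart[OF A c d'[OF c] x(1) d(1) d'[OF d(1)] d(2) e chart_open[OF e] x(2)] .
    show "\<exists>W. open W \<and> a \<in> W \<and> smooth_on (\<eta> \<circ> (\<lambda>x. \<Phi> x q) \<circ> inv_into U \<kappa>) W"
      using smooth_on_slice_left[OF W(1,5), of "\<zeta> q"] open_slice_left[OF W(1), of "\<zeta> q"] W(2) x(3)
      by (intro exI[of _ "{a. (a, \<zeta> q) \<in> W}"]) (simp add: chart_inv_left[OF d] o_def)
  qed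
  moreover have "continuous_on UNIV (\<lambda>x. \<Phi> x q)"
    using continuous_on_compose2[OF cont, of UNIV "\<lambda>x. (x, q)"] by (simp add: continuous_intros)
  ultimately show "smooth_map A A (\<lambda>x. \<Phi> x q)" by (auto simp: smooth_map_def)
  have "smooth_on (\<eta> \<circ> (\<lambda>x. \<Phi> q x) \<circ> inv_into U \<kappa>) (\<kappa> ` (U \<inter> (\<lambda>x. \<Phi> q x) -` V))"
    if c: "(U, \<kappa>) \<in> A" and e: "(V, \<eta>) \<in> A" for U \<kappa> V \<eta>
  proof (rule smooth_on_local)
    fix a assume "a \<in> \<kappa> ` (U \<inter> (\<lambda>x. \<Phi> q x) -` V)"
    then obtain x where x: "x \<in> U" "\<Phi> q x \<in> V" "a = \<kappa> x" by blast
    obtain T \<zeta> where d: "(T, \<zeta>) \<in> A" "q \<in> T" by (rule chart_cover)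
    obtain W where W: "open W" "(\<zeta> q, \<kappa> x) \<in> W" "W \<subseteq> \<zeta> ` T \<times> \<kappa> ` U"
      "\<forall>z\<in>W. \<Phi> (inv_into T \<zeta> (fst z)) (inv_into U \<kappa> (snd z)) \<in> V"
      "smooth_on (\<lambda>z. \<eta> (\<Phi> (inv_into T \<zeta> (fst z)) (inv_into U \<kappa> (snd z)))) W"
      using smooth_map_prod_chart[OF A d(1) d'[OF d(1)] d(2) c d'[OF c] x(1) e chart_open[OF e] x(2)] .
    show "\<exists>W. open W \<and> a \<in> W \<and> smooth_on (\<eta> \<circ> (\<lambda>x. \<Phi> q x) \<circ> inv_into U \<kappa>) W"
      using smooth_on_slice_right[OF W(1,5), of "\<zeta> q"] open_slice_right[OF W(1), of "\<zeta> q"] W(2) x(3)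
      by (intro exI[of _ "{a. (\<zeta> q, a) \<in> W}"]) (simp add: chart_inv_left[OF d] o_def)
  qed
  moreover have "continuous_on UNIV (\<lambda>x. \<Phi> q x)"
    using continuous_on_compose2[OF cont, of UNIV "\<lambda>x. (q, x)"] by (simp add: continuous_intros)
  ultimately show "smooth_map A A (\<lambda>x. \<Phi> q x)" by (auto simp: smooth_map_def)
qed

end

section \<open>Translation fields and isotropy fields\<close>

context manifold
begin

text \<open>For functions on the manifold that arise by differentiating in another variable: a
  formula \<open>F\<close> for them is available in chart coordinates near \<open>p\<close>.\<close>

lemma smooth_near_eq_in_chart:
  assumes c: "(U, \<kappa>) \<in> A" "p \<in> U" and W: "open W" "\<kappa> p \<in> W" "smooth_on F W"
    and N: "open N" "p \<in> N" and eq: "\<And>q. q \<in> U \<Longrightarrow> q \<in> N \<Longrightarrow> h q = F (\<kappa> q)"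
  shows "smooth_near A p h"
    and "chart_deriv U \<kappa> p h = fderiv F (at (\<kappa> p))"
proof -
  let ?N = "\<kappa> ` (U \<inter> N)"
  have opN: "open ?N" using c(1) N(1) by (rule chart_image_Int_open)
  have mem: "\<kappa> p \<in> ?N" using c N by blast
  have e: "h (inv_into U \<kappa> a) = F a" if "a \<in> ?N" for a
    using that eq by (auto simp: chart_inv_left[OF c(1)])
  show "smooth_near A p h"
  proof (rule smooth_near_chartI[OF c, of "?N \<inter> W"])
    have "smooth_on F (?N \<inter> W)" by (rule smooth_on_subset[OF W(3)]) blast
    then show "smooth_on (\<lambda>a. h (inv_into U \<kappa> a)) (?N \<inter> W)"
      by (subst smooth_on_cong[of _ _ F]) (auto simp: e opN W(1))
  qed (use opN W mem in auto)
  show "chart_deriv U \<kappa> p h = fderiv F (at (\<kappa> p))"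
    by (rule frechet_derivative_cong_open(1)[OF opN mem e])
qed

end

locale lie_group_with_algebra =
  fixes br :: "'s::euclidean_space \<Rightarrow> 's \<Rightarrow> 's"
    and G :: "('g::{t2_space, second_countable_topology}, 's) lie_group_data"
    and \<iota> :: "'s \<Rightarrow> 'g tvec"
  assumes lie_group: "lie_group G"
    and has_lie_algebra: "has_lie_algebra G br \<iota>"
begin

abbreviation "\<A> \<equiv> charts G"
abbreviation "e \<equiv> gone G"
abbreviation gmult (infixl "\<cdot>" 70) where "x \<cdot> y \<equiv> gmul G x y"
abbreviation "X \<equiv> translation_field G \<iota>"

sublocale manifold \<A>
  using lie_group by unfold_locales (simp add: lie_group_def)

sublocale grp: Groups.group "gmul G" "gone G" "ginv G"
  using lie_group by (simp add: lie_group_def)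

lemma mult_smooth: "smooth_map (prod_atlas \<A> \<A>) \<A> (\<lambda>(x, y). x \<cdot> y)"
  using lie_group by (simp add: lie_group_def)

lemmas right_smooth = smooth_map_slice(1)[OF mult_smooth]
lemmas left_smooth = smooth_map_slice(2)[OF mult_smooth]

lemma right_continuous: "continuous_on UNIV (\<lambda>x. x \<cdot> q)"
  using right_smooth by (simp add: smooth_map_def)

lemma iota_tangent: "\<iota> u \<in> tangent_space \<A> e"
  using has_lie_algebra unfolding has_lie_algebra_def bij_betw_def by blast

lemma iota_inj: "\<iota> u = \<iota> v \<Longrightarrow> u = v"
  using has_lie_algebra unfolding has_lie_algebra_def bij_betw_def inj_on_def by blast

lemma iota_inv: "v \<in> tangent_space \<A> e \<Longrightarrow> \<iota> (inv \<iota> v) = v"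
  using has_lie_algebra unfolding has_lie_algebra_def by (simp add: bij_betw_def f_inv_into_f)

lemma iota_inv': "inv \<iota> (\<iota> u) = u"
  using iota_inj by (simp add: inj_def)

lemma iota_add: "\<iota> (u + v) f = \<iota> u f + \<iota> v f"
  using has_lie_algebra by (simp add: has_lie_algebra_def)

lemma iota_scale: "\<iota> (c *\<^sub>R u) f = c * \<iota> u f"
  using has_lie_algebra by (simp add: has_lie_algebra_def)

lemmas iota_not_smooth = tangent_space_not_smooth[OF iota_tangent]

lemma iota_eqI: "(\<And>f. smooth_near \<A> e f \<Longrightarrow> \<iota> u f = \<iota> v f) \<Longrightarrow> u = v"
  using iota_inj iota_not_smooth by (metis ext)

definition coord :: "('g \<Rightarrow> 's) \<Rightarrow> 's \<Rightarrow> 's" where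
  "coord \<kappa> u = (\<Sum>b\<in>Basis. \<iota> u (\<lambda>q. \<kappa> q \<bullet> b) *\<^sub>R b)"

lemma iota_coord:
  assumes "(U, \<kappa>) \<in> \<A>" "e \<in> U" "smooth_near \<A> e f"
  shows "\<iota> u f = chart_deriv U \<kappa> e f (coord \<kappa> u)"
  unfolding coord_def by (rule tangent_space_coordinates[OF iota_tangent assms])

lemma coord_linear: "linear (coord \<kappa>)"
  unfolding coord_def
  by (rule linearI) (simp_all add: iota_add iota_scale scaleR_add_left sum.distrib scaleR_sum_right)

lemma coord_inj:
  assumes "(U, \<kappa>) \<in> \<A>" "e \<in> U"
  shows "inj (coord \<kappa>)"
proof (rule injI)
  fix u v assume "coord \<kappa> u = coord \<kappa> v"
  then show "u = v" by (intro iota_eqI) (simp add: iota_coord[OF assms])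
qed

lemma translation_eq: "smooth_near \<A> p f \<Longrightarrow> X u p f = \<iota> u (\<lambda>x. f (x \<cdot> p))"
  by (simp add: translation_field_def push_def o_def)

lemma translation_not_smooth: "\<not> smooth_near \<A> p f \<Longrightarrow> X u p f = 0"
  by (simp add: translation_field_def push_def)

lemma translation_e: "X u e = \<iota> u"
  by (rule ext, rename_tac f, case_tac "smooth_near \<A> e f")
    (simp_all add: translation_eq translation_not_smooth iota_not_smooth)

lemma translation_add: "X (u + v) = vf_add (X u) (X v)"
  by (rule ext, rule ext) (simp add: translation_field_def push_def vf_add_def iota_add)

lemma translation_scale: "X (c *\<^sub>R u) = vf_scale c (X u)"
  by (rule ext, rule ext) (simp add: translation_field_def push_def vf_scale_def iota_scale)

lemma translation_smooth_field: "smooth_field (X u)"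
proof -
  obtain U \<kappa> where c: "(U, \<kappa>) \<in> \<A>" "e \<in> U" by (rule chart_cover)
  show ?thesis
  proof (rule action_field[OF mult_smooth c(1) chart_image_open[OF c(1)] chart_inj[OF c(1)]
        chart_continuous(2)[OF c(1)] c(2)])
    fix p f assume f: "smooth_near \<A> p f"
    have "smooth_near \<A> e (\<lambda>x. f (x \<cdot> p))"
      by (rule smooth_near_comp[OF right_smooth]) (simp add: f)
    then show "X u p f = fderiv (\<lambda>a. f (inv_into U \<kappa> a \<cdot> p)) (at (\<kappa> e)) (coord \<kappa> u)"
      by (simp add: translation_eq[OF f] iota_coord[OF c])
  qed (simp_all add: translation_not_smooth)
qed

text \<open>Right translation by the inverse of \<open>q\<close> brings test functions at
  \<open>e\<close> to \<open>q\<close>, so the value at \<open>q\<close> determines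
  \<open>\<iota> u\<close>.\<close>

lemma translation_pointwise_inj:
  assumes "\<And>f. smooth_near \<A> q f \<Longrightarrow> X u q f = 0"
  shows "u = 0"
proof (rule iota_eqI)
  fix h assume h: "smooth_near \<A> e h"
  have hq: "smooth_near \<A> q (\<lambda>y. h (y \<cdot> ginv G q))"
    by (rule smooth_near_comp[OF right_smooth]) (simp add: h)
  have "\<iota> u (\<lambda>x. h (x \<cdot> q \<cdot> ginv G q)) = 0"
    using assms[OF hq] unfolding translation_eq[OF hq] .
  moreover have "\<iota> 0 h = 0" using iota_scale[of 0 0 h] by simp
  ultimately show "\<iota> u h = \<iota> 0 h" by (simp add: grp.assoc)
qed

text \<open>Both sides are the same mixed derivative of \<open>g (y \<cdot> x)\<close> at
  \<open>(e, e)\<close>.\<close>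

lemma iota_mixed:
  assumes g: "smooth_near \<A> e g"
  shows "\<iota> u (\<lambda>x. \<iota> v (\<lambda>y. g (y \<cdot> x))) = \<iota> v (\<lambda>y. \<iota> u (\<lambda>x. g (y \<cdot> x)))"
proof -
  obtain U \<kappa> where c: "(U, \<kappa>) \<in> \<A>" "e \<in> U" by (rule chart_cover)
  obtain N where N: "open N" "e \<in> N" "\<forall>q\<in>N. smooth_near \<A> q g"
    using smooth_near_nhd[OF g] .
  note c' = chart_image_open[OF c(1)] chart_inj[OF c(1)] chart_continuous(2)[OF c(1)] c(2)
  have ge: "smooth_near \<A> (e \<cdot> e) g" using g by simp
  let ?i = "inv_into U \<kappa>"
  define F1 where "F1 = (\<lambda>a. fderiv (\<lambda>b. g (?i b \<cdot> ?i a)) (at (\<kappa> e)) (coord \<kappa> v))"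
  define F2 where "F2 = (\<lambda>a. fderiv (\<lambda>b. g (?i a \<cdot> ?i b)) (at (\<kappa> e)) (coord \<kappa> u))"
  obtain W1 where W1: "open W1" "\<kappa> e \<in> W1" "smooth_on F1 W1"
    using product_partial_smooth(1)[OF mult_smooth c(1) c' c(1) c' ge] unfolding F1_def by blast
  obtain W2 where W2: "open W2" "\<kappa> e \<in> W2" "smooth_on F2 W2"
    using product_partial_smooth(2)[OF mult_smooth c(1) c' c(1) c' ge] unfolding F2_def by blast
  have h1: "\<iota> v (\<lambda>y. g (y \<cdot> x)) = F1 (\<kappa> x)" if "x \<in> U" "x \<in> N" for x
  proof -
    have "smooth_near \<A> e (\<lambda>y. g (y \<cdot> x))"
      by (rule smooth_near_comp[OF right_smooth]) (simp add: N(3) that)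
    then show ?thesis by (simp add: F1_def iota_coord[OF c] chart_inv_left[OF c(1) that(1)])
  qed
  have h2: "\<iota> u (\<lambda>x. g (y \<cdot> x)) = F2 (\<kappa> y)" if "y \<in> U" "y \<in> N" for y
  proof -
    have "smooth_near \<A> e (\<lambda>x. g (y \<cdot> x))"
      by (rule smooth_near_comp[OF left_smooth]) (simp add: N(3) that)
    then show ?thesis by (simp add: F2_def iota_coord[OF c] chart_inv_left[OF c(1) that(1)])
  qed
  have "\<iota> u (\<lambda>x. \<iota> v (\<lambda>y. g (y \<cdot> x))) = fderiv F1 (at (\<kappa> e)) (coord \<kappa> u)"
    using smooth_near_eq_in_chart[OF c W1 N(1,2) h1] by (simp add: iota_coord[OF c])
  also have "\<dots> = fderiv F2 (at (\<kappa> e)) (coord \<kappa> v)"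
    using product_mixed_derivatives[OF mult_smooth c(1) c' c(1) c' ge, of "coord \<kappa> u" "coord \<kappa> v"]
    by (simp add: F1_def F2_def)
  also have "\<dots> = \<iota> v (\<lambda>y. \<iota> u (\<lambda>x. g (y \<cdot> x)))"
    using smooth_near_eq_in_chart[OF c W2 N(1,2) h2] by (simp add: iota_coord[OF c])
  finally show ?thesis .
qed

lemma iota_bracket:
  assumes g: "smooth_near \<A> e g"
  shows "\<iota> (br u v) g = \<iota> u (\<lambda>x. \<iota> v (\<lambda>y. g (x \<cdot> y))) - \<iota> v (\<lambda>x. \<iota> u (\<lambda>y. g (x \<cdot> y)))"
proof -
  let ?L = "\<lambda>u. left_invariant_field G (\<iota> u)"
  have L: "?L u x h = (if smooth_near \<A> x h then \<iota> u (\<lambda>y. h (x \<cdot> y)) else 0)" for u x h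
    by (simp add: left_invariant_field_def push_def o_def)
  have Le: "?L u e h = \<iota> u h" for u h
    by (simp add: L iota_not_smooth)
  obtain N where N: "open N" "e \<in> N" "\<forall>q\<in>N. smooth_near \<A> q g"
    using smooth_near_nhd[OF g] .
  have loc: "\<iota> u (\<lambda>x. ?L v x g) = \<iota> u (\<lambda>x. \<iota> v (\<lambda>y. g (x \<cdot> y)))" for u v
    by (rule tangent_space_local[OF iota_tangent N(1,2)]) (simp add: L N(3))
  have "vf_bracket \<A> (?L u) (?L v) = ?L (br u v)"
    using has_lie_algebra by (simp add: has_lie_algebra_def)
  then have "vf_bracket \<A> (?L u) (?L v) e g = \<iota> (br u v) g" by (simp add: Le)
  then show ?thesis by (simp add: vf_bracket_eq g Le loc)
qed

text \<open>Iterated derivatives along translation fields multiply on the left, in the order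
  opposite to that for left-invariant fields. Rewriting them with \<open>iota_mixed\<close> gives
  \<open>iota_bracket\<close> with the sign reversed; \<open>transf_bracket\<close> cancels that
  sign.\<close>

lemma translation_bracket: "vf_bracket \<A> (X u) (X v) = vf_scale (- 1) (X (br u v))"
proof (rule ext, rule ext)
  fix p f
  show "vf_bracket \<A> (X u) (X v) p f = vf_scale (- 1) (X (br u v)) p f"
  proof (cases "smooth_near \<A> p f")
    case f: True
    define g where "g = (\<lambda>x. f (x \<cdot> p))"
    have g: "smooth_near \<A> e g"
      unfolding g_def by (rule smooth_near_comp[OF right_smooth]) (simp add: f)
    obtain N where N: "open N" "p \<in> N" "\<forall>q\<in>N. smooth_near \<A> q f"
      using smooth_near_nhd[OF f] .
    have op: "open ((\<lambda>x. x \<cdot> p) -` N)" using N(1) right_continuous by (rule open_vimage)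
    have "X u p (\<lambda>q. X v q f) = \<iota> u (\<lambda>x. \<iota> v (\<lambda>y. g (y \<cdot> x)))" for u v
    proof -
      have "X u p (\<lambda>q. X v q f) = \<iota> u (\<lambda>x. X v (x \<cdot> p) f)"
        by (rule translation_eq[OF smooth_field_apply[OF translation_smooth_field f]])
      also have "\<dots> = \<iota> u (\<lambda>x. \<iota> v (\<lambda>y. g (y \<cdot> x)))"
        by (rule tangent_space_local[OF iota_tangent op])
          (simp_all add: N translation_eq g_def grp.assoc)
      finally show ?thesis .
    qed
    then have "vf_bracket \<A> (X u) (X v) p f = - \<iota> (br u v) g"
      by (simp add: vf_bracket_eq f iota_bracket[OF g] iota_mixed[OF g, of u v] iota_mixed[OF g, of v u])
    then show ?thesis by (simp add: vf_scale_def translation_eq f g_def)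
  qed (simp add: vf_bracket_def vf_scale_def translation_not_smooth)
qed

section \<open>Isotropy fields\<close>

lemma isotropy_generator:
  assumes "Z \<in> isotropy_algebra G \<iota>"
  obtains \<theta> where "Z = generator \<A> \<theta>" "one_parameter_group \<A> {F \<in> isometries G \<iota>. F e = e} \<theta>"
  using assms by (auto simp: isotropy_algebra_def lie_of_def)

lemma isotropy_e: "Z \<in> isotropy_algebra G \<iota> \<Longrightarrow> Z e f = 0"
proof (erule isotropy_generator)
  fix \<theta> assume "Z = generator \<A> \<theta>" "one_parameter_group \<A> {F \<in> isometries G \<iota>. F e = e} \<theta>"
  then show "Z e f = 0" by (auto simp: generator_def one_parameter_group_def)
qed

lemma isotropy_smooth_field: "Z \<in> isotropy_algebra G \<iota> \<Longrightarrow> smooth_field Z"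
  by (erule isotropy_generator) (simp add: generator_smooth_field)

text \<open>The differentials \<open>Q t\<close> at \<open>e\<close> of the flow of \<open>Z\<close> are orthogonal, and
  \<open>D\<close> is their derivative at \<open>t = 0\<close>.\<close>
lemma isotropy_skew:
  assumes Z: "Z \<in> isotropy_algebra G \<iota>"
    and D: "\<And>u f. smooth_near \<A> e f \<Longrightarrow> \<iota> (D u) f = \<iota> u (\<lambda>q. Z q f)"
  shows "D u \<bullet> v = - (u \<bullet> D v)"
proof -
  obtain \<theta> where Z\<theta>: "Z = generator \<A> \<theta>" and opg: "one_parameter_group \<A> {F \<in> isometries G \<iota>. F e = e} \<theta>"
    using isotropy_generator[OF Z] .
  have \<theta>: "smooth_map (prod_atlas real_atlas \<A>) \<A> (\<lambda>(t, p). \<theta> t p)" "\<theta> 0 = id"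
    and iso: "\<theta> t \<in> isometries G \<iota>" and fix_e: "\<theta> t e = e" for t
    using opg by (auto simp: one_parameter_group_def)
  have sm\<theta>: "smooth_map \<A> \<A> (\<theta> t)" for t using iso by (simp add: isometries_def)
  define P where "P = (\<lambda>t u. push \<A> (\<theta> t) e (\<iota> u))"
  define Q where "Q = (\<lambda>t u. inv \<iota> (P t u))"
  have Pt: "P t u \<in> tangent_space \<A> e" for t u
    using push_tangent[OF sm\<theta> iota_tangent, of t u] by (simp add: P_def fix_e)
  have QP: "\<iota> (Q t u) = P t u" for t u unfolding Q_def by (rule iota_inv[OF Pt])
  have Q0: "Q 0 u = u" for u
  proof (rule iota_eqI)
    fix f assume "smooth_near \<A> e f"
    then show "\<iota> (Q 0 u) f = \<iota> u f" by (simp add: QP P_def push_def \<theta>(2) o_def)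
  qed
  have metric_e: "left_metric G \<iota> e v w = inv \<iota> v \<bullet> inv \<iota> w" if vw: "v \<in> tangent_space \<A> e" "w \<in> tangent_space \<A> e" for v w
  proof -
    have "push \<A> (\<lambda>x. ginv G e \<cdot> x) e z = z" if "z \<in> tangent_space \<A> e" for z
      using tangent_space_not_smooth[OF that] by (auto simp: push_def o_def grp.inverse_neutral)
    then show ?thesis using vw by (simp add: left_metric_def)
  qed
  have orth: "Q t u \<bullet> Q t v = u \<bullet> v" for t
  proof -
    have "left_metric G \<iota> (\<theta> t e) (P t u) (P t v) = left_metric G \<iota> e (\<iota> u) (\<iota> v)"
      using iso[of t] iota_tangent unfolding isometries_def P_def by blast
    then show ?thesis
      by (simp add: fix_e metric_e[OF Pt Pt] metric_e[OF iota_tangent iota_tangent] Q_def iota_inv')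
  qed
  obtain U \<kappa> where c: "(U, \<kappa>) \<in> \<A>" "e \<in> U" by (rule chart_cover)
  let ?i = "inv_into U \<kappa>"
  note c' = chart_image_open[OF c(1)] chart_inj[OF c(1)] chart_continuous(2)[OF c(1)] c(2)
  have deriv_b: "((\<lambda>t. coord \<kappa> (Q t u) \<bullet> b) has_real_derivative coord \<kappa> (D u) \<bullet> b) (at 0)"
    if b: "b \<in> Basis" for u b
  proof -
    let ?f = "\<lambda>q. \<kappa> q \<bullet> b"
    have fs: "smooth_near \<A> q ?f" if "q \<in> U" for q by (rule smooth_near_coordinate[OF c(1) that])
    have fe: "smooth_near \<A> (\<theta> 0 e) ?f" using fs[OF c(2)] by (simp add: \<theta>(2))
    have cb: "coord \<kappa> w \<bullet> b = \<iota> w ?f" for w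
      using b by (simp add: coord_def inner_sum_left inner_Basis if_distrib cong: if_cong)
    \<comment> \<open>\<open>F t\<close> is the \<open>b\<close>-coordinate of the differential of
      \<open>\<theta> t\<close> at \<open>e\<close> applied to \<open>u\<close>. Its
      \<open>t\<close>-derivative is a mixed derivative of the flow; with time taken first it
      becomes a derivative of the coordinate of \<open>Z\<close>, which \<open>D\<close>
      describes.\<close>
    define F where "F = (\<lambda>t. fderiv (\<lambda>a. ?f (\<theta> t (?i a))) (at (\<kappa> e)) (coord \<kappa> u))"
    have QF: "coord \<kappa> (Q t u) \<bullet> b = F t" for t
    proof -
      have "smooth_near \<A> e (\<lambda>q. ?f (\<theta> t q))"
        by (rule smooth_near_comp[OF sm\<theta>]) (simp add: fix_e fs c(2))
      then show ?thesis
        by (simp add: cb QP P_def push_def fix_e fs c(2) o_def iota_coord[OF c] F_def)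
    qed
    obtain W where W: "open W" "(0::real) \<in> W" "smooth_on F W"
      using product_partial_smooth(2)[OF \<theta>(1) real_chart UNIV_I c(1) c' fe, of "coord \<kappa> u"]
      unfolding F_def inv_into_UNIV_id by auto
    have F': "(F has_derivative fderiv F (at 0)) (at 0)"
      by (rule smooth_on_has_derivative[OF W(3,2)])
    have lin: "fderiv F (at 0) s = fderiv F (at 0) 1 * s" for s
      using linear_cmul[OF has_derivative_linear[OF F'], of s 1] by (simp add: mult.commute)
    define Zf where "Zf = (\<lambda>a. fderiv (\<lambda>t. ?f (\<theta> t (?i a))) (at 0) 1)"
    have Zf: "Z q ?f = Zf (\<kappa> q)" if "q \<in> U" "q \<in> UNIV" for q
      unfolding Z\<theta> Zf_def using generator_eq(1)[OF opg fs[OF that(1)]] by (simp add: chart_inv_left[OF c(1) that(1)])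
    obtain W' where W': "open W'" "\<kappa> e \<in> W'" "smooth_on Zf W'"
      using product_partial_smooth(1)[OF \<theta>(1) real_chart UNIV_I c(1) c' fe, of 1]
      unfolding Zf_def inv_into_UNIV_id by auto
    have "fderiv F (at 0) 1 = fderiv Zf (at (\<kappa> e)) (coord \<kappa> u)"
      using product_mixed_derivatives[OF \<theta>(1) real_chart UNIV_I c(1) c' fe, of "coord \<kappa> u" 1]
      unfolding F_def Zf_def inv_into_UNIV_id by simp
    also have "\<dots> = \<iota> u (\<lambda>q. Z q ?f)"
      using smooth_near_eq_in_chart[OF c W' open_UNIV UNIV_I Zf] by (simp add: iota_coord[OF c])
    also have "\<dots> = coord \<kappa> (D u) \<bullet> b" by (simp add: cb D fs c(2))
    finally have F1: "fderiv F (at 0) 1 = coord \<kappa> (D u) \<bullet> b" .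
    have "fderiv F (at 0) = (*) (coord \<kappa> (D u) \<bullet> b)"
      by (rule ext, subst lin, subst F1, rule refl)
    then show ?thesis unfolding QF has_field_derivative_def using F' by simp
  qed
  \<comment> \<open>Only the coordinates have been differentiated so far; a linear left inverse of
    \<open>coord\<close> carries this over to \<open>Q t u\<close> itself.\<close>
  obtain g where g: "linear g" "\<And>w. g (coord \<kappa> w) = w"
    using linear_injective_left_inverse[OF coord_linear coord_inj[OF c]] by (auto simp: fun_eq_iff)
  have Qd: "((\<lambda>t. Q t u) has_vector_derivative D u) (at 0)" for u
  proof -
    have "((\<lambda>t. (coord \<kappa> (Q t u) \<bullet> b) *\<^sub>R g b) has_vector_derivative
        (coord \<kappa> (D u) \<bullet> b) *\<^sub>R g b) (at 0)" if b: "b \<in> Basis" for b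
      using has_derivative_scaleR_left[OF deriv_b[OF b, of u, unfolded has_field_derivative_def], of "g b"]
      by (simp add: has_vector_derivative_def mult.commute)
    then have "((\<lambda>t. \<Sum>b\<in>Basis. (coord \<kappa> (Q t u) \<bullet> b) *\<^sub>R g b) has_vector_derivative
        (\<Sum>b\<in>Basis. (coord \<kappa> (D u) \<bullet> b) *\<^sub>R g b)) (at 0)"
      by (rule has_vector_derivative_sum)
    moreover have "(\<Sum>b\<in>Basis. (coord \<kappa> w \<bullet> b) *\<^sub>R g b) = w" for w
      using linear_sum[OF g(1), of "\<lambda>b. (coord \<kappa> w \<bullet> b) *\<^sub>R b" Basis] g
      by (simp add: euclidean_representation linear_cmul)
    ultimately show ?thesis by simp
  qed
  have "((\<lambda>t. Q t u \<bullet> Q t v) has_derivative (\<lambda>h. Q 0 u \<bullet> (h *\<^sub>R D v) + (h *\<^sub>R D u) \<bullet> Q 0 v)) (at 0)"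
    using Qd[of u] Qd[of v] unfolding has_vector_derivative_def by (rule has_derivative_inner)
  moreover have "((\<lambda>t. Q t u \<bullet> Q t v) has_derivative (\<lambda>h. 0)) (at 0)" unfolding orth by (rule has_derivative_const)
  ultimately have "(\<lambda>h. Q 0 u \<bullet> (h *\<^sub>R D v) + (h *\<^sub>R D u) \<bullet> Q 0 v) = (\<lambda>h. 0)"
    by (rule has_derivative_unique)
  from fun_cong[OF this, of 1] show ?thesis by (simp add: Q0)
qed

end

section \<open>Normality\<close>

text \<open>Gronwall's argument along the segment from \<open>a\<close> to \<open>b\<close>: the
  square of the norm of \<open>\<zeta>\<close> grows at rate at most
  \<open>K = 2 * (L * norm w)\<close>, so after multiplication by \<open>exp (- (K * t))\<close> it
  cannot increase, and it starts at 0.\<close>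

lemma zero_propagates:
  fixes \<zeta> :: "'a::real_normed_vector \<Rightarrow> 'b::real_inner"
  assumes S: "convex S" and D: "\<And>a. a \<in> S \<Longrightarrow> (\<zeta> has_derivative \<zeta>' a) (at a)"
    and bound: "\<And>a w. a \<in> S \<Longrightarrow> norm (\<zeta>' a w) \<le> L * norm w * norm (\<zeta> a)"
    and a: "a \<in> S" "\<zeta> a = 0" and b: "b \<in> S"
  shows "\<zeta> b = 0"
proof -
  define w where "w = b - a"
  define c where "c = (\<lambda>t. a + t *\<^sub>R w)"
  define K where "K = 2 * (L * norm w)"
  define \<phi> where "\<phi> = (\<lambda>t. exp (- (K * t)) * (\<zeta> (c t) \<bullet> \<zeta> (c t)))"
  have cS: "c t \<in> S" if "0 \<le> t" "t \<le> 1" for t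
  proof -
    have "c t = (1 - t) *\<^sub>R a + t *\<^sub>R b" by (simp add: c_def w_def algebra_simps)
    then show ?thesis using convexD_alt[OF S a(1) b that] by simp
  qed
  have "\<exists>y. (\<phi> has_real_derivative y) (at t) \<and> y \<le> 0" if t: "0 \<le> t" "t \<le> 1" for t
  proof -
    have "(c has_derivative (\<lambda>h. h *\<^sub>R w)) (at t)"
      unfolding c_def by (auto intro!: derivative_eq_intros)
    from has_derivative_compose[OF this D[OF cS[OF t]]]
    have zc: "((\<lambda>t. \<zeta> (c t)) has_derivative (\<lambda>h. \<zeta>' (c t) (h *\<^sub>R w))) (at t)" .
    have lin: "\<zeta>' (c t) (h *\<^sub>R w) = h *\<^sub>R \<zeta>' (c t) w" for h
      by (rule linear_cmul[OF has_derivative_linear[OF D[OF cS[OF t]]]])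
    define g' where "g' = 2 * (\<zeta> (c t) \<bullet> \<zeta>' (c t) w)"
    have "((\<lambda>t. \<zeta> (c t) \<bullet> \<zeta> (c t)) has_real_derivative g') (at t)"
      using has_derivative_inner[OF zc zc]
      by (rule has_derivative_imp_has_field_derivative) (simp add: lin g'_def inner_commute)
    then have "(\<phi> has_real_derivative
        exp (- (K * t)) * (- K) * (\<zeta> (c t) \<bullet> \<zeta> (c t)) + exp (- (K * t)) * g') (at t)"
      unfolding \<phi>_def by (auto intro!: derivative_eq_intros)
    moreover have "exp (- (K * t)) * (- K) * (\<zeta> (c t) \<bullet> \<zeta> (c t)) + exp (- (K * t)) * g' \<le> 0"
    proof -
      have "\<zeta> (c t) \<bullet> \<zeta>' (c t) w \<le> norm (\<zeta> (c t)) * norm (\<zeta>' (c t) w)"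
        by (rule norm_cauchy_schwarz)
      also have "\<dots> \<le> norm (\<zeta> (c t)) * (L * norm w * norm (\<zeta> (c t)))"
        by (intro mult_left_mono bound cS t) simp
      also have "\<dots> = L * norm w * (\<zeta> (c t) \<bullet> \<zeta> (c t))"
        by (simp add: power2_norm_eq_inner[symmetric] power2_eq_square)
      finally have "g' \<le> K * (\<zeta> (c t) \<bullet> \<zeta> (c t))" by (simp add: g'_def K_def)
      then have "exp (- (K * t)) * (g' - K * (\<zeta> (c t) \<bullet> \<zeta> (c t))) \<le> 0"
        by (intro mult_nonneg_nonpos) auto
      then show ?thesis by (simp add: algebra_simps)
    qed
    ultimately show ?thesis by blast
  qed
  then have "\<phi> 1 \<le> \<phi> 0"
    by (intro DERIV_nonpos_imp_nonincreasing[of 0 1 \<phi>]) auto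
  then have "exp (- K) * (\<zeta> b \<bullet> \<zeta> b) \<le> 0" using a(2) by (simp add: \<phi>_def c_def w_def)
  then have "\<zeta> b \<bullet> \<zeta> b \<le> 0" by (simp add: mult_le_0_iff)
  then have "\<zeta> b \<bullet> \<zeta> b = 0" using inner_ge_zero[of "\<zeta> b"] by (rule order_antisym)
  then show ?thesis by simp
qed

section \<open>Vector fields in coordinates\<close>

context manifold
begin

definition components :: "('m \<Rightarrow> 'e) \<Rightarrow> 'm vfield \<Rightarrow> 'm \<Rightarrow> 'e" where
  "components \<kappa> Y q = (\<Sum>b\<in>Basis. Y q (\<lambda>r. \<kappa> r \<bullet> b) *\<^sub>R b)"

lemma components_inner: "b \<in> Basis \<Longrightarrow> components \<kappa> Y q \<bullet> b = Y q (\<lambda>r. \<kappa> r \<bullet> b)"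
  by (simp add: components_def inner_sum_left inner_Basis if_distrib cong: if_cong)

lemma smooth_field_components:
  assumes Y: "smooth_field Y" and c: "(U, \<kappa>) \<in> A" "q \<in> U" and f: "smooth_near A q f"
  shows "Y q f = chart_deriv U \<kappa> q f (components \<kappa> Y q)"
  unfolding components_def by (rule tangent_space_coordinates[OF smooth_field_tangent[OF Y] c f])

lemma smooth_on_component:
  assumes Y: "smooth_field Y" and c: "(U, \<kappa>) \<in> A"
  shows "smooth_on (\<lambda>a. Y (inv_into U \<kappa> a) (\<lambda>r. \<kappa> r \<bullet> b)) (\<kappa> ` U)"
proof (rule smooth_on_local)
  fix a assume "a \<in> \<kappa> ` U"
  then obtain q where q: "q \<in> U" "a = \<kappa> q" by blast
  have "smooth_near A q (\<lambda>q. Y q (\<lambda>r. \<kappa> r \<bullet> b))"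
    by (rule smooth_field_apply[OF Y smooth_near_coordinate[OF c q(1)]])
  then obtain W where "open W" "\<kappa> q \<in> W" "W \<subseteq> \<kappa> ` U"
    "smooth_on (\<lambda>a. Y (inv_into U \<kappa> a) (\<lambda>r. \<kappa> r \<bullet> b)) W"
    using smooth_near_chartE[OF c q(1)] by blast
  then show "\<exists>W. open W \<and> a \<in> W \<and> smooth_on (\<lambda>a. Y (inv_into U \<kappa> a) (\<lambda>r. \<kappa> r \<bullet> b)) W"
    using q(2) by blast
qed

lemma smooth_on_sum:
  fixes f :: "'i \<Rightarrow> 'a::euclidean_space \<Rightarrow> 'b::real_normed_vector"
  assumes "open W" "\<And>i. i \<in> I \<Longrightarrow> smooth_on (f i) W"
  shows "smooth_on (\<lambda>x. \<Sum>i\<in>I. f i x) W"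
  by (rule smooth_onI, rule Ck_on_sum[OF assms(1) smooth_onD[OF assms(2)]])

lemma smooth_on_components:
  assumes Y: "smooth_field Y" and c: "(U, \<kappa>) \<in> A"
  shows "smooth_on (\<lambda>a. components \<kappa> Y (inv_into U \<kappa> a)) (\<kappa> ` U)"
  unfolding components_def
proof (rule smooth_on_sum[OF chart_image_open[OF c]])
  fix b :: 'e
  show "smooth_on (\<lambda>a. Y (inv_into U \<kappa> a) (\<lambda>r. \<kappa> r \<bullet> b) *\<^sub>R b) (\<kappa> ` U)"
    by (rule smooth_on_bounded_linear[OF chart_image_open[OF c] bounded_linear_scaleR_left
          smooth_on_component[OF Y c]])
qed

lemma components_derivative:
  assumes Y: "smooth_field Y" and Z: "smooth_field Z" and c: "(U, \<kappa>) \<in> A" and q: "q \<in> U"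
    and b: "b \<in> Basis"
  shows "fderiv (\<lambda>a. components \<kappa> Y (inv_into U \<kappa> a)) (at (\<kappa> q)) (components \<kappa> Z q) \<bullet> b =
    Z q (\<lambda>q. Y q (\<lambda>r. \<kappa> r \<bullet> b))"
proof -
  have "\<kappa> q \<in> \<kappa> ` U" using q by simp
  from smooth_on_has_derivative[OF smooth_on_components[OF Y c] this]
  have "((\<lambda>a. components \<kappa> Y (inv_into U \<kappa> a) \<bullet> b) has_derivative
    (\<lambda>w. fderiv (\<lambda>a. components \<kappa> Y (inv_into U \<kappa> a)) (at (\<kappa> q)) w \<bullet> b)) (at (\<kappa> q))"
    by (rule bounded_linear.has_derivative[OF bounded_linear_inner_left])
  from frechet_derivativeI[OF this]
  have "fderiv (\<lambda>a. components \<kappa> Y (inv_into U \<kappa> a)) (at (\<kappa> q)) w \<bullet> b =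
    fderiv (\<lambda>a. Y (inv_into U \<kappa> a) (\<lambda>r. \<kappa> r \<bullet> b)) (at (\<kappa> q)) w" for w
    by (simp add: components_inner[OF b] fun_eq_iff)
  then show ?thesis
    using smooth_field_components[OF Z c q smooth_field_apply[OF Y smooth_near_coordinate[OF c q]]]
    by simp
qed

text \<open>In coordinates the bracket is the difference of two directional derivatives. For a frame
  field \<open>Y\<close>, the derivative of \<open>Z\<close> along \<open>Y\<close> is thus traded
  for an expression linear in the value of \<open>Z\<close>.\<close>

lemma commuting_components:
  assumes Y: "smooth_field Y" and Z: "smooth_field Z" and c: "(U, \<kappa>) \<in> A" and q: "q \<in> U"
    and comm: "vf_bracket A Z Y = vf_zero"
  shows "fderiv (\<lambda>a. components \<kappa> Z (inv_into U \<kappa> a)) (at (\<kappa> q)) (components \<kappa> Y q) =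
    fderiv (\<lambda>a. components \<kappa> Y (inv_into U \<kappa> a)) (at (\<kappa> q)) (components \<kappa> Z q)"
proof (rule euclidean_eqI)
  fix b :: 'e assume b: "b \<in> Basis"
  have "vf_bracket A Z Y q (\<lambda>r. \<kappa> r \<bullet> b) = 0" by (simp add: comm vf_zero_def)
  then show "fderiv (\<lambda>a. components \<kappa> Z (inv_into U \<kappa> a)) (at (\<kappa> q)) (components \<kappa> Y q) \<bullet> b =
    fderiv (\<lambda>a. components \<kappa> Y (inv_into U \<kappa> a)) (at (\<kappa> q)) (components \<kappa> Z q) \<bullet> b"
    by (simp add: components_derivative[OF Y Z c q b] components_derivative[OF Z Y c q b]
        vf_bracket_eq smooth_near_coordinate[OF c q])
qed

end

context lie_group_with_algebra
begin

text \<open>The coordinates of the translation fields form a frame, so a field commuting with all of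
  them satisfies a homogeneous linear first order system.\<close>
lemma commuting_field_locally_zero:
  assumes Z: "smooth_field Z" and comm: "\<And>u. vf_bracket \<A> Z (X u) = vf_zero"
  obtains N where "open N" "p \<in> N" "\<forall>q\<in>N. \<forall>q'\<in>N. Z q = (\<lambda>f. 0) \<longrightarrow> Z q' = (\<lambda>f. 0)"
proof -
  obtain U \<kappa> where c: "(U, \<kappa>) \<in> \<A>" "p \<in> U" by (rule chart_cover)
  let ?i = "inv_into U \<kappa>" and ?V = "\<kappa> ` U"
  have opV: "open ?V" using c(1) by (rule chart_image_open)
  define \<zeta> where "\<zeta> = (\<lambda>a. components \<kappa> Z (?i a))"
  define \<xi> where "\<xi> = (\<lambda>u a. components \<kappa> (X u) (?i a))"
  have \<zeta>s: "smooth_on \<zeta> ?V" unfolding \<zeta>_def by (rule smooth_on_components[OF Z c(1)])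
  have \<xi>s: "smooth_on (\<xi> u) ?V" for u
    unfolding \<xi>_def by (rule smooth_on_components[OF translation_smooth_field c(1)])
  have \<xi>lin: "linear (\<lambda>u. \<xi> u a)" for a
    unfolding \<xi>_def components_def
    by (rule linearI) (simp_all add: translation_add translation_scale vf_add_def vf_scale_def
        scaleR_add_left sum.distrib scaleR_sum_right)
  have \<xi>inj: "u = 0" if "\<xi> u a = 0" "a \<in> ?V" for u a
  proof (rule translation_pointwise_inj)
    fix f assume f: "smooth_near \<A> (?i a) f"
    have q: "?i a \<in> U" by (rule chart_inv_in[OF c(1) that(2)])
    have "linear (fderiv (\<lambda>a. f (?i a)) (at (\<kappa> (?i a))))"
      by (rule has_derivative_linear[OF smooth_near_has_derivative[OF c(1) q f]])
    then show "X u (?i a) f = 0"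
      using that(1) by (simp add: smooth_field_components[OF translation_smooth_field c(1) q f] \<xi>_def linear_0)
  qed
  have \<xi>exp: "\<xi> u a = (\<Sum>d\<in>Basis. (u \<bullet> d) *\<^sub>R \<xi> d a)" for u a
    using linear_sum[OF \<xi>lin[of a], of "\<lambda>d. (u \<bullet> d) *\<^sub>R d" Basis]
    by (simp add: euclidean_representation linear_cmul[OF \<xi>lin])
  let ?a = "\<kappa> p"
  have a: "?a \<in> ?V" using c by blast
  obtain m where m: "0 < m" "\<And>u. m * norm u \<le> norm (\<xi> u ?a)"
  proof (rule linear_inj_bounded_below_pos[OF \<xi>lin[of ?a]])
    show "inj (\<lambda>u. \<xi> u ?a)"
      using \<xi>inj[OF _ a] by (simp add: linear_injective_0[OF \<xi>lin])
  qed (auto simp: mult.commute)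
  \<comment> \<open>\<open>E\<close> measures how far the frame has moved from its value at
    \<open>p\<close>; below \<open>m / 2\<close> it leaves half of the lower bound \<open>m\<close>.
    \<open>C\<close> bounds the first derivatives of the frame, and \<open>L\<close> below combines
    the two bounds.\<close>
  define E where "E = (\<lambda>a. \<Sum>d\<in>Basis. norm (\<xi> d a - \<xi> d ?a))"
  define C where "C = (\<lambda>a. \<Sum>d\<in>Basis. \<Sum>k\<in>Basis. norm (fderiv (\<xi> d) (at a) k))"
  have "continuous_on ?V E"
    unfolding E_def by (intro continuous_intros smooth_on_continuous[OF \<xi>s])
  then have "open (?V \<inter> E -` {..<m / 2})"
    by (rule continuous_open_preimage[OF _ opV open_lessThan])
  moreover have "continuous_on ?V C"
    unfolding C_def by (intro continuous_intros smooth_on_continuous[OF smooth_on_derivative[OF \<xi>s]])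
  then have "open (?V \<inter> C -` {..<C ?a + 1})"
    by (rule continuous_open_preimage[OF _ opV open_lessThan])
  ultimately have "open ((?V \<inter> E -` {..<m / 2}) \<inter> (?V \<inter> C -` {..<C ?a + 1}))"
    by (rule open_Int)
  moreover have "?a \<in> (?V \<inter> E -` {..<m / 2}) \<inter> (?V \<inter> C -` {..<C ?a + 1})"
    using a m(1) by (simp add: E_def)
  ultimately obtain r where r: "0 < r" "ball ?a r \<subseteq> (?V \<inter> E -` {..<m / 2}) \<inter> (?V \<inter> C -` {..<C ?a + 1})"
    using open_contains_ball by blast
  let ?B = "ball ?a r"
  have BV: "?B \<subseteq> ?V" and BE: "E b < m / 2" and BC: "C b < C ?a + 1" if "b \<in> ?B" for b
    using r(2) that by auto
  define L where "L = (C ?a + 1) * (2 / m)"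
  have C0: "0 \<le> C b" for b by (simp add: C_def sum_nonneg)
  have lower: "(m / 2) * norm u \<le> norm (\<xi> u b)" if b: "b \<in> ?B" for u b
  proof -
    have "\<xi> u b - \<xi> u ?a = (\<Sum>d\<in>Basis. (u \<bullet> d) *\<^sub>R (\<xi> d b - \<xi> d ?a))"
      unfolding \<xi>exp[of u b] \<xi>exp[of u ?a] by (simp add: scaleR_diff_right sum_subtractf)
    then have "norm (\<xi> u b - \<xi> u ?a) \<le> (\<Sum>d\<in>Basis. norm ((u \<bullet> d) *\<^sub>R (\<xi> d b - \<xi> d ?a)))"
      using norm_sum by metis
    also have "\<dots> \<le> (\<Sum>d\<in>Basis. norm u * norm (\<xi> d b - \<xi> d ?a))"
      by (intro sum_mono) (simp add: mult_right_mono Basis_le_norm)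
    also have "\<dots> = norm u * E b" by (simp add: E_def sum_distrib_left)
    also have "\<dots> \<le> norm u * (m / 2)" using BE[OF b] by (intro mult_left_mono) auto
    finally have "norm (\<xi> u b - \<xi> u ?a) \<le> norm u * (m / 2)" .
    moreover have "norm (\<xi> u ?a) \<le> norm (\<xi> u b) + norm (\<xi> u b - \<xi> u ?a)"
      using norm_triangle_ineq4[of "\<xi> u b" "\<xi> u b - \<xi> u ?a"] by simp
    ultimately show ?thesis using m(2)[of u] by (simp add: mult.commute)
  qed
  have upper: "norm (fderiv (\<xi> u) (at b) w) \<le> norm u * (norm w * C b)" if b: "b \<in> ?B" for u b w
  proof -
    have bV: "b \<in> ?V" using BV[OF b] b by blast
    have "(\<xi> u has_derivative (\<lambda>w. \<Sum>d\<in>Basis. (u \<bullet> d) *\<^sub>R fderiv (\<xi> d) (at b) w)) (at b)"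
      unfolding \<xi>exp[of u, abs_def]
      by (intro has_derivative_sum has_derivative_scaleR_right smooth_on_has_derivative[OF \<xi>s bV])
    from frechet_derivativeI[OF this]
    have "fderiv (\<xi> u) (at b) w = (\<Sum>d\<in>Basis. (u \<bullet> d) *\<^sub>R fderiv (\<xi> d) (at b) w)"
      by simp
    then have "norm (fderiv (\<xi> u) (at b) w) \<le>
        (\<Sum>d\<in>Basis. norm ((u \<bullet> d) *\<^sub>R fderiv (\<xi> d) (at b) w))"
      using norm_sum by metis
    also have "\<dots> \<le> (\<Sum>d\<in>Basis. norm u * (norm w * (\<Sum>k\<in>Basis. norm (fderiv (\<xi> d) (at b) k))))"
    proof (intro sum_mono)
      fix d :: 's assume d: "d \<in> Basis"
      have lin: "linear (fderiv (\<xi> d) (at b))"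
        by (rule has_derivative_linear[OF smooth_on_has_derivative[OF \<xi>s bV]])
      have "fderiv (\<xi> d) (at b) w = (\<Sum>k\<in>Basis. (w \<bullet> k) *\<^sub>R fderiv (\<xi> d) (at b) k)"
        using linear_sum[OF lin, of "\<lambda>k. (w \<bullet> k) *\<^sub>R k" Basis]
        by (simp add: euclidean_representation linear_cmul[OF lin])
      then have "norm (fderiv (\<xi> d) (at b) w) \<le>
          (\<Sum>k\<in>Basis. norm ((w \<bullet> k) *\<^sub>R fderiv (\<xi> d) (at b) k))"
        using norm_sum by metis
      also have "\<dots> \<le> (\<Sum>k\<in>Basis. norm w * norm (fderiv (\<xi> d) (at b) k))"
        by (intro sum_mono) (simp add: mult_right_mono Basis_le_norm)
      finally have "norm (fderiv (\<xi> d) (at b) w) \<le>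
          norm w * (\<Sum>k\<in>Basis. norm (fderiv (\<xi> d) (at b) k))"
        by (simp add: sum_distrib_left)
      then show "norm ((u \<bullet> d) *\<^sub>R fderiv (\<xi> d) (at b) w) \<le>
          norm u * (norm w * (\<Sum>k\<in>Basis. norm (fderiv (\<xi> d) (at b) k)))"
        using Basis_le_norm[OF d, of u] by (simp add: mult_mono)
    qed
    also have "\<dots> = norm u * (norm w * C b)" by (simp add: C_def sum_distrib_left)
    finally show ?thesis .
  qed
  have bound: "norm (fderiv \<zeta> (at b) w) \<le> L * norm w * norm (\<zeta> b)" if b: "b \<in> ?B" for b w
  proof -
    have bV: "b \<in> ?V" using BV[OF b] b by blast
    have q: "?i b \<in> U" "\<kappa> (?i b) = b" using chart_inv[OF c(1)] bV by auto
    have "inj (\<lambda>u. \<xi> u b)"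
      using \<xi>inj[OF _ bV] by (simp add: linear_injective_0[OF \<xi>lin])
    then have "surj (\<lambda>u. \<xi> u b)"
      by (rule linear_injective_imp_surjective[OF \<xi>lin]) simp
    \<comment> \<open>Every direction \<open>w\<close> is a value of a translation field with
      \<open>u\<close> bounded by \<open>2 / m\<close> times \<open>norm w\<close>, so commutation
      controls the full derivative of \<open>\<zeta>\<close>.\<close>
    then obtain u where u: "w = \<xi> u b" by (metis surjD)
    have "fderiv \<zeta> (at b) (\<xi> u b) = fderiv (\<xi> u) (at b) (\<zeta> b)"
      using commuting_components[OF translation_smooth_field Z c(1) q(1) comm, of u]
      unfolding \<zeta>_def \<xi>_def q(2) .
    then have "norm (fderiv \<zeta> (at b) w) \<le> norm u * (norm (\<zeta> b) * C b)"
      using upper[OF b, of u "\<zeta> b"] u by simp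
    also have "\<dots> \<le> (2 / m * norm w) * (norm (\<zeta> b) * (C ?a + 1))"
    proof (intro mult_mono mult_nonneg_nonneg C0)
      show "norm u \<le> 2 / m * norm w" using lower[OF b, of u] m(1) u by (simp add: field_simps)
      show "C b \<le> C ?a + 1" using BC[OF b] by simp
      show "0 \<le> 2 / m" using m(1) by simp
    qed simp_all
    finally show ?thesis by (simp add: L_def ac_simps)
  qed
  have Z0: "Z (?i b) = (\<lambda>f. 0) \<longleftrightarrow> \<zeta> b = 0" if b: "b \<in> ?B" for b
  proof
    assume "Z (?i b) = (\<lambda>f. 0)"
    then show "\<zeta> b = 0" by (simp add: \<zeta>_def components_def)
  next
    assume 0: "\<zeta> b = 0"
    have q: "?i b \<in> U" using chart_inv_in[OF c(1)] BV[OF b] b by blast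
    show "Z (?i b) = (\<lambda>f. 0)"
    proof
      fix f show "Z (?i b) f = 0"
      proof (cases "smooth_near \<A> (?i b) f")
        case True
        have "linear (fderiv (\<lambda>a. f (?i a)) (at (\<kappa> (?i b))))"
          by (rule has_derivative_linear[OF smooth_near_has_derivative[OF c(1) q True]])
        then show ?thesis
          using 0 by (simp add: smooth_field_components[OF Z c(1) q True] \<zeta>_def linear_0)
      qed (rule tangent_space_not_smooth[OF smooth_field_tangent[OF Z]])
    qed
  qed
  have propagate: "\<zeta> b' = 0" if "b \<in> ?B" "b' \<in> ?B" "\<zeta> b = 0" for b b'
  proof (rule zero_propagates[of ?B \<zeta> "\<lambda>b. fderiv \<zeta> (at b)" L,
          OF convex_ball _ bound that(1,3,2)])
    show "(\<zeta> has_derivative fderiv \<zeta> (at b)) (at b)" if "b \<in> ?B" for b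
      using BV[OF that] that by (intro smooth_on_has_derivative[OF \<zeta>s]) blast
  qed
  show thesis
  proof (rule that)
    show "open (U \<inter> \<kappa> -` ?B)" by (rule chart_preimage_open[OF c(1) open_ball])
    show "p \<in> U \<inter> \<kappa> -` ?B" using c r(1) by simp
    show "\<forall>q\<in>U \<inter> \<kappa> -` ?B. \<forall>q'\<in>U \<inter> \<kappa> -` ?B. Z q = (\<lambda>f. 0) \<longrightarrow> Z q' = (\<lambda>f. 0)"
    proof (intro ballI impI)
      fix q q' assume q: "q \<in> U \<inter> \<kappa> -` ?B" "q' \<in> U \<inter> \<kappa> -` ?B" and "Z q = (\<lambda>f. 0)"
      then have "\<zeta> (\<kappa> q) = 0" using Z0[of "\<kappa> q"] by (simp add: chart_inv_left[OF c(1)])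
      then have "\<zeta> (\<kappa> q') = 0" using propagate[of "\<kappa> q" "\<kappa> q'"] q by simp
      then show "Z q' = (\<lambda>f. 0)" using Z0[of "\<kappa> q'"] q by (simp add: chart_inv_left[OF c(1)])
    qed
  qed
qed

lemma commuting_field_zero:
  assumes Z: "smooth_field Z" and comm: "\<And>u. vf_bracket \<A> Z (X u) = vf_zero"
    and conn: "connected (UNIV :: 'g set)" and Ze: "Z e = (\<lambda>f. 0)"
  shows "Z = vf_zero"
proof -
  define T where "T = {p. Z p = (\<lambda>f. 0)}"
  have "open T"
  proof (subst open_subopen, intro ballI)
    fix p assume p: "p \<in> T"
    obtain N where N: "open N" "p \<in> N" "\<forall>q\<in>N. \<forall>q'\<in>N. Z q = (\<lambda>f. 0) \<longrightarrow> Z q' = (\<lambda>f. 0)"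
      using commuting_field_locally_zero[OF Z comm] .
    have "N \<subseteq> T" using N(2,3) p by (auto simp: T_def)
    then show "\<exists>N. open N \<and> p \<in> N \<and> N \<subseteq> T" using N by blast
  qed
  \<comment> \<open>A zero anywhere in \<open>N\<close> would force a zero at \<open>p\<close>, as
    the local statement holds for any two points of \<open>N\<close>.\<close>
  moreover have "open (- T)"
  proof (subst open_subopen, intro ballI)
    fix p assume p: "p \<in> - T"
    obtain N where N: "open N" "p \<in> N" "\<forall>q\<in>N. \<forall>q'\<in>N. Z q = (\<lambda>f. 0) \<longrightarrow> Z q' = (\<lambda>f. 0)"
      using commuting_field_locally_zero[OF Z comm] .
    have "N \<subseteq> - T"
    proof
      fix q assume "q \<in> N"
      then show "q \<in> - T" using N(2,3) p unfolding T_def by blast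
    qed
    then show "\<exists>N. open N \<and> p \<in> N \<and> N \<subseteq> - T" using N by blast
  qed
  ultimately have "T = {} \<or> T = UNIV"
    using conn by (simp add: connected_clopen closed_def)
  moreover have "e \<in> T" using Ze by (simp add: T_def)
  ultimately have "T = UNIV" by blast
  then have "Z p = (\<lambda>f. 0)" for p unfolding T_def by blast
  then show ?thesis by (simp add: vf_zero_def fun_eq_iff)
qed

section \<open>From vector fields to the abstract modification\<close>

lemma normalizer_isotropy: "Z \<in> normalizer_in_isotropy G \<iota> \<Longrightarrow> Z \<in> isotropy_algebra G \<iota>"
  by (simp add: normalizer_in_isotropy_def)

lemma transf_bracket_eq: "transf_bracket \<A> Y Z p f = - vf_bracket \<A> Y Z p f"
  by (simp add: transf_bracket_def vf_scale_def)

lemma translation_bracket_eq: "vf_bracket \<A> (X u) (X v) p f = - X (br u v) p f"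
  by (simp add: translation_bracket vf_scale_def)

lemma iota_diff: "\<iota> (u - v) f = \<iota> u f - \<iota> v f"
  using iota_add[of "u - v" v f] by simp

text \<open>Since \<open>Z\<close> vanishes at \<open>e\<close>, one of the two terms of the bracket drops out there.\<close>
lemma isotropy_bracket_e:
  assumes Z: "Z \<in> isotropy_algebra G \<iota>" and w: "transf_bracket \<A> Z (X u) = X w"
    and f: "smooth_near \<A> e f"
  shows "\<iota> w f = \<iota> u (\<lambda>q. Z q f)"
proof -
  have "\<iota> w f = transf_bracket \<A> Z (X u) e f" by (simp add: w translation_e)
  also have "\<dots> = \<iota> u (\<lambda>q. Z q f)"
    using isotropy_e[OF Z] by (simp add: transf_bracket_eq vf_bracket_eq f translation_e)
  finally show ?thesis .
qed

text \<open>\<open>D u v\<close> is the vector whose translation field is the bracket of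
  \<open>\<phi> u\<close> with \<open>X v\<close>; it exists because \<open>\<phi> u\<close>
  normalises the translation fields. The conditions on \<open>D\<close> are verified by evaluating
  identities between fields at \<open>e\<close>.\<close>

lemma modification_normal:
  assumes lie: "lie_algebra br" and cs: "completely_solvable br"
    and conn: "connected (UNIV :: 'g set)" and R: "modification G \<iota> R"
  shows "normal_modification G \<iota> R"
proof -
  obtain \<phi> where N: "\<And>u. \<phi> u \<in> normalizer_in_isotropy G \<iota>"
    and \<phi>_add: "\<And>u v. \<phi> (u + v) = vf_add (\<phi> u) (\<phi> v)"
    and \<phi>_scale: "\<And>c u. \<phi> (c *\<^sub>R u) = vf_scale c (\<phi> u)"
    and Req: "R = {vf_add (X u) (\<phi> u) |u. True}"
    and sub: "lie_subalgebra_of_isometries G \<iota> R"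
    using R unfolding modification_def by blast
  have iso: "\<phi> u \<in> isotropy_algebra G \<iota>" for u using N by (rule normalizer_isotropy)
  note \<phi>s = isotropy_smooth_field[OF iso] and Xs = translation_smooth_field
  have "\<exists>w. transf_bracket \<A> (\<phi> u) (X v) = X w" for u v
    using N[of u] unfolding normalizer_in_isotropy_def by blast
  then obtain D where D: "\<And>u v. transf_bracket \<A> (\<phi> u) (X v) = X (D u v)" by metis
  have Df: "\<iota> (D u v) f = \<iota> v (\<lambda>q. \<phi> u q f)" if "smooth_near \<A> e f" for u v f
    by (rule isotropy_bracket_e[OF iso D that])
  have D': "vf_bracket \<A> (\<phi> u) (X v) p f = - X (D u v) p f" for u v p f
    using D[of u v] transf_bracket_eq[of "\<phi> u" "X v" p f] by simp
  have D'': "vf_bracket \<A> (X v) (\<phi> u) p f = X (D u v) p f" for u v p f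
    using D'[of u v p f] vf_bracket_swap[of "X v" "\<phi> u"] by (simp add: vf_scale_def)
  have D_skew: "D u v \<bullet> w = - (v \<bullet> D u w)" for u v w
    by (rule isotropy_skew[OF iso Df])
  have Dlin: "linear (D u)" for u
    by (rule linearI; rule iota_eqI) (simp_all add: Df iota_add iota_scale)
  have Dlin': "linear (\<lambda>u. D u v)" for v
  proof (rule linearI; rule iota_eqI)
    fix u u' f assume f: "smooth_near \<A> e f"
    show "\<iota> (D (u + u') v) f = \<iota> (D u v + D u' v) f"
      by (simp add: Df f iota_add \<phi>_add vf_add_def
          tangent_space_add[OF iota_tangent smooth_field_apply[OF \<phi>s f] smooth_field_apply[OF \<phi>s f]])
  next
    fix c u f assume f: "smooth_near \<A> e f"
    show "\<iota> (D (c *\<^sub>R u) v) f = \<iota> (c *\<^sub>R D u v) f"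
      by (simp add: Df f iota_scale \<phi>_scale vf_scale_def
          tangent_space_cmult[OF iota_tangent smooth_field_apply[OF \<phi>s f]])
  qed
  have bracket_sum: "vf_bracket \<A> (vf_add (X u) (\<phi> u)) (vf_add (X v) (\<phi> v)) p f =
      - X (br u v) p f + X (D v u) p f - X (D u v) p f + vf_bracket \<A> (\<phi> u) (\<phi> v) p f"
    if f: "smooth_near \<A> p f" for u v p f
  proof -
    note t = tangent_space_add[OF smooth_field_tangent smooth_field_apply smooth_field_apply, OF _ _ f _ f]
    have "vf_bracket \<A> (vf_add (X u) (\<phi> u)) (vf_add (X v) (\<phi> v)) p f =
       vf_bracket \<A> (X u) (X v) p f + vf_bracket \<A> (X u) (\<phi> v) p f +
       vf_bracket \<A> (\<phi> u) (X v) p f + vf_bracket \<A> (\<phi> u) (\<phi> v) p f"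
      by (simp add: vf_bracket_eq f vf_add_def t[OF Xs Xs \<phi>s] t[OF \<phi>s Xs \<phi>s])
    then show ?thesis by (simp add: translation_bracket_eq D' D'')
  qed
  have closed: "\<phi> (br u v + D u v - D v u) = transf_bracket \<A> (\<phi> u) (\<phi> v)" for u v
  proof -
    have "transf_bracket \<A> (vf_add (X u) (\<phi> u)) (vf_add (X v) (\<phi> v)) \<in> R"
      using sub unfolding lie_subalgebra_of_isometries_def Req by blast
    then obtain w where w: "transf_bracket \<A> (vf_add (X u) (\<phi> u)) (vf_add (X v) (\<phi> v)) = vf_add (X w) (\<phi> w)"
      unfolding Req by blast
    have eq: "X w p f + \<phi> w p f = X (br u v) p f - X (D v u) p f + X (D u v) p f + transf_bracket \<A> (\<phi> u) (\<phi> v) p f"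
      if "smooth_near \<A> p f" for p f
      using fun_cong[OF fun_cong[OF w], of p f] bracket_sum[OF that, of u v]
      by (simp add: transf_bracket_eq vf_add_def)
    \<comment> \<open>At \<open>e\<close> the isotropy fields and their brackets vanish, so
      comparing values there determines \<open>w\<close>. The translation parts then cancel at every
      point, and the isotropy parts must agree.\<close>
    have w_eq: "w = br u v + D u v - D v u"
    proof (rule iota_eqI)
      fix f assume f: "smooth_near \<A> e f"
      have "\<iota> (br u v + D u v - D v u) f = \<iota> (br u v) f + \<iota> (D u v) f - \<iota> (D v u) f"
        by (simp add: iota_add iota_diff)
      then show "\<iota> w f = \<iota> (br u v + D u v - D v u) f"
        using eq[OF f] by (simp add: translation_e isotropy_e[OF iso] transf_bracket_eq vf_bracket_eq f)
    qed
    have Xw: "X w p f = X (br u v) p f - X (D v u) p f + X (D u v) p f" for p f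
    proof -
      have "X (w + D v u) = X (br u v + D u v)" by (simp add: w_eq)
      from fun_cong[OF fun_cong[OF this], of p f] show ?thesis
        by (simp add: translation_add vf_add_def)
    qed
    have "\<phi> w = transf_bracket \<A> (\<phi> u) (\<phi> v)"
    proof (rule ext, rule ext)
      fix p f show "\<phi> w p f = transf_bracket \<A> (\<phi> u) (\<phi> v) p f"
      proof (cases "smooth_near \<A> p f")
        case True
        from eq[OF True] show ?thesis by (simp add: Xw)
      next
        case False
        then show ?thesis using tangent_space_not_smooth[OF smooth_field_tangent[OF \<phi>s]]
          by (simp add: transf_bracket_eq vf_bracket_def)
      qed
    qed
    then show ?thesis by (simp add: w_eq)
  qed
  interpret skew_modification br D
  proof (rule skew_modification.intro)
    show "lie_algebra br" by fact
    show "real_spectrum (br x)" for x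
    proof (rule real_spectrum_if_real_eigenvalues)
      show "linear (br x)" using lie by (simp add: lie_algebra_def)
      show "\<mu> \<in> \<real>" if "complex_eigenvalue (br x) \<mu>" for \<mu>
        using cs that by (auto simp: completely_solvable_def)
    qed
    show "linear (\<lambda>x. D x v)" for v by (rule Dlin')
    show "skew_map (D x)" for x using D_skew Dlin by (simp add: skew_map_def)
    \<comment> \<open>The Jacobi identity for \<open>\<phi> x\<close>, \<open>X y\<close> and
      \<open>X z\<close>, read at \<open>e\<close>.\<close>
    show "D x (br y z) = br (D x y) z + br y (D x z)" for x y z
    proof (rule iota_eqI)
      fix f assume f: "smooth_near \<A> e f"
      have "vf_bracket \<A> (\<phi> x) (vf_bracket \<A> (X y) (X z)) e f = vf_bracket \<A> (vf_bracket \<A> (\<phi> x) (X y)) (X z) e f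
         + vf_bracket \<A> (X y) (vf_bracket \<A> (\<phi> x) (X z)) e f"
        by (simp add: vf_bracket_jacobi[OF \<phi>s Xs Xs] vf_add_def)
      moreover have "vf_bracket \<A> (X y) (X z) = X (- br y z)" for y z
        using translation_scale[of "- 1" "br y z"] by (simp add: translation_bracket)
      moreover have "vf_bracket \<A> (\<phi> x) (X z) = X (- D x z)" for z
        using translation_scale[of "- 1" "D x z"] D'[of x z] by (simp add: vf_scale_def fun_eq_iff)
      moreover have "br (- a) b = - br a b" "br a (- b) = - br a b" "D a (- b) = - D a b" for a b
      proof -
        have l: "linear (br a)" "linear (\<lambda>x. br x b)" using lie by (simp_all add: lie_algebra_def)
        show "br (- a) b = - br a b" "br a (- b) = - br a b" "D a (- b) = - D a b"
          using linear_neg[OF l(1)] linear_neg[OF l(2)] linear_neg[OF Dlin] by simp_all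
      qed
      ultimately show "\<iota> (D x (br y z)) f = \<iota> (br (D x y) z + br y (D x z)) f"
        by (simp add: translation_e iota_add)
    qed
    \<comment> \<open>\<open>Df\<close> reverses compositions: \<open>D x (D y v)\<close>
      corresponds to \<open>\<iota> v\<close> applied to \<open>\<phi> y (\<phi> x f)\<close>. The
      reversal absorbs the minus sign of \<open>transf_bracket\<close>.\<close>
    show "D (br x y + D x y - D y x) v = D x (D y v) - D y (D x v)" for x y v
    proof (rule iota_eqI)
      fix f assume f: "smooth_near \<A> e f"
      have "\<iota> (D (br x y + D x y - D y x) v) f = \<iota> v (\<lambda>q. transf_bracket \<A> (\<phi> x) (\<phi> y) q f)"
        by (simp add: Df f closed)
      also have "\<dots> = - \<iota> v (\<lambda>q. vf_bracket \<A> (\<phi> x) (\<phi> y) q f)"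
      proof -
        have fs: "smooth_near \<A> e (\<lambda>q. transf_bracket \<A> (\<phi> x) (\<phi> y) q f)"
          unfolding closed[symmetric] by (rule smooth_field_apply[OF \<phi>s f])
        show ?thesis
          using tangent_space_cmult[OF iota_tangent fs, of v "- 1"] by (simp add: transf_bracket_eq)
      qed
      also have "\<dots> = \<iota> v (\<lambda>q. \<phi> y q (\<lambda>r. \<phi> x r f)) - \<iota> v (\<lambda>q. \<phi> x q (\<lambda>r. \<phi> y r f))"
        by (simp add: tangent_vf_bracket[OF iota_tangent \<phi>s \<phi>s f])
      also have "\<iota> v (\<lambda>q. \<phi> y q (\<lambda>r. \<phi> x r f)) = \<iota> (D x (D y v)) f"
        by (simp add: Df f smooth_field_apply[OF \<phi>s f])
      also have "\<iota> v (\<lambda>q. \<phi> x q (\<lambda>r. \<phi> y r f)) = \<iota> (D y (D x v)) f"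
        by (simp add: Df f smooth_field_apply[OF \<phi>s f])
      also have "\<iota> (D x (D y v)) f - \<iota> (D y (D x v)) f = \<iota> (D x (D y v) - D y (D x v)) f"
        by (simp add: iota_diff)
      finally show "\<iota> (D (br x y + D x y - D y x) v) f = \<iota> (D x (D y v) - D y (D x v)) f" .
    qed
  qed
  have kernel: "\<phi> w = vf_zero" if w: "\<And>v. D w v = 0" for w
  proof (rule commuting_field_zero[OF \<phi>s _ conn])
    have "X 0 p f = 0" for p f using translation_scale[of 0 0] by (simp add: vf_scale_def)
    then show "vf_bracket \<A> (\<phi> w) (X u) = vf_zero" for u
      by (intro ext) (simp add: D' w vf_zero_def)
    show "\<phi> w e = (\<lambda>f. 0)" using isotropy_e[OF iso] by blast
  qed
  have "transf_bracket \<A> (X u) (vf_add (X v) (\<phi> v)) \<in> R" for u v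
  proof -
    \<comment> \<open>The bracket of \<open>X u\<close> with \<open>X v + \<phi> v\<close> is
      \<open>X w\<close>; since \<open>\<phi> w\<close> is zero, this is the element
      \<open>X w + \<phi> w\<close> of \<open>R\<close>.\<close>
    define w where "w = br u v - D v u"
    have "D w x = 0" for x
      unfolding w_def using D_normal cs by (simp add: completely_solvable_def)
    then have \<phi>w: "\<phi> w = vf_zero" by (rule kernel)
    have wX: "X (br u v) p f = X w p f + X (D v u) p f" for p f
    proof -
      have "X (br u v) = X (w + D v u)" by (simp add: w_def)
      then show ?thesis by (simp add: translation_add vf_add_def)
    qed
    have "transf_bracket \<A> (X u) (vf_add (X v) (\<phi> v)) = vf_add (X w) (\<phi> w)"
    proof (rule ext, rule ext)
      fix p f
      have "vf_bracket \<A> (X u) (vf_add (X v) (\<phi> v)) p f =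
          vf_bracket \<A> (X u) (X v) p f + vf_bracket \<A> (X u) (\<phi> v) p f"
        unfolding vf_bracket_add_right[OF Xs Xs \<phi>s] by (simp add: vf_add_def)
      moreover have "vf_add (X w) (\<phi> w) p f = X w p f" by (simp add: vf_add_def \<phi>w vf_zero_def)
      ultimately show "transf_bracket \<A> (X u) (vf_add (X v) (\<phi> v)) p f = vf_add (X w) (\<phi> w) p f"
        by (simp add: transf_bracket_eq translation_bracket_eq D'' wX)
    qed
    then show ?thesis unfolding Req by blast
  qed
  then show ?thesis
    using R unfolding normal_modification_def Req by blast
qed

end

text \<open>Any two loops are freely homotopic, in particular the constant loops at \<open>a\<close>
  and \<open>b\<close>; following one parameter value through the homotopy gives a path from
  \<open>a\<close> to \<open>b\<close>.\<close>

lemma simply_connected_UNIV_imp_connected: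
  assumes "simply_connected (UNIV :: 'a::topological_space set)"
  shows "connected (UNIV :: 'a set)"
proof (rule path_connected_imp_connected)
  have "path_component UNIV a b" for a b :: 'a
  proof -
    have "homotopic_loops UNIV (\<lambda>t::real. a) (\<lambda>t. b)"
      using assms by (auto simp: simply_connected_def path_def pathstart_def pathfinish_def)
    from homotopic_loops_imp_path_component_value[OF this, of 0] show ?thesis by simp
  qed
  then show "path_connected (UNIV :: 'a set)" by (simp add: path_connected_component)
qed

theorem lemma4p3:
  fixes br :: "'s::euclidean_space \<Rightarrow> 's \<Rightarrow> 's"
    and G :: "('g::{t2_space, second_countable_topology}, 's) lie_group_data"
    and \<iota> :: "'s \<Rightarrow> 'g tvec"
    and R :: "'g vfield set"
  assumes "lie_algebra br"
    and "completely_solvable br"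
    and "lie_group G"
    and "simply_connected (UNIV :: 'g set)"
    and "has_lie_algebra G br \<iota>"
    and "modification G \<iota> R"
  shows "normal_modification G \<iota> R"
proof -
  interpret lie_group_with_algebra br G \<iota>
    using assms(3,5) by unfold_locales
  show ?thesis
    by (rule modification_normal[OF assms(1,2) simply_connected_UNIV_imp_connected[OF assms(4)] assms(6)])
qed

end
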